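(* Let $H\cong\mathbb{Z}_{2p^e}$, where $p$ is an odd prime and $e\ge1$, let $H_0$ be the unique subgroup of $H$ of order $p^e$, and let $b$ be the unique involution of $H$. A connected non-bipartite graph $\mathrm{Cay}(H,S)$ is unstable if and only if (1) $e>1$ and $(S\cap H_0)h=S\cap H_0$ for some $h\in H_0$ with $h\ne 1_H$; or (2) $\mathrm{Cay}(H,S)\cong\mathrm{Cay}(H,Sb)$, where $Sb=\{sb:s\in S\}$.
   Context: For a group $H$ and $S\subseteq H$ with $1_H\notin S$ and $S=S^{-1}$, the Cayley graph $\mathrm{Cay}(H,S)$ has vertex set $H$ and edges $\{x,sx\}$ for $x\in H$, $s\in S$. For a graph $\Gamma$, $\Gamma\times K_2$ has vertex set $V(\Gamma)\times\{0,1\}$ and edges $\{(u,0),(v,1)\}$ for $\{u,v\}\in E(\Gamma)$. $\Gamma$ is stable if $\mathrm{Aut}(\Gamma\times K_2)\cong\mathrm{Aut}(\Gamma)\times\mathbb{Z}_2$, and unstable otherwise. *)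

theory Defs
  imports "HOL-Algebra.Elementary_Groups" "HOL-Algebra.Bij" "HOL-Computational_Algebra.Primes"
begin

text \<open>
  Undirected graphs are given by a vertex set and a set of edges, an edge being an unordered pair
  \<open>{u, v}\<close> of vertices. A singleton edge \<open>{u}\<close> is a loop at \<open>u\<close>.
\<close>

record 'a ugraph =
  verts :: "'a set"
  edges :: "'a set set"

definition connected_graph :: "'a ugraph \<Rightarrow> bool" where
  "connected_graph G \<longleftrightarrow>
     verts G \<noteq> {} \<and> (\<forall>u \<in> verts G. \<forall>v \<in> verts G. (u, v) \<in> {(x, y). {x, y} \<in> edges G}\<^sup>*)"

definition bipartite_graph :: "'a ugraph \<Rightarrow> bool" where
  "bipartite_graph G \<longleftrightarrow>
     (\<exists>A B. A \<union> B = verts G \<and> A \<inter> B = {} \<and> (\<forall>E \<in> edges G. \<exists>a \<in> A. \<exists>b \<in> B. E = {a, b}))"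

definition graph_isos :: "'a ugraph \<Rightarrow> 'b ugraph \<Rightarrow> ('a \<Rightarrow> 'b) set" where
  "graph_isos G G' =
     {f. bij_betw f (verts G) (verts G') \<and>
         (\<forall>u \<in> verts G. \<forall>v \<in> verts G. {u, v} \<in> edges G \<longleftrightarrow> {f u, f v} \<in> edges G')}"

definition graph_isomorphic :: "'a ugraph \<Rightarrow> 'b ugraph \<Rightarrow> bool" where
  "graph_isomorphic G G' \<longleftrightarrow> graph_isos G G' \<noteq> {}"

text \<open>
  The carrier of \<^const>\<open>BijGroup\<close> consists of the extensional bijections of the vertex set, so that
  each automorphism is represented by exactly one HOL function.
\<close>

definition graph_Aut :: "'a ugraph \<Rightarrow> ('a \<Rightarrow> 'a) monoid" where
  "graph_Aut G = (BijGroup (verts G))\<lparr>carrier := Bij (verts G) \<inter> graph_isos G G\<rparr>"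

text \<open>
  The direct product of a graph with \<open>K\<^sub>2\<close>. As \<open>{u, v} = {v, u}\<close>, an edge \<open>{u, v}\<close> gives rise to
  both \<open>{(u, 0), (v, 1)}\<close> and \<open>{(v, 0), (u, 1)}\<close>.
\<close>

definition times_K2 :: "'a ugraph \<Rightarrow> ('a \<times> nat) ugraph" where
  "times_K2 G = \<lparr>verts = verts G \<times> {0, 1}, edges = {{(u, 0), (v, 1)} | u v. {u, v} \<in> edges G}\<rparr>"

definition stable_graph :: "'a ugraph \<Rightarrow> bool" where
  "stable_graph G \<longleftrightarrow> graph_Aut (times_K2 G) \<cong> graph_Aut G \<times>\<times> integer_mod_group 2"

text \<open>
  If \<open>S\<close> contains the identity, the result has a loop at every vertex. This cannot happen for the
  connection sets of a Cayley graph in the strict sense, but it does for \<open>Sb\<close> when \<open>b\<close> is an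
  involution in \<open>S\<close>; a loopless graph is then not isomorphic to \<open>Cay(H, Sb)\<close>.
\<close>

definition Cay :: "('a, 'm) monoid_scheme \<Rightarrow> 'a set \<Rightarrow> 'a ugraph" where
  "Cay H S = \<lparr>verts = carrier H, edges = {{x, s \<otimes>\<^bsub>H\<^esub> x} | x s. x \<in> carrier H \<and> s \<in> S}\<rparr>"

end

theory Submission
  imports Defs Complex_Main
begin

text \<open>
  Identify \<open>H\<close> with the complex roots of unity of order \<open>2 p\<^sup>e\<close>, so that \<open>b = -1\<close>. The graph is
  unstable iff there is a non-diagonal two-fold automorphism, a pair of bijections \<open>(\<alpha>, \<beta>)\<close> with
  \<open>y / x \<in> S \<longleftrightarrow> \<beta> y / \<alpha> x \<in> S\<close>. Counting walks of prime length \<open>q\<close> modulo \<open>q\<close> shows that sets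
  invariant under all two-fold automorphisms stay invariant under taking \<open>q\<close>-th powers; this replaces
  the theory of Schur rings. Let \<open>O\<close> be the orbit of \<open>1\<close>, that is, the set of all \<open>\<beta> 1\<close> with
  \<open>\<alpha> 1 = 1\<close>. If \<open>O\<close> contains an element of order \<open>p\<close>, then \<open>p\<close>-th powers of the orbits inside \<open>S\<close>
  show that \<open>S \<inter> H0\<close> is periodic. Otherwise \<open>O \<subseteq> {1, -1}\<close>, hence \<open>\<beta> = \<plusminus>\<alpha>\<close> pointwise. The sign is
  constant on the cosets of a subgroup outside of which \<open>S\<close> is periodic, and a map with sign \<open>-1\<close>
  on one coset can be copied to all the others, which gives \<open>Cay(H, S) \<cong> Cay(H, Sb)\<close>.
\<close>

subsection \<open>Roots of unity\<close>

text \<open>Walks of odd length are the useful ones: a walk that starts on the \<alpha> side then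
  ends on the \<beta> side. Since n is even, all prime factors of an exponent coprime to n are odd,
  so for such exponents the counting yields Schur's theorem on multipliers. For the exponent p
  different elements collide and only residues of multiplicities survive; both arguments about the
  orbit of 1 reach a multiplicity that would have to be 1 and 0 modulo p at the same time. In the
  case \<beta> = \<plusminus>\<alpha> the obstacle is that the sign may vary. Where it is -1
  throughout, \<alpha> itself exchanges S and -S, but two signs are tied to each other directly only
  if the quotient of the points lies in exactly one of S and -S. So a subgroup with constant sign on
  its cosets has to grow until S is periodic outside it. Constancy alone does not propagate from one
  subgroup to the next; what propagates is a statement on how the sign depends on the action on the
  top layer of the subgroup.\<close>

definition rt :: "nat \<Rightarrow> complex set" where "rt n = {z. z ^ n = 1}"

lemma rt_1 [simp]: "1 \<in> rt n" by (simp add: rt_def)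
lemma rt_mult: "x \<in> rt n \<Longrightarrow> y \<in> rt n \<Longrightarrow> x * y \<in> rt n" by (simp add: rt_def power_mult_distrib)
lemma rt_divide: "x \<in> rt n \<Longrightarrow> y \<in> rt n \<Longrightarrow> x / y \<in> rt n" by (simp add: rt_def power_divide)
lemma rt_power: "x \<in> rt n \<Longrightarrow> x ^ k \<in> rt n"
proof -
  assume "x \<in> rt n"
  moreover have "(x ^ k) ^ n = (x ^ n) ^ k" by (simp add: power_mult[symmetric] mult.commute)
  ultimately show ?thesis by (simp add: rt_def)
qed
lemma rt_nz: "x \<in> rt n \<Longrightarrow> n > 0 \<Longrightarrow> x \<noteq> 0" by (auto simp: rt_def zero_power)
lemma rt_mono: "m dvd n \<Longrightarrow> rt m \<subseteq> rt n" unfolding rt_def dvd_def by (auto simp: power_mult)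
lemma finite_rt: "n > 0 \<Longrightarrow> finite (rt n)" unfolding rt_def by (rule finite_roots_unity) simp
lemma card_rt: "n > 0 \<Longrightarrow> card (rt n) = n" unfolding rt_def by (rule card_roots_unity_eq)

lemma power_gcd_eq_1:
  assumes "(x::complex) ^ a = 1" "x ^ b = 1" "a > 0"
  shows "x ^ gcd a b = 1"
proof -
  obtain u v where "a * u = b * v + gcd a b"
    using bezout_nat[of a b] assms(3) by auto
  then have "x ^ (a * u) = x ^ (b * v) * x ^ gcd a b" by (simp add: power_add)
  then show ?thesis using assms by (simp add: power_mult)
qed

lemma rt_inj_power:
  assumes "n > 0" "coprime k n"
  shows "inj_on (\<lambda>z. z ^ k) (rt n)"
proof (rule inj_onI)
  fix x y assume x: "x \<in> rt n" and y: "y \<in> rt n" and e: "x ^ k = y ^ k"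
  have "(x / y) ^ n = 1" using rt_divide[OF x y] by (simp add: rt_def)
  moreover have "(x / y) ^ k = 1" using e rt_nz[OF y assms(1)] by (simp add: power_divide)
  ultimately have "(x / y) ^ gcd n k = 1" using power_gcd_eq_1 assms(1) by blast
  then show "x = y" using assms rt_nz[OF y] by (simp add: coprime_iff_gcd_eq_1 gcd.commute)
qed

subsection \<open>Counting walks modulo a prime\<close>

lemma funpow_fixed: "(r ^^ d) y = y \<Longrightarrow> (r ^^ (d * a)) y = y"
  by (induction a) (auto simp: funpow_add)

text \<open>The iterates of \<open>r\<close> form an action of a cyclic group of prime order q, so a
  point that is not fixed has exactly q distinct iterates, and these cycles partition the points
  that are not fixed.\<close>

lemma card_fixed_points_mod:
  assumes "finite T" "r ` T \<subseteq> T" "\<And>x. x \<in> T \<Longrightarrow> (r ^^ q) x = x" "prime (q::nat)"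
  shows "card T mod q = card {x \<in> T. r x = x} mod q"
proof -
  define F where "F = {x \<in> T. r x = x}"
  define ob where "ob x = (\<lambda>i. (r ^^ i) x) ` {..<q}" for x
  have q0: "q > 0" using assms(4) prime_gt_0_nat by blast
  have inT: "(r ^^ i) x \<in> T" if "x \<in> T" for x i
    using that assms(2) by (induction i) auto
  have redm: "(r ^^ i) x = (r ^^ (i mod q)) x" if "x \<in> T" for x i
  proof -
    have "(r ^^ (i mod q + q * (i div q))) x = (r ^^ (i mod q)) x"
      using funpow_fixed[OF assms(3)[OF that], of "i div q"] unfolding funpow_add by simp
    then show ?thesis by simp
  qed
  have ob_in: "(r ^^ i) x \<in> ob x" if "x \<in> T" for x i
    unfolding ob_def using redm[OF that, of i] q0 by (metis imageI lessThan_iff mod_less_divisor)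
  have bck: "x = (r ^^ (q - i)) ((r ^^ i) x)" if "x \<in> T" "i < q" for x i
    using assms(3)[OF that(1)] that(2) by (metis comp_apply funpow_add le_add_diff_inverse2 less_imp_le)
  \<comment> \<open>Going on around the cycle leads from \<open>(r ^^ i) x\<close> back to
    \<open>x\<close>, so if the former is fixed they are equal.\<close>
  have fixb: "r x = x" if x: "x \<in> T" and i: "i < q" and f: "r ((r ^^ i) x) = (r ^^ i) x" for x i
  proof -
    have "(r ^^ k) ((r ^^ i) x) = (r ^^ i) x" for k by (induction k) (auto simp: f)
    then have "x = (r ^^ i) x" using bck[OF x i] by metis
    then show ?thesis using f by simp
  qed
  have inj: "inj_on (\<lambda>i. (r ^^ i) x) {..<q}" if x: "x \<in> T - F" for x
  proof -
    have *: False if ij: "i < j" "j < q" "(r ^^ i) x = (r ^^ j) x" for i j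
    proof -
      define y where "y = (r ^^ i) x"
      have d: "(r ^^ (j - i)) y = y"
        using ij unfolding y_def by (metis comp_apply funpow_add le_add_diff_inverse2 less_imp_le)
      have "\<not> q dvd j - i" using ij by (auto dest: dvd_imp_le)
      then have "gcd (j - i) q = 1"
        using prime_imp_coprime[OF assms(4)] by (metis coprime_iff_gcd_eq_1 gcd.commute)
      \<comment> \<open>Both q and j - i are periods of \<open>y\<close>; by Bezout so is 1.\<close>
      then obtain u v where uv: "(j - i) * u = q * v + 1"
        using bezout_nat[of "j - i" q] ij(1) by auto
      have yT: "y \<in> T" using inT x y_def by auto
      have "y = (r ^^ ((j - i) * u)) y" using funpow_fixed[OF d] by simp
      also have "\<dots> = r ((r ^^ (q * v)) y)" by (simp add: uv)
      also have "\<dots> = r y" using funpow_fixed[OF assms(3)[OF yT]] by simp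
      finally have "r y = y" by simp
      then have "r x = x" using fixb[of x i] x ij y_def by auto
      then show False using x F_def by auto
    qed
    show ?thesis by (rule inj_onI) (metis * lessThan_iff linorder_neqE_nat)
  qed
  have sub: "ob x \<subseteq> T - F" if "x \<in> T - F" for x
  proof
    fix w assume "w \<in> ob x"
    then obtain i where "i < q" "w = (r ^^ i) x" unfolding ob_def by blast
    moreover from this have "r w \<noteq> w" using fixb[of x i] that unfolding F_def by blast
    ultimately show "w \<in> T - F" using inT[of x i] that unfolding F_def by blast
  qed
  have cob: "card (ob x) = q" if "x \<in> T - F" for x
    unfolding ob_def using card_image[OF inj[OF that]] by simp
  have obeq: "ob y \<subseteq> ob x" if x: "x \<in> T" and y: "y \<in> ob x" for x y
  proof -
    obtain i where "y = (r ^^ i) x" using y ob_def by auto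
    then have "(r ^^ j) y = (r ^^ (j + i)) x" for j by (simp add: funpow_add)
    then show ?thesis using ob_in[OF x] unfolding ob_def[of y] by auto
  qed
  have un: "\<Union> (ob ` (T - F)) = T - F"
  proof
    show "T - F \<subseteq> \<Union> (ob ` (T - F))"
    proof
      fix x assume x: "x \<in> T - F"
      then have "x \<in> ob x" using ob_in[of x 0] by simp
      then show "x \<in> \<Union> (ob ` (T - F))" using x by blast
    qed
  qed (use sub in blast)
  have dis: "ob x \<inter> ob y = {}" if xy: "x \<in> T - F" "y \<in> T - F" "ob x \<noteq> ob y" for x y
  proof (rule ccontr)
    assume "ob x \<inter> ob y \<noteq> {}"
    then obtain z where z: "z \<in> ob x" "z \<in> ob y" by auto
    have zT: "z \<in> T - F" using sub[OF xy(1)] z by blast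
    have e: "ob z = ob w" if "w \<in> T - F" "z \<in> ob w" for w
    proof (rule card_subset_eq)
      show "ob z \<subseteq> ob w" using obeq[of w z] that by blast
      show "card (ob z) = card (ob w)" using cob that zT by metis
      show "finite (ob w)" unfolding ob_def by simp
    qed
    show False using e[OF xy(1) z(1)] e[OF xy(2) z(2)] xy(3) by simp
  qed
  have "q * card (ob ` (T - F)) = card (\<Union> (ob ` (T - F)))"
  proof (rule card_partition)
    show "finite (ob ` (T - F))" "finite (\<Union> (ob ` (T - F)))" using assms(1) un by simp_all
    show "card c = q" if "c \<in> ob ` (T - F)" for c using cob that by blast
    show "c \<inter> d = {}" if "c \<in> ob ` (T - F)" "d \<in> ob ` (T - F)" "c \<noteq> d" for c d
      using dis that by blast
  qed
  then have "card (T - F) = q * card (ob ` (T - F))" using un by simp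
  moreover have "card T = card F + card (T - F)"
  proof -
    have "F \<subseteq> T" unfolding F_def by blast
    then show ?thesis using assms(1)
      by (metis card_Diff_subset card_mono finite_subset le_add_diff_inverse)
  qed
  ultimately show ?thesis unfolding F_def by simp
qed

text \<open>A walk is stored as its list of steps, so that the walks from x to y depend on y / x
  only. The cardinality is the coefficient of z in the k-th power of the sum of N in the group
  ring.\<close>

definition walks :: "nat \<Rightarrow> complex set \<Rightarrow> complex \<Rightarrow> complex list set" where
  "walks k N z = {xs. length xs = k \<and> set xs \<subseteq> N \<and> prod_list xs = z}"

lemma rotate1_fixed: "rotate1 xs = xs \<Longrightarrow> xs = replicate (length xs) (hd xs)"
proof (cases xs)
  case (Cons a ys)
  assume "rotate1 xs = xs"
  then have "ys @ [a] = a # ys" using Cons by simp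
  then have "ys = replicate (length ys) a"
  proof (induction ys)
    case (Cons b ys)
    then show ?case by auto
  qed auto
  then show ?thesis using Cons by simp
qed simp

lemma finite_walks: "finite N \<Longrightarrow> finite (walks k N z)"
  unfolding walks_def by (rule finite_subset[OF _ finite_lists_length_eq[of N k]]) auto

lemma prod_list_rotate1: "prod_list (rotate1 xs) = (prod_list xs :: complex)"
  by (cases xs) auto

text \<open>The product does not change when a list is rotated, and rotation has order dividing q on
  lists of length q. The fixed lists are the constant ones, one for each q-th root of z in
  N.\<close>

lemma card_walks_prime_mod:
  assumes "finite N" "prime (q::nat)"
  shows "card (walks q N z) mod q = card {n \<in> N. n ^ q = z} mod q"
proof -
  have "card (walks q N z) mod q = card {xs \<in> walks q N z. rotate1 xs = xs} mod q"
  proof (rule card_fixed_points_mod[OF finite_walks[OF assms(1)] _ _ assms(2)])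
    show "rotate1 ` walks q N z \<subseteq> walks q N z"
      by (auto simp: walks_def prod_list_rotate1)
    show "(rotate1 ^^ q) xs = xs" if "xs \<in> walks q N z" for xs
      using that rotate_id[of q xs] by (simp add: walks_def rotate_def)
  qed
  also have "{xs \<in> walks q N z. rotate1 xs = xs} = replicate q ` {n \<in> N. n ^ q = z}"
  proof (intro equalityI subsetI)
    fix xs assume "xs \<in> {xs \<in> walks q N z. rotate1 xs = xs}"
    then have w: "length xs = q" "set xs \<subseteq> N" "prod_list xs = z" and r: "xs = replicate q (hd xs)"
      using rotate1_fixed by (auto simp: walks_def)
    have "hd xs \<in> N" using w assms(2) by (metis hd_in_set length_0_conv not_prime_0 subsetD)
    moreover have "hd xs ^ q = z" using w r by (metis prod_list_replicate)
    ultimately show "xs \<in> replicate q ` {n \<in> N. n ^ q = z}" using r by blast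
  next
    fix xs assume "xs \<in> replicate q ` {n \<in> N. n ^ q = z}"
    then show "xs \<in> {xs \<in> walks q N z. rotate1 xs = xs}" by (auto simp: walks_def rotate1_replicate)
  qed
  also have "card \<dots> = card {n \<in> N. n ^ q = z}"
    by (rule card_image) (use assms(2) in \<open>auto simp: inj_on_def replicate_eq_replicate not_prime_0\<close>)
  finally show ?thesis .
qed

lemma card_walks_Suc:
  assumes "N \<subseteq> rt n" "n > 0" "x \<in> rt n" "y \<in> rt n"
  shows "card (walks (Suc k) N (y / x)) = (\<Sum>v | v \<in> rt n \<and> v / x \<in> N. card (walks k N (y / v)))"
proof -
  have fN: "finite N" using assms finite_rt finite_subset by blast
  have nz: "x \<noteq> 0" "y \<noteq> 0" using assms rt_nz by auto
  define V where "V = {v. v \<in> rt n \<and> v / x \<in> N}"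
  have fV: "finite V" unfolding V_def using finite_rt[OF assms(2)] by auto
  have "walks (Suc k) N (y / x) = (\<Union>v\<in>V. (#) (v / x) ` walks k N (y / v))"
  proof (intro equalityI subsetI)
    fix xs assume "xs \<in> walks (Suc k) N (y / x)"
    then obtain a as where xs: "xs = a # as" "length as = k" "a \<in> N" "set as \<subseteq> N" "a * prod_list as = y / x"
      unfolding walks_def by (cases xs) auto
    have "a \<in> rt n" using xs assms by auto
    then have "a \<noteq> 0" using rt_nz assms by blast
    then have "prod_list as = y / (a * x)" using xs(5) nz by (simp add: field_simps)
    moreover have "a * x \<in> V" using xs nz assms \<open>a \<in> rt n\<close> by (auto simp: V_def rt_mult)
    ultimately show "xs \<in> (\<Union>v\<in>V. (#) (v / x) ` walks k N (y / v))"
      using xs nz by (intro UN_I[of "a * x"]) (auto simp: walks_def)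
  next
    fix xs assume "xs \<in> (\<Union>v\<in>V. (#) (v / x) ` walks k N (y / v))"
    then show "xs \<in> walks (Suc k) N (y / x)"
      using nz rt_nz[OF _ assms(2)] by (auto simp: V_def walks_def)
  qed
  also have "card \<dots> = (\<Sum>v\<in>V. card ((#) (v / x) ` walks k N (y / v)))"
    by (rule card_UN_disjoint) (use fV finite_walks[OF fN] nz in auto)
  also have "\<dots> = (\<Sum>v\<in>V. card (walks k N (y / v)))"
    by (intro sum.cong refl card_image) auto
  finally show ?thesis unfolding V_def .
qed

section \<open>Pairs of maps between Cayley digraphs, and their behaviour under powers\<close>

text \<open>Arcs of the Cayley digraph of \<open>N\<close> go to arcs for \<open>N'\<close> when one
  map is used at the tail and the other at the head. Both assignments are required, so that along a
  walk the two maps can alternate; the sets are not assumed to be closed under inversion. Different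
  \<open>N\<close> and \<open>N'\<close> occur when a map carries one orbit to another.\<close>

definition link :: "nat \<Rightarrow> (complex \<Rightarrow> complex) \<Rightarrow> (complex \<Rightarrow> complex) \<Rightarrow> complex set \<Rightarrow> complex set \<Rightarrow> bool" where
  "link n \<alpha> \<beta> N N' \<longleftrightarrow> (\<forall>x\<in>rt n. \<forall>y\<in>rt n.
     (y / x \<in> N \<longleftrightarrow> \<beta> y / \<alpha> x \<in> N') \<and> (y / x \<in> N \<longleftrightarrow> \<alpha> y / \<beta> x \<in> N'))"

lemma linkD: "link n \<alpha> \<beta> N N' \<Longrightarrow> x \<in> rt n \<Longrightarrow> y \<in> rt n \<Longrightarrow> \<beta> y / \<alpha> x \<in> N' \<longleftrightarrow> y / x \<in> N"
  "link n \<alpha> \<beta> N N' \<Longrightarrow> x \<in> rt n \<Longrightarrow> y \<in> rt n \<Longrightarrow> \<alpha> y / \<beta> x \<in> N' \<longleftrightarrow> y / x \<in> N"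
  unfolding link_def by blast+

lemma link_swap: "link n \<alpha> \<beta> N N' \<Longrightarrow> link n \<beta> \<alpha> N N'"
  unfolding link_def by blast

text \<open>Each step of a walk switches between the two maps, so the parity of the length decides
  which of them is applied at the end point. The induction splits off the first step and exchanges
  the roles of \<alpha> and \<beta>.\<close>

lemma link_walks:
  assumes "n > 0" "N \<subseteq> rt n" "N' \<subseteq> rt n"
  shows "bij_betw \<alpha> (rt n) (rt n) \<Longrightarrow> bij_betw \<beta> (rt n) (rt n) \<Longrightarrow> link n \<alpha> \<beta> N N' \<Longrightarrow>
    x \<in> rt n \<Longrightarrow> y \<in> rt n \<Longrightarrow>
    card (walks k N (y / x)) = card (walks k N' ((if even k then \<alpha> y else \<beta> y) / \<alpha> x))"
proof (induction k arbitrary: \<alpha> \<beta> x)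
  case 0
  have *: "walks 0 M z = (if z = 1 then {[]} else {})" for M z by (auto simp: walks_def)
  have "\<alpha> x \<in> rt n" "\<alpha> y \<in> rt n" using 0 bij_betwE by blast+
  then have "x \<noteq> 0" "\<alpha> x \<noteq> 0" using 0 rt_nz assms by auto
  moreover have "\<alpha> x = \<alpha> y \<longleftrightarrow> x = y" using 0 by (metis bij_betw_inv_into_left)
  ultimately show ?case by (auto simp: *)
next
  case (Suc k)
  let ?g = "\<lambda>y. if even k then \<beta> y else \<alpha> y"
  have im: "\<alpha> v \<in> rt n" "\<beta> v \<in> rt n" if "v \<in> rt n" for v using Suc.prems that bij_betwE by blast+
  have "card (walks (Suc k) N (y / x)) = (\<Sum>v | v \<in> rt n \<and> v / x \<in> N. card (walks k N (y / v)))"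
    using card_walks_Suc assms Suc.prems by blast
  also have "\<dots> = (\<Sum>v | v \<in> rt n \<and> v / x \<in> N. card (walks k N' (?g y / \<beta> v)))"
    by (intro sum.cong refl) (use Suc.IH[of \<beta> \<alpha>] Suc.prems link_swap in \<open>simp\<close>)
  also have "\<dots> = (\<Sum>v | v \<in> rt n \<and> v / \<alpha> x \<in> N'. card (walks k N' (?g y / v)))"
  proof -
    have "bij_betw \<beta> {v. v \<in> rt n \<and> v / x \<in> N} {v. v \<in> rt n \<and> v / \<alpha> x \<in> N'}"
    proof (rule bij_betw_imageI)
      show "inj_on \<beta> {v. v \<in> rt n \<and> v / x \<in> N}"
        by (rule inj_on_subset[OF bij_betw_imp_inj_on[OF Suc.prems(2)]]) auto
      show "\<beta> ` {v. v \<in> rt n \<and> v / x \<in> N} = {v. v \<in> rt n \<and> v / \<alpha> x \<in> N'}"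
      proof (intro equalityI subsetI)
        fix w assume w: "w \<in> {v. v \<in> rt n \<and> v / \<alpha> x \<in> N'}"
        then obtain v where v: "v \<in> rt n" "w = \<beta> v"
          using bij_betw_imp_surj_on[OF Suc.prems(2)] by auto
        then have "v / x \<in> N" using w Suc.prems(3,4) unfolding link_def by auto
        then show "w \<in> \<beta> ` {v. v \<in> rt n \<and> v / x \<in> N}" using v by auto
      qed (use Suc.prems(3,4) im in \<open>auto simp: link_def\<close>)
    qed
    from sum.reindex_bij_betw[OF this, of "\<lambda>v. card (walks k N' (?g y / v))"] show ?thesis .
  qed
  also have "\<dots> = card (walks (Suc k) N' (?g y / \<alpha> x))"
    using card_walks_Suc[OF assms(3,1), of "\<alpha> x" "?g y"] im Suc.prems by simp
  finally show ?case by simp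
qed

text \<open>
  Modulo a prime \<open>q\<close>, the \<open>q\<close>-th power of the sum of \<open>N\<close> in the group ring is the sum of the \<open>q\<close>-th
  powers of the elements of \<open>N\<close>; \<open>pw q N\<close> collects the elements with coefficient 1.
\<close>

definition pw :: "nat \<Rightarrow> complex set \<Rightarrow> complex set" where
  "pw q N = {z. card {n \<in> N. n ^ q = z} mod q = 1}"

lemma pw_subset: "pw q N \<subseteq> (\<lambda>z. z ^ q) ` N"
proof
  fix z assume "z \<in> pw q N"
  then have "card {n \<in> N. n ^ q = z} \<noteq> 0" unfolding pw_def by (intro notI) auto
  then have "{n \<in> N. n ^ q = z} \<noteq> {}" by (intro notI) simp
  then show "z \<in> (\<lambda>z. z ^ q) ` N" by auto
qed

text \<open>Membership in \<open>pw q N\<close> is a residue of a number of walks of length q, and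
  these numbers are preserved. The length is odd, so the end point is mapped by \<beta>, as
  \<open>link\<close> demands.\<close>

lemma link_pw:
  assumes "n > 0" "N \<subseteq> rt n" "N' \<subseteq> rt n" "prime q" "odd q"
    "bij_betw \<alpha> (rt n) (rt n)" "bij_betw \<beta> (rt n) (rt n)" "link n \<alpha> \<beta> N N'"
  shows "link n \<alpha> \<beta> (pw q N) (pw q N')"
proof -
  have f: "finite N" "finite N'" using assms finite_rt finite_subset by blast+
  have *: "z \<in> pw q M \<longleftrightarrow> card (walks q M z) mod q = 1" if "finite M" for M z
    using card_walks_prime_mod[OF that assms(4)] by (simp add: pw_def)
  have "card (walks q N (y / x)) = card (walks q N' (\<beta> y / \<alpha> x))"
       "card (walks q N (y / x)) = card (walks q N' (\<alpha> y / \<beta> x))" if "x \<in> rt n" "y \<in> rt n" for x y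
    using link_walks[OF assms(1-3,6-8) that, of q] 
      link_walks[OF assms(1-3) assms(7,6) link_swap[OF assms(8)] that, of q] assms(5) by auto
  then show ?thesis unfolding link_def using *[OF f(1)] *[OF f(2)] by simp
qed

text \<open>The q-th power map is injective on \<open>rt n\<close>, hence every coefficient is 0 or
  1.\<close>

lemma pw_coprime:
  assumes "n > 0" "N \<subseteq> rt n" "prime q" "coprime q n"
  shows "pw q N = (\<lambda>z. z ^ q) ` N"
proof
  show "(\<lambda>z. z ^ q) ` N \<subseteq> pw q N"
  proof
    fix z assume "z \<in> (\<lambda>z. z ^ q) ` N"
    then obtain m where m: "m \<in> N" "z = m ^ q" by auto
    then have "{n \<in> N. n ^ q = z} = {m}"
      using rt_inj_power[OF assms(1,4)] assms(2) by (auto simp: inj_on_def)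
    then show "z \<in> pw q N" using prime_gt_1_nat[OF assms(3)] by (simp add: pw_def)
  qed
qed (rule pw_subset)

text \<open>The prime factors of k are odd because n is even, and they are split off one at a time;
  each costs one application of the walk count modulo that prime.\<close>

lemma link_power:
  assumes "n > 0" "even n" "bij_betw \<alpha> (rt n) (rt n)" "bij_betw \<beta> (rt n) (rt n)"
  shows "coprime k n \<Longrightarrow> N \<subseteq> rt n \<Longrightarrow> N' \<subseteq> rt n \<Longrightarrow> link n \<alpha> \<beta> N N' \<Longrightarrow>
    link n \<alpha> \<beta> ((\<lambda>z. z ^ k) ` N) ((\<lambda>z. z ^ k) ` N')"
proof (induction k arbitrary: N N' rule: less_induct)
  case (less k)
  show ?case
  proof (cases "k = 1")
    case True then show ?thesis using less by simp
  next
    case False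
    then obtain q where q: "prime q" "q dvd k" using prime_factor_nat by blast
    then obtain j where j: "k = q * j" by auto
    have "k \<noteq> 0" using less.prems(1) assms(2) by (intro notI) simp
    then have jk: "j < k" using j q prime_gt_1_nat by auto
    have cq: "coprime q n" and cj: "coprime j n" using less.prems(1) j by auto
    have oq: "odd q" using cq assms(2) by (metis coprime_common_divisor even_numeral odd_one)
    let ?P = "\<lambda>M. (\<lambda>z. z ^ q) ` M"
    have "link n \<alpha> \<beta> (?P N) (?P N')"
      using link_pw[OF assms(1) less.prems(2,3) q(1) oq assms(3,4) less.prems(4)]
        pw_coprime[OF assms(1) _ q(1) cq] less.prems by simp
    moreover have "?P N \<subseteq> rt n" "?P N' \<subseteq> rt n" using less.prems rt_power by auto
    ultimately have "link n \<alpha> \<beta> ((\<lambda>z. z ^ j) ` ?P N) ((\<lambda>z. z ^ j) ` ?P N')"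
      using less.IH[OF jk cj] by blast
    then show ?thesis by (simp add: image_image j power_mult)
  qed
qed

subsection \<open>Cyclic groups of prime power order\<close>

lemma power_eq_mod: "(a::complex) ^ n = 1 \<Longrightarrow> u mod n = v mod n \<Longrightarrow> a ^ u = a ^ v"
proof -
  assume a: "a ^ n = 1" and uv: "u mod n = v mod n"
  have "a ^ w = a ^ (w mod n)" for w
    using a by (metis mult_div_mod_eq mult.left_neutral power_add power_mult power_one)
  then show ?thesis using uv by metis
qed

section \<open>Geometric sums modulo powers of an odd prime\<close>

lemma geometric_sum_mod:
  assumes "(k::nat) mod p = 1 mod p"
  shows "(\<Sum>i<t. k ^ i) mod p = t mod p"
proof (induction t)
  case (Suc t)
  have "k ^ t mod p = 1 mod p" using assms by (metis power_mod power_one)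
  with Suc have "((\<Sum>i<t. k ^ i) + k ^ t) mod p = (t + 1) mod p" by (rule mod_add_cong)
  then show ?case by simp
qed simp

text \<open>Modulo the square of p, \<open>k ^ i\<close> is linear in i. The linear terms add up to
  a multiple of p (p - 1) / 2 times p, which vanishes modulo that square because p is odd; what
  remains is p.\<close>

lemma geometric_sum_prime:
  assumes "prime (p::nat)" "odd p" "k mod p = 1"
  obtains v where "(\<Sum>i<p. k ^ i) = p * v" "\<not> p dvd v"
proof -
  obtain z where z: "k = 1 + p * z" using assms(3) by (metis add.commute mult_div_mod_eq)
  have "\<exists>c. k ^ i = 1 + i * (p * z) + p\<^sup>2 * c" for i
  proof (induction i)
    case (Suc i)
    then obtain c where c: "k ^ i = 1 + i * (p * z) + p\<^sup>2 * c" by blast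
    have "k ^ Suc i = (1 + p * z) * (1 + i * (p * z) + p\<^sup>2 * c)" using c z by simp
    also have "\<dots> = 1 + Suc i * (p * z) + p\<^sup>2 * (c + i * z\<^sup>2 + p * z * c)"
      by (simp add: algebra_simps power2_eq_square)
    finally show ?case by blast
  qed (use exI[of _ 0] in auto)
  then obtain c where c: "\<And>i. k ^ i = 1 + i * (p * z) + p\<^sup>2 * c i" by metis
  obtain m where m: "p = Suc (2 * m)" using assms(2) by (metis oddE Suc_eq_plus1)
  have g: "(\<Sum>i<p. i) = p * m"
    using gauss_sum_nat[of "2 * m"] by (simp add: m lessThan_Suc_atMost atLeast0AtMost algebra_simps)
  have "(\<Sum>i<p. k ^ i) = p + (\<Sum>i<p. i) * (p * z) + p\<^sup>2 * (\<Sum>i<p. c i)"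
    by (simp only: c sum.distrib sum_distrib_left sum_distrib_right) simp
  also have "\<dots> = p * (1 + p * (m * z + (\<Sum>i<p. c i)))"
    by (simp add: g algebra_simps power2_eq_square)
  finally have "(\<Sum>i<p. k ^ i) = p * (1 + p * (m * z + (\<Sum>i<p. c i)))" .
  moreover have "\<not> p dvd 1 + p * (m * z + (\<Sum>i<p. c i))"
    using assms(1) by (metis dvd_add_left_iff dvd_triv_left not_prime_unit)
  ultimately show ?thesis using that by blast
qed

text \<open>With t = s p, grouping the terms into blocks of length p leaves the sum of s powers of
  \<open>k ^ p\<close> times a number with exactly one factor p. Thus one factor p is removed from
  both sides and the induction continues with \<open>k ^ p\<close>.\<close>

lemma geometric_sum_dvd:
  assumes "prime (p::nat)" "odd p"
  shows "k mod p = 1 \<Longrightarrow> p ^ c dvd (\<Sum>i<t. k ^ i) \<Longrightarrow> p ^ c dvd t"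
proof (induction c arbitrary: k t)
  case (Suc c)
  have p1: "1 mod p = 1" using prime_gt_1_nat[OF assms(1)] by simp
  have "p dvd (\<Sum>i<t. k ^ i)" using Suc.prems(2) by (meson dvd_power dvd_trans zero_less_Suc)
  then have "p dvd t" using geometric_sum_mod[of k p t] Suc.prems(1) p1 by (simp add: dvd_eq_mod_eq_0)
  then obtain s where s: "t = s * p" by (metis dvd_def mult.commute)
  obtain v where v: "(\<Sum>i<p. k ^ i) = p * v" "\<not> p dvd v" 
    using geometric_sum_prime[OF assms Suc.prems(1)] by blast
  have "(\<Sum>i<s * p. k ^ i) = (\<Sum>j<s. \<Sum>i\<in>{j * p..<j * p + p}. k ^ i)"
    by (rule sum.nat_group[symmetric])
  also have "\<dots> = (\<Sum>j<s. \<Sum>i<p. (k ^ p) ^ j * k ^ i)"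
  proof (rule sum.cong[OF refl])
    fix j
    have "(\<Sum>i\<in>{j * p..<j * p + p}. k ^ i) = (\<Sum>i<p. k ^ (i + j * p))"
      using sum.shift_bounds_nat_ivl[of "\<lambda>i. k ^ i" 0 "j * p" p] by (simp add: add.commute lessThan_atLeast0)
    then show "(\<Sum>i\<in>{j * p..<j * p + p}. k ^ i) = (\<Sum>i<p. (k ^ p) ^ j * k ^ i)"
      by (simp add: power_add power_mult[symmetric] mult.commute)
  qed
  also have "\<dots> = (\<Sum>j<s. (k ^ p) ^ j) * (p * v)"
    by (simp add: sum_distrib_left[symmetric] sum_distrib_right[symmetric] v(1))
  finally have "p ^ Suc c dvd p * (v * (\<Sum>j<s. (k ^ p) ^ j))"
    using Suc.prems(2) s by (simp add: algebra_simps)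
  then have "p ^ c dvd v * (\<Sum>j<s. (k ^ p) ^ j)"
    using prime_gt_0_nat[OF assms(1)] by simp
  moreover have "coprime (p ^ c) v" using v(2) assms(1) by (simp add: prime_imp_coprime)
  ultimately have "p ^ c dvd (\<Sum>j<s. (k ^ p) ^ j)" by (simp add: coprime_dvd_mult_right_iff)
  moreover have "k ^ p mod p = 1" using Suc.prems(1) p1 by (metis power_mod power_one)
  ultimately have "p ^ c dvd s" using Suc.IH by blast
  then show ?case using s by (simp add: mult.commute)
qed simp

text \<open>Two sums that agree modulo \<open>p ^ c\<close> differ by a power of k, which is a unit,
  times a shorter sum. By the divisibility just proved the sums of length less than
  \<open>p ^ c\<close> are therefore pairwise incongruent, and there are as many of them as
  residues.\<close>

lemma geometric_sum_surj_mod: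
  assumes "prime (p::nat)" "odd p" "k mod p = 1"
  shows "\<exists>t. (\<Sum>i<t. k ^ i) mod p ^ c = j mod p ^ c"
proof -
  let ?f = "\<lambda>t. (\<Sum>i<t. k ^ i) mod p ^ c"
  have p0: "p ^ c > 0" using assms prime_gt_0_nat by simp
  have ck: "coprime (p ^ c) k"
    using assms by (metis coprime_power_left_iff mod_0_imp_dvd dvd_imp_mod_0 one_neq_zero prime_imp_coprime)
  have "s = t" if "s \<le> t" "t < p ^ c" "?f s = ?f t" for s t
  proof -
    have "(\<Sum>i<t. k ^ i) = (\<Sum>i<s. k ^ i) + (\<Sum>i\<in>{s..<t}. k ^ i)"
      using that(1) by (metis lessThan_atLeast0 sum.atLeastLessThan_concat zero_le)
    also have "(\<Sum>i\<in>{s..<t}. k ^ i) = k ^ s * (\<Sum>i<t - s. k ^ i)"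
      using that(1) sum.shift_bounds_nat_ivl[of "\<lambda>i. k ^ i" 0 s "t - s"]
      by (simp add: power_add sum_distrib_left lessThan_atLeast0 mult.commute)
    finally have "p ^ c dvd k ^ s * (\<Sum>i<t - s. k ^ i)"
      using that(3) by (metis add_diff_cancel_left' mod_eq_dvd_iff_nat le_add1)
    then have "p ^ c dvd (\<Sum>i<t - s. k ^ i)" using ck by (simp add: coprime_dvd_mult_right_iff)
    then have "p ^ c dvd t - s" using geometric_sum_dvd assms by blast
    then show ?thesis using that by (auto dest: dvd_imp_le)
  qed
  then have "inj_on ?f {..<p ^ c}" by (auto simp: inj_on_def) (metis nat_le_linear)
  moreover have "?f ` {..<p ^ c} \<subseteq> {..<p ^ c}" using p0 by auto
  ultimately have "?f ` {..<p ^ c} = {..<p ^ c}" by (simp add: endo_inj_surj)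
  then have "j mod p ^ c \<in> ?f ` {..<p ^ c}" using p0 by simp
  then show ?thesis by auto
qed

section \<open>Generators of groups of roots of unity\<close>

lemma rt_prime_power_order:
  assumes "prime (p::nat)" "y \<in> rt (p ^ l)" "y \<notin> rt (p ^ (l - 1))" "y ^ u = 1"
  shows "p ^ l dvd u"
proof -
  have "y ^ gcd (p ^ l) u = 1"
    using power_gcd_eq_1[of y "p ^ l" u] assms prime_gt_0_nat by (simp add: rt_def)
  moreover obtain i where i: "i \<le> l" "gcd (p ^ l) u = p ^ i"
    using divides_primepow_nat[OF assms(1)] by (metis gcd_dvd1)
  ultimately have "y \<in> rt (p ^ i)" by (simp add: rt_def)
  then have "\<not> i \<le> l - 1" using rt_mono[OF le_imp_power_dvd, of i "l - 1" p] assms(3) by blast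
  then have "i = l" using i by linarith
  then show ?thesis using i by (metis gcd_dvd2)
qed

lemma rt_prime_power_gen:
  assumes "prime (p::nat)" "y \<in> rt (p ^ l)" "y \<notin> rt (p ^ (l - 1))" "c \<in> rt (p ^ l)"
  shows "\<exists>u. c = y ^ u"
proof -
  have p0: "p ^ l > 0" using assms prime_gt_0_nat by simp
  have nz: "y \<noteq> 0" using assms rt_nz p0 by blast
  have "s = t" if "s \<le> t" "t < p ^ l" "y ^ s = y ^ t" for s t
  proof -
    have "y ^ t = y ^ s * y ^ (t - s)" using that(1) by (simp add: power_add[symmetric])
    then have "y ^ (t - s) = 1" using that(3) nz by simp
    then have "p ^ l dvd t - s" using rt_prime_power_order assms by blast
    then show ?thesis using that by (auto dest: dvd_imp_le)
  qed
  then have "inj_on (\<lambda>u. y ^ u) {..<p ^ l}" by (auto simp: inj_on_def) (metis nat_le_linear)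
  then have "card ((\<lambda>u. y ^ u) ` {..<p ^ l}) = card (rt (p ^ l))"
    using card_rt[OF p0] by (simp add: card_image)
  moreover have "(\<lambda>u. y ^ u) ` {..<p ^ l} \<subseteq> rt (p ^ l)" using assms rt_power by auto
  ultimately have "(\<lambda>u. y ^ u) ` {..<p ^ l} = rt (p ^ l)"
    using card_subset_eq[OF finite_rt[OF p0]] by blast
  then show ?thesis using assms(4) by (metis imageE)
qed

text \<open>The square of x has order \<open>p ^ l\<close>, so a is a power of it, and the exponent
  is divisible by p because a lies one layer lower. The result is a multiplier 1 + 2 p v, odd and
  congruent to 1 modulo p, that sends x to x a.\<close>

lemma rt_double_gen:
  assumes "prime (p::nat)" "l \<ge> 1" "x \<in> rt (2 * p ^ l)" "x \<notin> rt (2 * p ^ (l - 1))"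
    "a \<in> rt (p ^ (l - 1))"
  obtains v where "a = x ^ (2 * p * v)"
proof -
  have y: "x\<^sup>2 \<in> rt (p ^ l)" "x\<^sup>2 \<notin> rt (p ^ (l - 1))"
    using assms by (auto simp: rt_def power_mult[symmetric])
  have "a \<in> rt (p ^ l)" using assms(5) rt_mono[OF le_imp_power_dvd, of "l - 1" l p] by auto
  then obtain u where u: "a = (x\<^sup>2) ^ u" using rt_prime_power_gen[OF assms(1) y] by blast
  have "(x\<^sup>2) ^ (u * p ^ (l - 1)) = 1" using assms(5) u by (simp add: rt_def power_mult)
  then have "p ^ l dvd u * p ^ (l - 1)" using rt_prime_power_order[OF assms(1) y] by blast
  moreover have "p ^ l = p * p ^ (l - 1)" using assms(2) by (metis Suc_diff_le diff_Suc_1 power_Suc One_nat_def)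
  ultimately have "p dvd u" using assms(1) by (simp add: prime_gt_0_nat)
  then obtain v where "u = p * v" by auto
  then show ?thesis using that[of v] u by (simp add: power_mult[symmetric] mult.assoc)
qed

subsection \<open>Two-fold automorphisms and their orbits\<close>

definition tf :: "nat \<Rightarrow> complex set set \<Rightarrow> ((complex \<Rightarrow> complex) \<times> (complex \<Rightarrow> complex)) set" where
  "tf n F = {(\<alpha>, \<beta>). bij_betw \<alpha> (rt n) (rt n) \<and> bij_betw \<beta> (rt n) (rt n) \<and> (\<forall>N\<in>F. link n \<alpha> \<beta> N N)}"

text \<open>Let \<alpha> act on one copy of \<open>rt n\<close> and \<beta> on a second one. This is
  the orbit of z in the second copy under the stabilizer of 1 in the first; in particular 1 itself
  may move.\<close>

definition orb :: "nat \<Rightarrow> complex set set \<Rightarrow> complex \<Rightarrow> complex set" where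
  "orb n F z = {\<beta> z | \<alpha> \<beta>. (\<alpha>, \<beta>) \<in> tf n F \<and> \<alpha> 1 = 1}"

definition invset :: "nat \<Rightarrow> complex set set \<Rightarrow> complex set \<Rightarrow> bool" where
  "invset n F N \<longleftrightarrow> N \<subseteq> rt n \<and> (\<forall>(\<alpha>, \<beta>)\<in>tf n F. link n \<alpha> \<beta> N N)"

lemma tf_swap: "(\<alpha>, \<beta>) \<in> tf n F \<Longrightarrow> (\<beta>, \<alpha>) \<in> tf n F"
  unfolding tf_def using link_swap by auto

lemma tf_im: "(\<alpha>, \<beta>) \<in> tf n F \<Longrightarrow> x \<in> rt n \<Longrightarrow> \<alpha> x \<in> rt n"
  "(\<alpha>, \<beta>) \<in> tf n F \<Longrightarrow> x \<in> rt n \<Longrightarrow> \<beta> x \<in> rt n"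
  unfolding tf_def using bij_betwE by blast+

lemma tf_eq_iff: "(\<alpha>, \<beta>) \<in> tf n F \<Longrightarrow> x \<in> rt n \<Longrightarrow> y \<in> rt n \<Longrightarrow> \<alpha> x = \<alpha> y \<longleftrightarrow> x = y"
  "(\<alpha>, \<beta>) \<in> tf n F \<Longrightarrow> x \<in> rt n \<Longrightarrow> y \<in> rt n \<Longrightarrow> \<beta> x = \<beta> y \<longleftrightarrow> x = y"
  unfolding tf_def by (auto dest: bij_betw_imp_inj_on inj_onD)

lemma tf_comp:
  assumes "(\<alpha>, \<beta>) \<in> tf n F" "(\<alpha>', \<beta>') \<in> tf n F"
  shows "(\<lambda>x. \<alpha>' (\<alpha> x), \<lambda>x. \<beta>' (\<beta> x)) \<in> tf n F"
proof -
  have "bij_betw (\<alpha>' \<circ> \<alpha>) (rt n) (rt n)" "bij_betw (\<beta>' \<circ> \<beta>) (rt n) (rt n)"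
    using assms bij_betw_trans unfolding tf_def by blast+
  moreover have "link n (\<lambda>x. \<alpha>' (\<alpha> x)) (\<lambda>x. \<beta>' (\<beta> x)) N N" if "N \<in> F" for N
  proof -
    have "link n \<alpha> \<beta> N N" "link n \<alpha>' \<beta>' N N" using assms that by (auto simp: tf_def)
    then show ?thesis unfolding link_def[of n "\<lambda>x. \<alpha>' (\<alpha> x)"]
      using tf_im[OF assms(1)] by (simp add: linkD)
  qed
  ultimately show ?thesis unfolding tf_def comp_def by simp
qed

lemma tf_inv:
  assumes "(\<alpha>, \<beta>) \<in> tf n F"
  shows "(inv_into (rt n) \<alpha>, inv_into (rt n) \<beta>) \<in> tf n F"
proof -
  have b: "bij_betw \<alpha> (rt n) (rt n)" "bij_betw \<beta> (rt n) (rt n)" using assms by (auto simp: tf_def)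
  have i: "inv_into (rt n) \<alpha> x \<in> rt n" "\<alpha> (inv_into (rt n) \<alpha> x) = x"
    "inv_into (rt n) \<beta> x \<in> rt n" "\<beta> (inv_into (rt n) \<beta> x) = x" if "x \<in> rt n" for x
    using b that by (auto simp: bij_betw_inv_into_right inv_into_into bij_betw_imp_surj_on)
  show ?thesis unfolding tf_def mem_Collect_eq case_prod_conv
  proof (intro conjI ballI)
    fix N assume "N \<in> F"
    then have "link n \<alpha> \<beta> N N" using assms by (auto simp: tf_def)
    then show "link n (inv_into (rt n) \<alpha>) (inv_into (rt n) \<beta>) N N"
      unfolding link_def using i by metis
  qed (use b bij_betw_inv_into in auto)
qed

lemma tf_shift:
  assumes "(\<alpha>, \<beta>) \<in> tf n F" "u \<in> rt n" "v \<in> rt n" "n > 0"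
  shows "(\<lambda>x. \<alpha> (u * x) / v, \<lambda>x. \<beta> (u * x) / v) \<in> tf n F"
proof -
  have nz: "u \<noteq> 0" "v \<noteq> 0" using assms rt_nz by auto
  have bm: "bij_betw (\<lambda>x. w * x) (rt n) (rt n)" if "w \<in> rt n" for w
  proof (rule bij_betw_byWitness[where f' = "\<lambda>x. x / w"])
  qed (use that rt_nz[OF that assms(4)] rt_mult rt_divide in auto)
  have "(\<lambda>x. w * x, \<lambda>x. w * x) \<in> tf n F" if "w \<in> rt n" for w
    using bm[OF that] rt_nz[OF that assms(4)] unfolding tf_def link_def by simp
  from tf_comp[OF tf_comp[OF this[OF assms(2)] assms(1)] this[OF rt_divide[OF rt_1 assms(3)]]]
  show ?thesis by simp
qed

lemma tf_id: "n > 0 \<Longrightarrow> (\<lambda>x. x, \<lambda>x. x) \<in> tf n F"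
  unfolding tf_def link_def using bij_betw_id[of "rt n"] by (simp add: id_def)

lemma orbI: "(\<alpha>, \<beta>) \<in> tf n F \<Longrightarrow> \<alpha> 1 = 1 \<Longrightarrow> w = \<beta> z \<Longrightarrow> w \<in> orb n F z"
  unfolding orb_def by blast

lemma orb_refl: "n > 0 \<Longrightarrow> z \<in> orb n F z"
  unfolding orb_def mem_Collect_eq using tf_id[of n F]
  by (intro exI[of _ "\<lambda>x. x"]) simp

text \<open>Translations belong to \<open>tf\<close>. Multiplying by x beforehand and dividing by
  the image of x afterwards turns any pair into one with \<alpha> 1 = 1, which keeps the orbit. The
  inverse pair gives the other direction.\<close>

lemma invset_orb:
  assumes "z \<in> rt n" "n > 0"
  shows "invset n F (orb n F z)"
proof -
  have fw: "\<beta> y / \<alpha> x \<in> orb n F z"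
    if t: "(\<alpha>, \<beta>) \<in> tf n F" and xy: "x \<in> rt n" "y \<in> rt n" "y / x \<in> orb n F z" for \<alpha> \<beta> x y
  proof -
    obtain \<alpha>0 \<beta>0 where g: "(\<alpha>0, \<beta>0) \<in> tf n F" "\<alpha>0 1 = 1" "y / x = \<beta>0 z"
      using xy(3) by (auto simp: orb_def)
    have "(\<lambda>t. \<alpha> (x * \<alpha>0 t) / \<alpha> x, \<lambda>t. \<beta> (x * \<beta>0 t) / \<alpha> x) \<in> tf n F"
      using tf_comp[OF g(1) tf_shift[OF t xy(1) tf_im(1)[OF t xy(1)] assms(2)]] .
    moreover have "x * \<beta>0 z = y" using g(3) rt_nz[OF xy(1) assms(2)] by (simp flip: g(3))
    moreover have "\<alpha> x \<noteq> 0" using rt_nz tf_im(1)[OF t xy(1)] assms(2) by blast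
    ultimately show ?thesis unfolding orb_def using g(2) by force
  qed
  have "y / x \<in> orb n F z \<longleftrightarrow> \<beta> y / \<alpha> x \<in> orb n F z"
    if t: "(\<alpha>, \<beta>) \<in> tf n F" and xy: "x \<in> rt n" "y \<in> rt n" for \<alpha> \<beta> x y
  proof
    assume "\<beta> y / \<alpha> x \<in> orb n F z"
    from fw[OF tf_inv[OF t] tf_im(1)[OF t xy(1)] tf_im(2)[OF t xy(2)] this]
    have "inv_into (rt n) \<beta> (\<beta> y) / inv_into (rt n) \<alpha> (\<alpha> x) \<in> orb n F z" .
    moreover have "inv_into (rt n) \<beta> (\<beta> y) = y" "inv_into (rt n) \<alpha> (\<alpha> x) = x"
      using t xy bij_betw_inv_into_left unfolding tf_def by auto
    ultimately show "y / x \<in> orb n F z" by simp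
  qed (use fw[OF t xy] in auto)
  then have "link n \<alpha> \<beta> (orb n F z) (orb n F z)" if "(\<alpha>, \<beta>) \<in> tf n F" for \<alpha> \<beta>
    unfolding link_def using that tf_swap[OF that] by blast
  moreover have "orb n F z \<subseteq> rt n" using tf_im assms by (auto simp: orb_def)
  ultimately show ?thesis unfolding invset_def by auto
qed

lemma orb_subset: "invset n F N \<Longrightarrow> z \<in> N \<Longrightarrow> orb n F z \<subseteq> N"
proof
  fix w assume N: "invset n F N" "z \<in> N" "w \<in> orb n F z"
  then obtain \<alpha> \<beta> where g: "(\<alpha>, \<beta>) \<in> tf n F" "\<alpha> 1 = 1" "w = \<beta> z" by (auto simp: orb_def)
  have "link n \<alpha> \<beta> N N" "z \<in> rt n" using N g unfolding invset_def by auto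
  then have "\<beta> z / \<alpha> 1 \<in> N" using linkD(1)[of n \<alpha> \<beta> N N 1 z] N by simp
  then show "w \<in> N" using g by simp
qed

lemma orb_eq:
  assumes "z \<in> rt n" "n > 0" "w \<in> orb n F z"
  shows "orb n F w = orb n F z"
proof
  show "orb n F w \<subseteq> orb n F z" using orb_subset[OF invset_orb] assms by blast
  obtain \<alpha> \<beta> where g: "(\<alpha>, \<beta>) \<in> tf n F" "\<alpha> 1 = 1" "w = \<beta> z" using assms by (auto simp: orb_def)
  have wr: "w \<in> rt n" using g tf_im assms by auto
  have "\<beta> z / \<alpha> 1 \<in> orb n F w" using g orb_refl assms by auto
  moreover have "link n \<alpha> \<beta> (orb n F w) (orb n F w)"
    using invset_orb[OF wr assms(2), of F] g unfolding invset_def by auto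
  ultimately have "z / 1 \<in> orb n F w" using linkD(1)[of n \<alpha> \<beta> _ _ 1 z] assms(1) by simp
  then show "orb n F z \<subseteq> orb n F w" using orb_subset[OF invset_orb[OF wr assms(2)]] by simp
qed

lemma invset_power:
  assumes "invset n F N" "n > 0" "even n" "coprime k n"
  shows "invset n F ((\<lambda>z. z ^ k) ` N)"
proof -
  have "N \<subseteq> rt n" using assms by (simp add: invset_def)
  moreover have "link n \<alpha> \<beta> ((\<lambda>z. z ^ k) ` N) ((\<lambda>z. z ^ k) ` N)" if "(\<alpha>, \<beta>) \<in> tf n F" for \<alpha> \<beta>
    using link_power[OF assms(2,3) _ _ assms(4)] that assms(1) unfolding invset_def tf_def by auto
  ultimately show ?thesis unfolding invset_def using rt_power by auto
qed

lemma invset_pw: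
  assumes "invset n F N" "n > 0" "prime q" "odd q"
  shows "invset n F (pw q N)"
proof -
  have "N \<subseteq> rt n" using assms by (simp add: invset_def)
  moreover have "link n \<alpha> \<beta> (pw q N) (pw q N)" if "(\<alpha>, \<beta>) \<in> tf n F" for \<alpha> \<beta>
    using link_pw[OF assms(2) _ _ assms(3,4)] that assms(1) unfolding invset_def tf_def by auto
  ultimately show ?thesis unfolding invset_def using rt_power pw_subset[of q N] by blast
qed

text \<open>The k-th powers of an orbit form an invariant set, which contains every orbit that it
  meets. So a single coincidence yields an inclusion, and finiteness makes it an equality.\<close>

lemma orb_power:
  assumes "z \<in> rt n" "n > 0" "even n" "coprime k n" "w \<in> orb n F z" "w ^ k \<in> orb n F z"
  shows "(\<lambda>z. z ^ k) ` orb n F z = orb n F z"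
proof -
  have "w ^ k \<in> (\<lambda>z. z ^ k) ` orb n F z" using assms by blast
  then have "orb n F (w ^ k) \<subseteq> (\<lambda>z. z ^ k) ` orb n F z"
    using orb_subset invset_power invset_orb assms by blast
  then have "orb n F z \<subseteq> (\<lambda>z. z ^ k) ` orb n F z" using orb_eq assms by metis
  moreover have "finite (orb n F z)" 
    using invset_orb[OF assms(1,2)] finite_rt[OF assms(2)] finite_subset unfolding invset_def by blast
  ultimately show ?thesis by (metis card_image_le card_seteq finite_imageI)
qed

text \<open>
  The number \<open>k \<equiv> 1\<close> modulo \<open>p\<close> with \<open>x ^ k = x * a\<close> induces a permutation of the orbits which fixes
  this one, and the powers of \<open>k\<close> already sweep out the coset \<open>x \<langle>a\<rangle>\<close>.
\<close>

lemma orb_coset: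
  assumes "prime (p::nat)" "odd p" "z \<in> rt (2 * p ^ e)" "l \<ge> 1"
    "x \<in> rt (2 * p ^ l)" "x \<notin> rt (2 * p ^ (l - 1))" "a \<in> rt (p ^ (l - 1))"
    "x \<in> orb (2 * p ^ e) F z" "x * a \<in> orb (2 * p ^ e) F z"
  shows "x * a ^ j \<in> orb (2 * p ^ e) F z"
proof -
  let ?n = "2 * p ^ e" and ?O = "orb (2 * p ^ e) F z"
  have n0: "?n > 0" using assms(1) prime_gt_0_nat by simp
  obtain v where v: "a = x ^ (2 * p * v)" using rt_double_gen assms by metis
  define k where "k = 1 + 2 * p * v"
  have "k = 1 + p * (2 * v)" by (simp add: k_def)
  then have k: "k mod p = 1" using prime_gt_1_nat[OF assms(1)] by (metis mod_less mod_mult_self2)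
  have "coprime k p" using k assms(1)
    by (metis coprime_commute dvd_eq_mod_eq_0 one_neq_zero prime_imp_coprime)
  moreover have "odd k" by (simp add: k_def)
  ultimately have ck: "coprime k ?n" by simp
  have xk: "x ^ k = x * a" by (simp add: k_def v)
  have cl: "(\<lambda>z. z ^ k) ` ?O = ?O"
    using orb_power[OF assms(3) n0 _ ck assms(8)] assms(9) xk by simp
  have it: "x ^ (k ^ t) \<in> ?O" for t
  proof (induction t)
    case (Suc t)
    then have "(x ^ (k ^ t)) ^ k \<in> ?O" using cl by blast
    then show ?case by (simp add: power_mult[symmetric] mult.commute)
  qed (use assms in simp)
  have eq: "x ^ (k ^ t) = x * a ^ (\<Sum>i<t. k ^ i)" for t
  proof (induction t)
    case (Suc t)
    have "x ^ (k ^ Suc t) = (x ^ (k ^ t)) ^ k" by (simp add: power_mult[symmetric] mult.commute)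
    also have "\<dots> = x * a ^ (1 + k * (\<Sum>i<t. k ^ i))"
      by (simp add: Suc power_mult_distrib xk power_mult[symmetric] mult.commute mult.left_commute)
    also have "1 + k * (\<Sum>i<t. k ^ i) = (\<Sum>i<Suc t. k ^ i)"
      by (simp only: sum.lessThan_Suc_shift sum_distrib_left) simp
    finally show ?case .
  qed simp
  \<comment> \<open>Only the residue of the exponent modulo \<open>p ^ (l - 1)\<close> matters for
    a, and the geometric sums attain every residue.\<close>
  obtain t where "(\<Sum>i<t. k ^ i) mod p ^ (l - 1) = j mod p ^ (l - 1)"
    using geometric_sum_surj_mod[OF assms(1,2) k] by blast
  then have "a ^ (\<Sum>i<t. k ^ i) = a ^ j" using power_eq_mod[of a "p ^ (l - 1)"] assms(7) unfolding rt_def by blast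
  then show ?thesis using it[of t] eq[of t] by simp
qed

lemma rt_mono_power: "i \<le> j \<Longrightarrow> rt (m * p ^ i) \<subseteq> rt (m * p ^ j)"
  by (intro rt_mono mult_dvd_mono le_imp_power_dvd) auto

text \<open>Subgroups of p-power order form a chain, so an element outside the layer below
  \<open>rt (p ^ r)\<close> generates a group that contains \<open>rt (p ^ r)\<close>.\<close>

lemma rt_cover:
  assumes "prime (p::nat)" "a \<in> rt (p ^ m)" "a \<notin> rt (p ^ (r - 1))" "c \<in> rt (p ^ r)"
  shows "\<exists>j. c = a ^ j"
proof -
  define L where "L = (LEAST L. a \<in> rt (p ^ L))"
  have L: "a \<in> rt (p ^ L)" unfolding L_def using assms(2) by (rule LeastI)
  have mono: "rt (p ^ i) \<subseteq> rt (p ^ j)" if "i \<le> j" for i j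
    using rt_mono_power[OF that, of 1] by simp
  have rL: "r - 1 < L" using L assms(3) mono[of L "r - 1"] by (meson linorder_not_less subsetD)
  then have "a \<notin> rt (p ^ (L - 1))" using not_less_Least[of "L - 1" "\<lambda>L. a \<in> rt (p ^ L)"] unfolding L_def[symmetric] by simp
  moreover have "r \<le> L" using rL by linarith
  then have "c \<in> rt (p ^ L)" using assms(4) mono by blast
  ultimately show ?thesis using rt_prime_power_gen[OF assms(1) L] by blast
qed

lemma rt_odd_double:
  assumes "z \<in> rt (2 * m)" "z \<in> rt k" "odd k"
  shows "z \<in> rt m"
proof -
  have "(z ^ m)\<^sup>2 = 1" using assms(1) by (simp add: rt_def power_mult[symmetric] mult.commute)
  then have "z ^ m = 1 \<or> z ^ m = -1" by (simp add: power2_eq_1_iff)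
  moreover have "(z ^ m) ^ k = 1" using rt_power[OF assms(2), of m] by (simp add: rt_def)
  ultimately show ?thesis using assms(3) by (auto simp: rt_def)
qed

lemma rt_double_cases: "z \<in> rt (2 * m) \<Longrightarrow> odd m \<Longrightarrow> z \<in> rt m \<or> - z \<in> rt m"
proof -
  assume "z \<in> rt (2 * m)" "odd m"
  then have "(z ^ m)\<^sup>2 = 1" by (simp add: rt_def power_mult[symmetric] mult.commute)
  then show ?thesis using \<open>odd m\<close> by (auto simp: rt_def power2_eq_1_iff)
qed

lemma rt_uminus: "even n \<Longrightarrow> - z \<in> rt n \<longleftrightarrow> z \<in> rt n"
  by (simp add: rt_def)

text \<open>Taking the least layer that contains Q yields an element of Q in the top layer, whose
  powers then fill the layer up to sign. The factor m is 1 or 2, according to whether the sign is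
  included.\<close>

lemma layer_exists:
  assumes "Q \<subseteq> rt (m * p ^ e)" "\<not> Q \<subseteq> rt (m * p ^ r)"
  obtains l x where "r < l" "l \<le> e" "Q \<subseteq> rt (m * p ^ l)" "x \<in> Q" "x \<notin> rt (m * p ^ (l - 1))"
proof -
  define l where "l = (LEAST l. Q \<subseteq> rt (m * p ^ l))"
  have l: "Q \<subseteq> rt (m * p ^ l)" "l \<le> e"
    unfolding l_def using assms(1) by (rule LeastI, rule Least_le)
  have "r < l" using l(1) assms(2) rt_mono_power[of l r m p] by (meson dual_order.trans linorder_not_less)
  then have "\<not> Q \<subseteq> rt (m * p ^ (l - 1))" using not_less_Least[of "l - 1" "\<lambda>l. Q \<subseteq> rt (m * p ^ l)"] unfolding l_def[symmetric] by simp
  then show ?thesis using that l \<open>r < l\<close> by blast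
qed

lemma coprime_one_mod: "(k::nat) mod p = 1 \<Longrightarrow> prime p \<Longrightarrow> odd k \<Longrightarrow> coprime k (2 * p ^ e)"
  by (metis coprime_commute coprime_mult_right_iff coprime_power_right_iff coprime_right_2_iff_odd
      dvd_eq_mod_eq_0 one_neq_zero prime_imp_coprime)

subsection \<open>The orbit of the identity\<close>

text \<open>
  If \<open>s u \<notin> S\<close>, the orbit of \<open>s\<close> meets the relevant coset of \<open>s\<close> only in \<open>s\<close>, so iterated \<open>p\<close>-th
  powers keep the coefficient 1 at \<open>s ^ (p ^ t)\<close> until this element has order \<open>p\<close> and lies in the
  orbit of 1, whose coefficient is divisible by \<open>p\<close>.
\<close>

lemma subgroup_periodic_of_orbit:
  assumes p: "prime (p::nat)" "odd p" and n: "n = 2 * p ^ e"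
    and S: "S \<subseteq> rt n" "1 \<notin> S"
    and h: "h \<in> rt p" "h \<noteq> 1" "h \<in> orb n {S} 1"
    and s: "s \<in> S" "s \<in> rt (p ^ e)"
  shows "s \<notin> rt p \<and> (\<forall>u\<in>rt p. s * u \<in> S)"
proof -
  let ?O = "orb n {S}"
  have n0: "n > 0" using n p prime_gt_0_nat by simp
  have p1: "p > 1" using p prime_gt_1_nat by simp
  have en: "even n" using n by simp
  have PO: "u \<in> ?O 1" if u: "u \<in> rt p" for u
  proof (cases "u = 1")
    case False
    have "h \<notin> rt (p ^ (1 - 1))" using h(2) by (simp add: rt_def)
    then obtain j where j: "u = h ^ j" using rt_prime_power_gen[OF p(1), of h 1 u] h(1) u by auto
    \<comment> \<open>Adding p does not change the power of h but makes the exponent odd, hence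
      coprime to n. Such a power map fixes 1 and therefore the orbit of 1.\<close>
    define k where "k = (if odd j then j else j + p)"
    have k: "u = h ^ k" using j h(1) by (auto simp: k_def power_add rt_def)
    have "\<not> p dvd k" using False k h(1) by (auto simp: rt_def power_mult)
    then have "coprime k n" using p n unfolding k_def
      by (auto simp: coprime_commute prime_imp_coprime)
    then have "(\<lambda>z. z ^ k) ` ?O 1 = ?O 1"
      using orb_power[OF rt_1 n0 en, of k 1 "{S}"] orb_refl[OF n0, of 1] by simp
    then show ?thesis using h(3) k by blast
  qed (use orb_refl[OF n0] in simp)
  have invS: "invset n {S} S" using S unfolding invset_def tf_def by auto
  have SO: "x \<notin> S" if "x \<in> ?O 1" for x
  proof
    assume "x \<in> S"
    then have "?O x \<subseteq> S" using orb_subset[OF invS] by blast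
    moreover have "?O x = ?O 1" using orb_eq[OF rt_1 n0 that] .
    ultimately show False using S(2) orb_refl[OF n0] by blast
  qed
  have sP: "s \<notin> rt p" using s PO SO by blast
  moreover have "s * u \<in> S" if u: "u \<in> rt p" for u
  proof (rule ccontr)
    assume su: "s * u \<notin> S"
    have srt: "s \<in> rt n" using s S by blast
    define N where "N = ?O s"
    have N: "invset n {S} N" "s \<in> N" "N \<subseteq> S"
      unfolding N_def using invset_orb[OF srt n0] orb_refl[OF n0] orb_subset[OF invS s(1)] by auto
    have "\<not> {s} \<subseteq> rt (1 * p ^ 1)" using sP by simp
    then obtain l where l: "1 < l" "s \<in> rt (p ^ l)" "s \<notin> rt (p ^ (l - 1))"
      using layer_exists[of "{s}" 1 p e 1] s(2) by auto
    have l2: "s \<in> rt (2 * p ^ l)" "s \<notin> rt (2 * p ^ (l - 1))"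
      using l rt_odd_double[of s "p ^ (l - 1)" "p ^ l"] p(2) rt_mono[of "p ^ l" "2 * p ^ l"] by auto
    have single: "a = 1" if a: "a \<in> rt (p ^ (l - 1))" "s * a \<in> N" for a
    proof (rule ccontr)
      assume "a \<noteq> 1"
      then have "a \<notin> rt (p ^ (1 - 1))" by (simp add: rt_def)
      then obtain j where "u = a ^ j" using rt_cover[OF p(1) a(1), of 1 u] u by auto
      moreover have "s * a ^ j \<in> ?O s"
        using orb_coset[OF p(1,2), of s e l s a] srt l l2 a N n unfolding N_def by auto
      ultimately show False using su N by (auto simp: N_def)
    qed
    define X where "X t = (pw p ^^ t) N" for t
    have XS: "X (Suc t) = pw p (X t)" for t by (simp add: X_def)
    have inv: "invset n {S} (X t)" for t
      by (induction t) (use N invset_pw[OF _ n0 p] in \<open>auto simp: X_def\<close>)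
    \<comment> \<open>Inside \<open>X t\<close> the element \<open>s ^ p ^ t\<close> is alone in its
      coset of \<open>rt (p ^ (l - 1 - t))\<close>. Each p-th power costs one layer of that
      subgroup: a p-th root of an element of the new coset lies in the old one.\<close>
    have chain: "t \<le> l - 1 \<Longrightarrow> s ^ p ^ t \<in> X t \<and> (\<forall>a\<in>rt (p ^ (l - 1 - t)). s ^ p ^ t * a \<in> X t \<longrightarrow> a = 1)" for t
    proof (induction t)
      case 0 then show ?case using N single by (simp add: X_def)
    next
      case (Suc t)
      let ?q = "s ^ p ^ t"
      have q0: "?q \<noteq> 0" using rt_nz[OF rt_power[OF srt] n0] .
      have sp: "s ^ p ^ Suc t = ?q ^ p" by (simp add: power_mult[symmetric] mult.commute)
      have IH: "?q \<in> X t" "\<And>a. a \<in> rt (p ^ (l - 1 - t)) \<Longrightarrow> ?q * a \<in> X t \<Longrightarrow> a = 1"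
        using Suc by auto
      have pe: "p ^ (l - 1 - t) = p * p ^ (l - 1 - Suc t)"
        using Suc.prems by (metis Suc_diff_Suc Suc_le_lessD power_Suc)
      have key: "m = ?q \<and> b = 1" if m: "m \<in> X t" "m ^ p = ?q ^ p * b" "b \<in> rt (p ^ (l - 1 - Suc t))" for m b
      proof -
        have "(m / ?q) ^ p = b" using m q0 by (simp add: power_divide)
        then have "m / ?q \<in> rt (p ^ (l - 1 - t))" using m(3) unfolding rt_def pe by (simp add: power_mult)
        moreover have "?q * (m / ?q) = m" using q0 by simp
        ultimately have "m / ?q = 1" using IH(2) m(1) by metis
        then have "m = ?q" using q0 by simp
        moreover have "?q ^ p * 1 = ?q ^ p * b" using m(2) \<open>m = ?q\<close> by simp
        then have "b = 1" using power_not_zero[OF q0] by (metis mult_left_cancel)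
        ultimately show ?thesis by blast
      qed
      have "{m \<in> X t. m ^ p = ?q ^ p} = {?q}" using key[of _ 1] IH(1) by auto
      then have "?q ^ p \<in> X (Suc t)" using p1 by (simp add: XS pw_def)
      moreover have "b = 1" if b: "b \<in> rt (p ^ (l - 1 - Suc t))" "?q ^ p * b \<in> X (Suc t)" for b
      proof -
        obtain m where "m \<in> X t" "m ^ p = ?q ^ p * b" using pw_subset[of p "X t"] b(2) XS by auto
        then show ?thesis using key b by blast
      qed
      ultimately show ?case using sp by auto
    qed
    have c1: "s ^ p ^ (l - 1) \<in> X (l - 1)" using chain[of "l - 1"] by simp
    have "s ^ p ^ (l - 1) \<in> rt p" using l
      by (simp add: rt_def power_mult[symmetric]) (metis One_nat_def Suc_pred less_imp_Suc_add mult.commute power_Suc zero_less_Suc)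
    then have "1 \<in> ?O (s ^ p ^ (l - 1))" using orb_eq[OF rt_1 n0 PO] orb_refl[OF n0] by metis
    then have "1 \<in> X (l - 1)" using orb_subset[OF inv c1] by blast
    moreover have "l - 1 = Suc (l - 2)" using l by simp
    ultimately have c2: "card {m \<in> X (l - 2). m ^ p = 1} mod p = 1"
      using XS[of "l - 2"] by (simp add: pw_def)
    \<comment> \<open>All of \<open>rt p\<close> lies in the orbit of 1, so an invariant set
      contains all of it or none of it.\<close>
    have "{m \<in> X (l - 2). m ^ p = 1} = {} \<or> {m \<in> X (l - 2). m ^ p = 1} = rt p"
    proof (cases "\<exists>m\<in>X (l - 2). m ^ p = 1")
      case True
      then obtain m where m: "m \<in> X (l - 2)" "m \<in> rt p" by (auto simp: rt_def)
      then have "?O 1 \<subseteq> X (l - 2)" using orb_eq[OF rt_1 n0 PO] orb_subset[OF inv m(1)] by metis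
      then show ?thesis using PO by (auto simp: rt_def)
    qed auto
    moreover have "card (rt p) mod p = 0" "card ({} :: complex set) mod p = 0"
      using card_rt[of p] p1 by simp_all
    ultimately have "card {m \<in> X (l - 2). m ^ p = 1} mod p = 0" by (elim disjE) (simp_all only:)
    then show False using c2 by linarith
  qed
  ultimately show ?thesis by blast
qed

text \<open>By hypothesis 1 has a single p-th root in its orbit. Having a number of p-th roots
  congruent to 1 modulo p is an invariant property, so every z in the orbit has it. A root m of z
  outside \<open>rt (2 * p)\<close> would come with its whole coset of \<open>rt p\<close>, and then
  there would be p roots.\<close>

lemma orbit_of_one_signs:
  assumes p: "prime (p::nat)" "odd p" and n: "n = 2 * p ^ e"
    and h: "\<And>h. h \<in> rt p \<Longrightarrow> h \<in> orb n F 1 \<Longrightarrow> h = 1"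
  shows "orb n F 1 \<subseteq> {1, -1}"
proof
  fix z assume z: "z \<in> orb n F 1"
  let ?O = "orb n F 1"
  have n0: "n > 0" using n p prime_gt_0_nat by simp
  have p1: "p > 1" using p prime_gt_1_nat by simp
  have en: "even n" using n by simp
  have O1: "1 \<in> ?O" using orb_refl[OF n0] .
  have inv: "invset n F ?O" using invset_orb[OF rt_1 n0] .
  have "{m \<in> ?O. m ^ p = 1} = {1}" using h O1 by (auto simp: rt_def)
  then have "1 \<in> pw p ?O" using p1 by (simp add: pw_def)
  then have "?O \<subseteq> pw p ?O" using orb_subset[OF invset_pw[OF inv n0 p]] by blast
  then have zp: "card {m \<in> ?O. m ^ p = z} mod p = 1" using z by (auto simp: pw_def)
  then have "{m \<in> ?O. m ^ p = z} \<noteq> {}" using p1 by (intro notI) simp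
  then obtain m where m: "m \<in> ?O" "m ^ p = z" by blast
  have mrt: "m \<in> rt (2 * p ^ e)" using inv m n by (auto simp: invset_def)
  have m0: "m \<noteq> 0" using rt_nz mrt n0 n by blast
  show "z \<in> {1, -1}"
  proof (cases "m \<in> rt (2 * p)")
    case True
    then show ?thesis using m(2) unfolding rt_def mem_Collect_eq
      by (metis insertI1 insertI2 mult.commute power2_eq_1_iff power_mult)
  next
    case False
    then obtain l where l: "1 < l" "m \<in> rt (2 * p ^ l)" "m \<notin> rt (2 * p ^ (l - 1))"
      using layer_exists[of "{m}" 2 p e 1] mrt by auto
    have mP: "m * a \<in> ?O" if a: "a \<in> rt p" for a
    proof -
      have "1 \<le> l - 1" using l by linarith
      then have "a \<in> rt (p ^ (l - 1))" using a rt_mono_power[of 1 "l - 1" 1 p] by auto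
      then obtain v where v: "a = m ^ (2 * p * v)" using rt_double_gen[OF p(1) _ l(2,3)] l(1) by auto
      \<comment> \<open>As 1 is fixed by all power maps, each exponent coprime to n preserves the
        orbit of 1; this one sends m to m a.\<close>
      define k where "k = 1 + p * (2 * v)"
      have "k mod p = 1" using p1 unfolding k_def by (metis mod_less mod_mult_self2)
      then have "coprime k n" using coprime_one_mod[OF _ p(1)] n by (simp add: k_def)
      then have "(\<lambda>z. z ^ k) ` ?O = ?O" using orb_power[OF rt_1 n0 en, of k 1 F] O1 by simp
      then have "m ^ k \<in> ?O" using m(1) by blast
      then show ?thesis by (simp add: k_def v mult.assoc mult.left_commute)
    qed
    have "{m' \<in> ?O. m' ^ p = z} = (\<lambda>a. m * a) ` rt p"
    proof (intro equalityI subsetI)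
      fix m' assume "m' \<in> {m' \<in> ?O. m' ^ p = z}"
      then have "m' / m \<in> rt p" using m power_not_zero[OF m0, of p] by (auto simp: rt_def power_divide)
      then show "m' \<in> (\<lambda>a. m * a) ` rt p" using m0 by (intro image_eqI[of _ _ "m' / m"]) auto
    qed (use mP m in \<open>auto simp: rt_def power_mult_distrib\<close>)
    moreover have "card ((\<lambda>a. m * a) ` rt p) = p"
      using card_image[of "\<lambda>a. m * a" "rt p"] card_rt[of p] p1 m0 by (simp add: inj_on_def)
    ultimately show ?thesis using zp by simp
  qed
qed

text \<open>Each further p-th power multiplies the difference to 1 by a sum of p terms congruent to
  1 modulo p, hence by a multiple of p. It shows that a multiplier congruent to 1 modulo p has odd
  order modulo \<open>2 * p ^ l\<close> if it is odd.\<close>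

lemma power_prime_power_mod:
  assumes "prime (p::nat)" "k mod p = 1"
  shows "p ^ Suc c dvd k ^ p ^ c - 1"
proof (induction c)
  case 0
  have "k - 1 = p * (k div p)" using assms(2) minus_mod_eq_mult_div[of k p] by simp
  then show ?case by simp
next
  case (Suc c)
  let ?m = "k ^ p ^ c"
  have p1: "1 mod p = 1" using prime_gt_1_nat[OF assms(1)] by simp
  have m: "?m mod p = 1" using assms(2) p1 by (metis power_mod power_one)
  then have "?m \<noteq> 0" by (intro notI) simp
  then have m1: "?m \<ge> 1" by linarith
  have "p dvd (\<Sum>i<p. ?m ^ i)" using geometric_sum_mod[of ?m p p] m p1 by (simp add: dvd_eq_mod_eq_0)
  then have "p ^ Suc c * p dvd (?m - 1) * (\<Sum>i<p. ?m ^ i)" using Suc.IH by (intro mult_dvd_mono)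
  also have "(?m - 1) * (\<Sum>i<p. ?m ^ i) = ?m ^ p - 1"
  proof -
    have "int ((?m - 1) * (\<Sum>i<p. ?m ^ i)) = (int ?m - 1) * (\<Sum>i<p. int ?m ^ i)"
      using m1 by (simp add: of_nat_diff)
    also have "\<dots> = int ?m ^ p - 1" by (simp only: power_diff_1_eq)
    also have "\<dots> = int (?m ^ p - 1)" using m1 by (simp add: of_nat_diff)
    finally show ?thesis by (simp only: of_nat_eq_iff)
  qed
  also have "?m ^ p = k ^ p ^ Suc c" by (simp add: power_mult[symmetric] mult.commute)
  finally show ?case by (simp add: mult.commute)
qed

text \<open>Squaring removes the sign, and the square of x generates
  \<open>rt (p ^ l)\<close>.\<close>

lemma rt_double_pm_gen:
  assumes "prime (p::nat)" "odd p" "x \<in> rt (2 * p ^ l)" "x \<notin> rt (2 * p ^ (l - 1))" "z \<in> rt (2 * p ^ l)"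
  obtains m where "z = x ^ m \<or> z = - (x ^ m)"
proof -
  have "x\<^sup>2 \<in> rt (p ^ l)" "x\<^sup>2 \<notin> rt (p ^ (l - 1))" "z\<^sup>2 \<in> rt (p ^ l)"
    using assms by (auto simp: rt_def power_mult[symmetric])
  then obtain m where "z\<^sup>2 = (x\<^sup>2) ^ m" using rt_prime_power_gen[OF assms(1)] by blast
  then have "z\<^sup>2 = (x ^ m)\<^sup>2" by (simp add: power_mult[symmetric] mult.commute)
  then show ?thesis using that[of m] by (simp add: power2_eq_iff)
qed

subsection \<open>Two-fold automorphisms determined up to sign\<close>

locale sign_orbit =
  fixes p e n :: nat and S :: "complex set"
  assumes p: "prime p" "odd p" and n: "n = 2 * p ^ e"
    and S: "S \<subseteq> rt n" "1 \<notin> S"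
    and orb1: "orb n {S} 1 \<subseteq> {1, -1}"
    and twisted: "\<exists>\<alpha> \<beta>. (\<alpha>, \<beta>) \<in> tf n {S} \<and> \<alpha> 1 = 1 \<and> \<beta> 1 = -1"
begin

abbreviation T where "T \<equiv> tf n {S}"
abbreviation B where "B r \<equiv> rt (2 * p ^ r)"

text \<open>For a quotient in \<open>V\<close> a change of sign is invisible to S. A quotient in
  \<open>W\<close> detects it, which ties the signs at two points to each other.\<close>

definition V where "V = {z \<in> rt n. z \<in> S \<and> - z \<in> S}"
definition W where "W = {z \<in> rt n. (z \<in> S) \<noteq> (- z \<in> S)}"

lemma n0: "n > 0" and en: "even n"
  using n p prime_gt_0_nat by auto

lemma nz: "x \<in> rt n \<Longrightarrow> x \<noteq> 0" using rt_nz n0 by blast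

lemma neg_rt: "- x \<in> rt n \<longleftrightarrow> x \<in> rt n" using rt_uminus en by blast

lemma neg_B: "- x \<in> B r \<longleftrightarrow> x \<in> B r" by (simp add: rt_uminus)

lemma B_rt: "r \<le> e \<Longrightarrow> B r \<subseteq> rt n" using n rt_mono_power by blast

lemma T_sign:
  assumes "(\<alpha>, \<beta>) \<in> T" "x \<in> rt n"
  shows "\<beta> x = \<alpha> x \<or> \<beta> x = - \<alpha> x"
proof -
  have ax: "\<alpha> x \<in> rt n" using tf_im assms by blast
  then have a0: "\<alpha> x \<noteq> 0" using nz by blast
  have "(\<lambda>t. \<alpha> (x * t) / \<alpha> x, \<lambda>t. \<beta> (x * t) / \<alpha> x) \<in> T" using tf_shift[OF assms ax n0] .
  then have "\<beta> x / \<alpha> x \<in> orb n {S} 1" by (rule orbI) (use a0 in simp_all)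
  then have "\<beta> x / \<alpha> x = 1 \<or> \<beta> x / \<alpha> x = -1" using orb1 by blast
  then show ?thesis using a0 by (auto simp: field_simps)
qed

text \<open>The twisted pair, moved to the base point x and followed by the given pair, sends x to
  \<alpha> x on one side and to \<beta> (-x) on the other. These agree up to sign, and injectivity
  of \<beta> leaves only -\<beta> x.\<close>

lemma T_minus_right:
  assumes "(\<alpha>, \<beta>) \<in> T" "x \<in> rt n"
  shows "\<beta> (- x) = - \<beta> x"
proof -
  obtain \<alpha>0 \<beta>0 where g: "(\<alpha>0, \<beta>0) \<in> T" "\<alpha>0 1 = 1" "\<beta>0 1 = -1" using twisted by blast
  have x0: "x \<noteq> 0" using nz assms by blast
  have r: "1 / x \<in> rt n" using rt_divide[OF rt_1 assms(2)] .
  have "(\<lambda>t. \<alpha> (\<alpha>0 (1 / x * t) / (1 / x)), \<lambda>t. \<beta> (\<beta>0 (1 / x * t) / (1 / x))) \<in> T"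
    using tf_comp[OF tf_shift[OF g(1) r r n0] assms(1)] .
  from T_sign[OF this assms(2)] have "\<beta> (- x) = \<alpha> x \<or> \<beta> (- x) = - \<alpha> x" using g x0 by simp
  moreover have "\<beta> (- x) \<noteq> \<beta> x" using tf_eq_iff(2)[OF assms(1), of "- x" x] assms(2) x0 neg_rt by simp
  ultimately show ?thesis using T_sign[OF assms] by auto
qed

lemma T_minus:
  assumes "(\<alpha>, \<beta>) \<in> T" "x \<in> rt n"
  shows "\<alpha> (- x) = - \<alpha> x" "\<beta> (- x) = - \<beta> x"
  using T_minus_right[OF assms] T_minus_right[OF tf_swap[OF assms(1)] assms(2)] by auto

lemma T_S: "(\<alpha>, \<beta>) \<in> T \<Longrightarrow> x \<in> rt n \<Longrightarrow> y \<in> rt n \<Longrightarrow> \<beta> y / \<alpha> x \<in> S \<longleftrightarrow> y / x \<in> S"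
  "(\<alpha>, \<beta>) \<in> T \<Longrightarrow> x \<in> rt n \<Longrightarrow> y \<in> rt n \<Longrightarrow> \<alpha> y / \<beta> x \<in> S \<longleftrightarrow> y / x \<in> S"
  using linkD unfolding tf_def by auto

lemma T_minus_S:
  assumes "(\<alpha>, \<beta>) \<in> T" "x \<in> rt n" "y \<in> rt n"
  shows "- (\<beta> y / \<alpha> x) \<in> S \<longleftrightarrow> - (y / x) \<in> S" "- (\<alpha> y / \<beta> x) \<in> S \<longleftrightarrow> - (y / x) \<in> S"
  using T_S[OF assms(1,2), of "- y"] T_minus[OF assms(1,3)] assms(3) neg_rt by auto

text \<open>Replacing \<beta> y by \<alpha> y changes the quotient at most by a sign, and
  \<open>V\<close> and \<open>W\<close> are symmetric under negation. So they are preserved by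
  \<alpha> alone.\<close>

lemma T_VW:
  assumes t: "(\<alpha>, \<beta>) \<in> T" and xy: "x \<in> rt n" "y \<in> rt n"
  shows "\<alpha> y / \<alpha> x \<in> V \<longleftrightarrow> y / x \<in> V" "\<alpha> y / \<alpha> x \<in> W \<longleftrightarrow> y / x \<in> W"
proof -
  have r: "\<alpha> y / \<alpha> x \<in> rt n" "y / x \<in> rt n" using rt_divide tf_im(1)[OF t] xy by auto
  have s: "\<beta> y = \<alpha> y \<or> \<beta> y = - \<alpha> y" using T_sign t xy by blast
  have q: "\<beta> y / \<alpha> x \<in> S \<longleftrightarrow> y / x \<in> S" "- (\<beta> y / \<alpha> x) \<in> S \<longleftrightarrow> - (y / x) \<in> S"
    using T_S(1)[OF t xy] T_minus_S(1)[OF t xy] by auto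
  show "\<alpha> y / \<alpha> x \<in> V \<longleftrightarrow> y / x \<in> V" "\<alpha> y / \<alpha> x \<in> W \<longleftrightarrow> y / x \<in> W"
    using s q r unfolding V_def W_def by auto
qed

text \<open>The quotients \<beta> y / \<alpha> x and \<alpha> y / \<beta> x are both in S or both
  outside. If the signs at x and y differed they would be negatives of each other, which is
  impossible for a quotient in \<open>W\<close>.\<close>

lemma T_twist_W:
  assumes t: "(\<alpha>, \<beta>) \<in> T" and xy: "x \<in> rt n" "y \<in> rt n" and w: "y / x \<in> W"
  shows "\<beta> x = \<alpha> x \<longleftrightarrow> \<beta> y = \<alpha> y"
proof -
  have a: "\<alpha> x \<noteq> 0" "\<alpha> y \<noteq> 0" using nz tf_im(1)[OF t] xy by auto
  have "\<alpha> y / \<alpha> x \<in> W" using T_VW(2) assms by blast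
  then have "(\<alpha> y / \<alpha> x \<in> S) \<noteq> (- (\<alpha> y / \<alpha> x) \<in> S)" by (simp add: W_def)
  moreover have "\<beta> y / \<alpha> x \<in> S \<longleftrightarrow> \<alpha> y / \<beta> x \<in> S" using T_S[OF t xy] by simp
  ultimately show ?thesis using T_sign[OF t xy(1)] T_sign[OF t xy(2)] a by auto
qed

lemma T_tfV: "(\<alpha>, \<beta>) \<in> T \<Longrightarrow> (\<alpha>, \<alpha>) \<in> tf n {V}"
  using T_VW(1)[of \<alpha> \<beta>] unfolding tf_def[of n "{V}"] link_def by (simp add: tf_def)

text \<open>
  The subgroups \<open>B r\<close> to which the constancy of the sign has been extended. The last clause (a map
  acting trivially on \<open>B r / B (r - 1)\<close> has sign \<open>+1\<close>) carries the induction.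
\<close>

definition good where
  "good r \<longleftrightarrow> 1 \<le> r \<and> r \<le> e \<and> W \<subseteq> B r \<and>
    (\<forall>\<alpha> \<beta> y z. (\<alpha>, \<beta>) \<in> T \<longrightarrow> y \<in> rt n \<longrightarrow> z \<in> B r \<longrightarrow>
       \<alpha> (y * z) / \<alpha> y \<in> B r \<and> (\<beta> (y * z) = \<alpha> (y * z) \<longleftrightarrow> \<beta> y = \<alpha> y)) \<and>
    (\<forall>\<alpha> \<beta>. (\<alpha>, \<beta>) \<in> T \<longrightarrow> \<alpha> 1 = 1 \<longrightarrow> (\<forall>v \<in> B r. \<alpha> v / v \<in> B (r - 1)) \<longrightarrow> \<beta> 1 = 1)"

lemma goodD:
  assumes "good r"
  shows "1 \<le> r" "r \<le> e" "W \<subseteq> B r"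
    "(\<alpha>, \<beta>) \<in> T \<Longrightarrow> y \<in> rt n \<Longrightarrow> z \<in> B r \<Longrightarrow> \<alpha> (y * z) / \<alpha> y \<in> B r"
    "(\<alpha>, \<beta>) \<in> T \<Longrightarrow> y \<in> rt n \<Longrightarrow> z \<in> B r \<Longrightarrow> \<beta> (y * z) = \<alpha> (y * z) \<longleftrightarrow> \<beta> y = \<alpha> y"
    "(\<alpha>, \<beta>) \<in> T \<Longrightarrow> \<alpha> 1 = 1 \<Longrightarrow> \<forall>v \<in> B r. \<alpha> v / v \<in> B (r - 1) \<Longrightarrow> \<beta> 1 = 1"
  using assms unfolding good_def by blast+

text \<open>Up to sign every element of \<open>B l\<close> is a power of x, so the property of the
  single step x is iterated; the remaining sign commutes with both maps.\<close>

lemma T_generated_subgroup: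
  assumes x: "x \<in> rt n" "x \<in> B l" "x \<notin> B (l - 1)" "l \<le> e"
    and st: "\<And>y. y \<in> rt n \<Longrightarrow> \<alpha> (y * x) / \<alpha> y \<in> B l \<and> (\<beta> (y * x) = \<alpha> (y * x) \<longleftrightarrow> \<beta> y = \<alpha> y)"
    and t: "(\<alpha>, \<beta>) \<in> T" and yz: "y \<in> rt n" "z \<in> B l"
  shows "\<alpha> (y * z) / \<alpha> y \<in> B l \<and> (\<beta> (y * z) = \<alpha> (y * z) \<longleftrightarrow> \<beta> y = \<alpha> y)"
proof -
  have a: "\<alpha> (y * x ^ m) / \<alpha> y \<in> B l \<and> (\<beta> (y * x ^ m) = \<alpha> (y * x ^ m) \<longleftrightarrow> \<beta> y = \<alpha> y)" for m
  proof (induction m)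
    case 0 then show ?case using nz[OF tf_im(1)[OF t yz(1)]] by simp
  next
    case (Suc m)
    have yx: "y * x ^ m \<in> rt n" using yz x rt_mult rt_power by blast
    have a0: "\<alpha> (y * x ^ m) \<noteq> 0" using nz[OF tf_im(1)[OF t yx]] .
    have e: "y * x ^ m * x = y * x ^ Suc m" by simp
    have "\<alpha> (y * x ^ Suc m) / \<alpha> y = (\<alpha> (y * x ^ m * x) / \<alpha> (y * x ^ m)) * (\<alpha> (y * x ^ m) / \<alpha> y)"
      using a0 unfolding e by simp
    then show ?case using st[OF yx] Suc rt_mult unfolding e by metis
  qed
  obtain m where m: "z = x ^ m \<or> z = - (x ^ m)" using rt_double_pm_gen[OF p x(2,3) yz(2)] by blast
  have yx: "y * x ^ m \<in> rt n" using yz x rt_mult rt_power by blast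
  show ?thesis using m a[of m] T_minus[OF t yx] neg_B by auto
qed

lemma V_uminus: "- z \<in> V \<longleftrightarrow> z \<in> V" using neg_rt unfolding V_def by auto

lemma W_uminus: "- z \<in> W \<longleftrightarrow> z \<in> W" using neg_rt unfolding W_def by auto

lemma one_notin_W: "1 \<notin> W" "-1 \<notin> W"
proof -
  obtain \<alpha>0 \<beta>0 where g: "(\<alpha>0, \<beta>0) \<in> T" "\<alpha>0 1 = 1" "\<beta>0 1 = -1" using twisted by blast
  have "-1 \<notin> S" using T_S(1)[OF g(1), of 1 1] g S(2) by simp
  then show "1 \<notin> W" using S(2) by (simp add: W_def)
  then show "-1 \<notin> W" using W_uminus[of 1] by simp
qed

section \<open>Symmetries of \<open>B l\<close> that keep or exchange S and -S\<close>

text \<open>The flag tells whether S and -S are exchanged, so composition adds flags modulo 2.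
  Conjugation by a flip with flag \<open>True\<close> thus preserves those with flag
  \<open>False\<close>.\<close>

definition flip where
  "flip l b \<sigma> \<longleftrightarrow> bij_betw \<sigma> (B l) (B l) \<and> (\<forall>x\<in>B l. \<forall>y\<in>B l.
     (\<sigma> y / \<sigma> x \<in> S \<longleftrightarrow> (if b then - (y / x) \<in> S else y / x \<in> S)) \<and>
     (- (\<sigma> y / \<sigma> x) \<in> S \<longleftrightarrow> (if b then y / x \<in> S else - (y / x) \<in> S)))"

lemma flip_im: "flip l b \<sigma> \<Longrightarrow> x \<in> B l \<Longrightarrow> \<sigma> x \<in> B l"
  unfolding flip_def using bij_betwE by blast

lemma flip_comp:
  assumes "flip l b \<sigma>" "flip l c \<tau>"
  shows "flip l (b \<noteq> c) (\<lambda>x. \<tau> (\<sigma> x))"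
proof -
  have "bij_betw (\<tau> \<circ> \<sigma>) (B l) (B l)" using assms bij_betw_trans unfolding flip_def by blast
  then show ?thesis using assms flip_im[OF assms(1)] unfolding flip_def[of l "b \<noteq> c"] comp_def
    by (simp add: flip_def)
qed

lemma flip_inv:
  assumes "flip l b \<sigma>"
  shows "flip l b (inv_into (B l) \<sigma>)"
proof -
  let ?i = "inv_into (B l) \<sigma>"
  have bi: "bij_betw \<sigma> (B l) (B l)" using assms by (simp add: flip_def)
  have i: "?i x \<in> B l" "\<sigma> (?i x) = x" if "x \<in> B l" for x
    using bi that by (auto simp: bij_betw_inv_into_right inv_into_into bij_betw_imp_surj_on)
  have "(?i y / ?i x \<in> S \<longleftrightarrow> (if b then - (y / x) \<in> S else y / x \<in> S)) \<and>
     (- (?i y / ?i x) \<in> S \<longleftrightarrow> (if b then y / x \<in> S else - (y / x) \<in> S))" if xy: "x \<in> B l" "y \<in> B l" for x y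
  proof -
    have "(\<sigma> (?i y) / \<sigma> (?i x) \<in> S \<longleftrightarrow> (if b then - (?i y / ?i x) \<in> S else ?i y / ?i x \<in> S)) \<and>
     (- (\<sigma> (?i y) / \<sigma> (?i x)) \<in> S \<longleftrightarrow> (if b then ?i y / ?i x \<in> S else - (?i y / ?i x) \<in> S))"
      using assms i xy unfolding flip_def by blast
    then show ?thesis using i xy by (simp split: if_splits)
  qed
  then show ?thesis unfolding flip_def using bij_betw_inv_into[OF bi] by blast
qed

lemma flip_mult:
  assumes "u \<in> B l"
  shows "flip l False (\<lambda>x. u * x)"
proof -
  have B0: "2 * p ^ l > 0" using p prime_gt_0_nat by simp
  have u0: "u \<noteq> 0" using rt_nz[OF assms B0] .
  have "bij_betw (\<lambda>x. u * x) (B l) (B l)"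
  proof (rule bij_betw_byWitness[where f' = "\<lambda>x. x / u"])
  qed (use assms u0 rt_mult rt_divide in auto)
  then show ?thesis unfolding flip_def using u0 by simp
qed

lemma flip_divide:
  assumes "flip l b \<sigma>" "u \<in> B l" 
  shows "flip l b (\<lambda>x. \<sigma> x / u)"
  using flip_comp[OF assms(1) flip_mult[OF rt_divide[OF rt_1 assms(2)]]] by simp

text \<open>The singleton of 1 forces \<beta> = \<alpha> on \<open>B l\<close>. Hence the two-fold
  automorphisms of this family are the diagonal ones, given by the flips with flag
  \<open>False\<close>.\<close>

abbreviation F where "F l \<equiv> {S \<inter> B l, uminus ` (S \<inter> B l), {1}}"

lemma flip_tf:
  assumes "flip l False \<sigma>"
  shows "(\<sigma>, \<sigma>) \<in> tf (2 * p ^ l) (F l)"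
proof -
  have B0: "2 * p ^ l > 0" using p prime_gt_0_nat by simp
  have b: "bij_betw \<sigma> (B l) (B l)" using assms by (simp add: flip_def)
  have "(y / x \<in> N) = (\<sigma> y / \<sigma> x \<in> N)" if N: "N \<in> F l" and xy: "x \<in> B l" "y \<in> B l" for N x y
  proof -
    have r: "y / x \<in> B l" "\<sigma> y / \<sigma> x \<in> B l" using xy flip_im[OF assms] rt_divide by auto
    have *: "z \<in> uminus ` (S \<inter> B l) \<longleftrightarrow> - z \<in> S \<and> z \<in> B l" for z
      using neg_B[of z l] by (auto simp: neg_B intro!: image_eqI[of z uminus "- z"])
    have nz: "x \<noteq> 0" "\<sigma> x \<noteq> 0" using xy flip_im[OF assms] rt_nz B0 by blast+
    have "y / x = 1 \<longleftrightarrow> \<sigma> y / \<sigma> x = 1" 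
      using nz bij_betw_imp_inj_on[OF b] xy by (auto dest: inj_onD)
    note one = this
    have sS: "\<sigma> y / \<sigma> x \<in> S \<longleftrightarrow> y / x \<in> S" "- (\<sigma> y / \<sigma> x) \<in> S \<longleftrightarrow> - (y / x) \<in> S"
      using assms xy unfolding flip_def by simp_all
    from N consider "N = S \<inter> B l" | "N = uminus ` (S \<inter> B l)" | "N = {1}" by blast
    then show ?thesis by cases (simp_all only: * Int_iff singleton_iff r one sS)
  qed
  then show ?thesis unfolding tf_def link_def using b by auto
qed

lemma tf_flip:
  assumes t: "(\<alpha>, \<beta>) \<in> tf (2 * p ^ l) (F l)"
  shows "flip l False \<alpha>" "\<And>x. x \<in> B l \<Longrightarrow> \<beta> x = \<alpha> x"
proof -
  have B0: "2 * p ^ l > 0" using p prime_gt_0_nat by simp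
  have lk: "link (2 * p ^ l) \<alpha> \<beta> (S \<inter> B l) (S \<inter> B l)"
    "link (2 * p ^ l) \<alpha> \<beta> (uminus ` (S \<inter> B l)) (uminus ` (S \<inter> B l))" "link (2 * p ^ l) \<alpha> \<beta> {1} {1}"
    using t by (auto simp: tf_def)
  show eq: "\<beta> x = \<alpha> x" if "x \<in> B l" for x
    using linkD(1)[OF lk(3) that that] rt_nz[OF that B0] by auto
  have *: "z \<in> uminus ` (S \<inter> B l) \<longleftrightarrow> - z \<in> S \<and> z \<in> B l" for z
    using neg_B[of z l] by (auto simp: neg_B intro!: image_eqI[of z uminus "- z"])
  have "(\<alpha> y / \<alpha> x \<in> S \<longleftrightarrow> y / x \<in> S) \<and> (- (\<alpha> y / \<alpha> x) \<in> S \<longleftrightarrow> - (y / x) \<in> S)"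
    if xy: "x \<in> B l" "y \<in> B l" for x y
  proof -
    have r: "y / x \<in> B l" "\<alpha> y / \<alpha> x \<in> B l" using xy tf_im[OF t] rt_divide by auto
    show ?thesis using linkD(1)[OF lk(1) xy] linkD(1)[OF lk(2) xy] r eq[OF xy(2)] unfolding * by simp
  qed
  then show "flip l False \<alpha>" unfolding flip_def using t by (simp add: tf_def)
qed

text \<open>
  If \<open>\<gamma> s = s ^ k\<close> with \<open>k \<equiv> 1\<close> modulo \<open>p\<close>, then \<open>\<gamma>\<close> acts on the orbit \<open>N\<close> of \<open>s\<close> like the \<open>k\<close>-th power
  while \<open>\<gamma> \<circ> \<gamma>\<close> fixes \<open>N\<close>. As \<open>k\<close> has odd order, the \<open>k\<close>-th power fixes \<open>N\<close> as well, which is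
  incompatible with \<open>\<gamma>\<close> exchanging \<open>S\<close> and \<open>-S\<close>.
\<close>

lemma base_step:
  assumes l: "1 \<le> l" "l \<le> e" and w: "w \<in> W" "w \<in> rt (p ^ l)" "w \<notin> B (l - 1)"
    and blk: "\<And>\<alpha> \<beta> y z. (\<alpha>, \<beta>) \<in> T \<Longrightarrow> y \<in> rt n \<Longrightarrow> z \<in> B l \<Longrightarrow>
       \<alpha> (y * z) / \<alpha> y \<in> B l \<and> (\<beta> (y * z) = \<alpha> (y * z) \<longleftrightarrow> \<beta> y = \<alpha> y)"
    and t: "(\<gamma>, \<delta>) \<in> T" "\<gamma> 1 = 1" "\<delta> 1 = -1"
  shows "\<gamma> w / w \<notin> rt (p ^ (l - 1))"
proof
  assume aw: "\<gamma> w / w \<in> rt (p ^ (l - 1))"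
  define a where "a = \<gamma> w / w"
  let ?m = "2 * p ^ l"
  have m0: "?m > 0" and em: "even ?m" using p prime_gt_0_nat by auto
  have wB: "w \<in> B l" using w(2) rt_mono[of "p ^ l" ?m] by auto
  have wn: "w \<in> rt n" using wB B_rt[OF l(2)] by blast
  obtain s where s: "s = w \<or> s = - w" "s \<in> S" using w(1) by (auto simp: W_def)
  have sB: "s \<in> B l" "s \<notin> B (l - 1)" using s wB w(3) neg_B by auto
  have sn: "s \<in> rt n" using s(2) S by blast
  have s0: "s \<noteq> 0" using nz sn by blast
  have gs: "\<gamma> s = s * a" using s(1) T_minus(1)[OF t(1) wn] nz[OF wn] by (auto simp: a_def)
  obtain v where v: "a = s ^ (2 * p * v)"
    using rt_double_gen[OF p(1) l(1) sB] aw a_def by blast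
  define k where "k = 1 + p * (2 * v)"
  have k1: "k mod p = 1" using prime_gt_1_nat[OF p(1)] unfolding k_def by (metis mod_less mod_mult_self2)
  have ck: "coprime k ?m" using coprime_one_mod[OF k1 p(1)] by (simp add: k_def)
  have gk: "\<gamma> s = s ^ k" unfolding gs v k_def by (simp add: mult.assoc mult.left_commute)
  have gB: "\<gamma> x \<in> B l" if "x \<in> B l" for x using blk[OF t(1) rt_1 that] t by simp
  have gbij: "bij_betw \<gamma> (B l) (B l)"
  proof -
    have "inj_on \<gamma> (B l)" using t(1) B_rt[OF l(2)] unfolding tf_def
      by (auto dest: bij_betw_imp_inj_on intro: inj_on_subset)
    moreover from this have "\<gamma> ` B l = B l" using gB finite_rt[OF m0] by (intro endo_inj_surj) auto
    ultimately show ?thesis by (simp add: bij_betw_def)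
  qed
  have dg: "\<delta> x = - \<gamma> x" if "x \<in> B l" for x
    using blk[OF t(1) rt_1 that] T_sign[OF t(1), of x] t that B_rt[OF l(2)] by auto
  have fg: "flip l True \<gamma>"
  proof -
    have "(\<gamma> y / \<gamma> x \<in> S \<longleftrightarrow> - (y / x) \<in> S) \<and> (- (\<gamma> y / \<gamma> x) \<in> S \<longleftrightarrow> y / x \<in> S)"
      if xy: "x \<in> B l" "y \<in> B l" for x y
    proof -
      have xn: "x \<in> rt n" "y \<in> rt n" using xy B_rt[OF l(2)] by auto
      show ?thesis using T_S(1)[OF t(1) xn] T_minus_S(1)[OF t(1) xn] dg[OF xy(2)] by simp
    qed
    then show ?thesis unfolding flip_def using gbij by simp
  qed
  define N where "N = orb ?m (F l) s"
  define N' where "N' = orb ?m (F l) (\<gamma> s)"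
  have gsB: "\<gamma> s \<in> B l" using gB sB by blast
  have invN: "invset ?m (F l) N" "invset ?m (F l) N'"
    unfolding N_def N'_def using invset_orb m0 sB gsB by blast+
  have sN: "s \<in> N" unfolding N_def using orb_refl m0 by blast
  have sub: "N \<subseteq> B l" "N' \<subseteq> B l" using invN by (auto simp: invset_def)
  \<comment> \<open>Conjugation by \<gamma> uses \<gamma> and its inverse, so it turns flips with
    flag \<open>False\<close> into such flips. This carries the orbit of s to the orbit of \<gamma>
    s, also after rebasing at x.\<close>
  have lk: "link ?m \<gamma> \<gamma> N N'"
  proof -
    have "y / x \<in> N \<longleftrightarrow> \<gamma> y / \<gamma> x \<in> N'" if xy: "x \<in> B l" "y \<in> B l" for x y
    proof
      let ?i = "inv_into (B l) \<gamma>"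
      have x0: "x \<noteq> 0" "\<gamma> x \<noteq> 0" using rt_nz m0 xy gB by blast+
      have inv: "?i (\<gamma> z) = z" if "z \<in> B l" for z using gbij that by (simp add: bij_betw_inv_into_left)
      have i1: "?i 1 = 1" using inv[of 1] t by simp
      {
        assume "y / x \<in> N"
        then obtain \<alpha>0 \<beta>0 where g: "(\<alpha>0, \<beta>0) \<in> tf ?m (F l)" "\<alpha>0 1 = 1" "y / x = \<beta>0 s"
          by (auto simp: N_def orb_def)
        have ys: "x * \<alpha>0 s = y" using g(3) tf_flip(2)[OF g(1) sB(1)] x0 by (simp add: field_simps)
        have "flip l False (\<lambda>z. \<gamma> (x * \<alpha>0 (?i z)) / \<gamma> x)"
          using flip_divide[OF flip_comp[OF flip_comp[OF flip_comp[OF flip_inv[OF fg] tf_flip(1)[OF g(1)]] flip_mult[OF xy(1)]] fg] gB[OF xy(1)]]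
          by simp
        then have M: "(\<lambda>z. \<gamma> (x * \<alpha>0 (?i z)) / \<gamma> x, \<lambda>z. \<gamma> (x * \<alpha>0 (?i z)) / \<gamma> x) \<in> tf ?m (F l)"
          by (rule flip_tf)
        have s1: "\<gamma> (x * \<alpha>0 (?i 1)) / \<gamma> x = 1" using i1 g(2) x0 by simp
        have s2: "\<gamma> (x * \<alpha>0 (?i (\<gamma> s))) / \<gamma> x = \<gamma> y / \<gamma> x" using inv[OF sB(1)] ys by simp
        show "\<gamma> y / \<gamma> x \<in> N'" unfolding N'_def by (rule orbI[OF M]) (simp_all only: s1 s2)
      }
      {
        assume "\<gamma> y / \<gamma> x \<in> N'"
        then obtain \<alpha>0 \<beta>0 where g: "(\<alpha>0, \<beta>0) \<in> tf ?m (F l)" "\<alpha>0 1 = 1" "\<gamma> y / \<gamma> x = \<beta>0 (\<gamma> s)"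
          by (auto simp: N'_def orb_def)
        have ys: "\<gamma> x * \<alpha>0 (\<gamma> s) = \<gamma> y" using g(3) tf_flip(2)[OF g(1) gsB] x0 by (simp add: field_simps)
        have "flip l False (\<lambda>z. ?i (\<gamma> x * \<alpha>0 (\<gamma> z)) / x)"
          using flip_divide[OF flip_comp[OF flip_comp[OF flip_comp[OF fg tf_flip(1)[OF g(1)]] flip_mult[OF gB[OF xy(1)]]] flip_inv[OF fg]] xy(1)]
          by simp
        then have M: "(\<lambda>z. ?i (\<gamma> x * \<alpha>0 (\<gamma> z)) / x, \<lambda>z. ?i (\<gamma> x * \<alpha>0 (\<gamma> z)) / x) \<in> tf ?m (F l)"
          by (rule flip_tf)
        have s1: "?i (\<gamma> x * \<alpha>0 (\<gamma> 1)) / x = 1" using inv[OF xy(1)] t(2) g(2) x0 by simp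
        have s2: "?i (\<gamma> x * \<alpha>0 (\<gamma> s)) / x = y / x" using inv[OF xy(2)] ys by simp
        show "y / x \<in> N" unfolding N_def by (rule orbI[OF M]) (simp_all only: s1 s2)
      }
    qed
    then show ?thesis unfolding link_def by blast
  qed
  let ?P = "\<lambda>M. (\<lambda>z. z ^ k) ` M"
  have "s ^ k \<in> ?P N" using sN by blast
  then have N'N: "N' \<subseteq> ?P N"
    using orb_subset[OF invset_power[OF invN(1) m0 em ck]] unfolding N'_def gk by blast
  have lkP: "link ?m \<gamma> \<gamma> (?P N) (?P N')" using link_power[OF m0 em gbij gbij ck sub lk] .
  \<comment> \<open>Two descriptions of \<gamma> (\<gamma> s) are compared: it is a (k * k)-th power
    of an element of N, because \<open>N'\<close> lies in the k-th powers of N, and it lies in N,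
    because \<gamma> applied twice is a flip with flag \<open>False\<close>.\<close>
  have "\<gamma> s / 1 \<in> ?P N" using sN gk by simp
  then have "\<gamma> (\<gamma> s) / \<gamma> 1 \<in> ?P N'" using linkD(1)[OF lkP rt_1 gsB] by blast
  then obtain u where u: "u \<in> N" "\<gamma> (\<gamma> s) = u ^ (k * k)" using N'N t(2) by (auto simp: power_mult)
  have "(\<lambda>x. \<gamma> (\<gamma> x), \<lambda>x. \<gamma> (\<gamma> x)) \<in> tf ?m (F l)" using flip_tf flip_comp[OF fg fg] by simp
  then have "\<gamma> (\<gamma> s) \<in> N" unfolding N_def by (rule orbI) (use t(2) in simp_all)
  then have kk: "(\<lambda>z. z ^ (k * k)) ` N = N"
    using orb_power[OF sB(1) m0 em, of "k * k" u "F l"] ck u unfolding N_def by simp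
  have pows: "s ^ ((k * k) ^ j) \<in> N" for j
  proof (induction j)
    case (Suc j)
    then have "(s ^ ((k * k) ^ j)) ^ (k * k) \<in> N" using kk by blast
    then show ?case by (simp add: power_mult[symmetric] mult.commute)
  qed (use sN in simp)
  have "odd (p ^ l)" using p(2) by simp
  \<comment> \<open>Writing the odd number \<open>p ^ l\<close> as 2 j + 1 expresses s through j
    applications of the (k * k)-th power, which stay in N, and one k-th power.\<close>
  then obtain j where j: "p ^ l = 2 * j + 1" by (rule oddE)
  have "p ^ l dvd k ^ p ^ l - 1" using power_prime_power_mod[OF p(1) k1, of l] by (meson dvd_trans le_imp_power_dvd le_SucI order_refl)
  moreover have ok: "odd k" by (simp add: k_def)
  then have "2 dvd k ^ p ^ l - 1" by simp
  moreover have "coprime 2 (p ^ l)" using p(2) by simp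
  ultimately have "?m dvd k ^ p ^ l - 1" by (simp add: divides_mult)
  moreover have "k ^ p ^ l \<ge> 1" using ok by (metis One_nat_def Suc_leI odd_pos zero_less_power)
  ultimately obtain q where q: "k ^ p ^ l = 1 + ?m * q" by (metis dvd_def le_add_diff_inverse)
  have "s ^ (k ^ p ^ l) = s * (s ^ ?m) ^ q" unfolding q by (simp add: power_add power_mult)
  then have sk: "s ^ (k ^ p ^ l) = s" using sB(1) by (simp add: rt_def)
  have "(k * k) ^ j * k = k ^ p ^ l" unfolding j by (simp add: power_mult power2_eq_square)
  then have "(s ^ ((k * k) ^ j)) ^ k = s ^ (k ^ p ^ l)" by (simp only: power_mult[symmetric])
  then have "?P N = N" using orb_power[OF sB(1) m0 em ck, of "s ^ ((k * k) ^ j)" "F l"] pows[of j] sN sk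
    unfolding N_def by simp
  then have "\<gamma> s \<in> N" using sN gk by blast
  moreover have "invset ?m (F l) (S \<inter> B l)" unfolding invset_def tf_def by auto
  then have "N \<subseteq> S" unfolding N_def using orb_subset[of ?m "F l" "S \<inter> B l" s] s(2) sB(1) by blast
  ultimately have "\<gamma> s \<in> S" by blast
  then have "- s \<in> S" using fg sB(1) rt_1 t(2) unfolding flip_def by (metis div_by_1)
  then show False using s w(1) by (auto simp: W_def)
qed

text \<open>The least layer containing \<open>W\<close> works. A step by an element of
  \<open>W\<close> stays in \<open>W\<close> and keeps the sign, and a suitable w generates the
  layer up to sign. Choosing w of odd order is possible since \<open>W\<close> =
  -\<open>W\<close>.\<close>

lemma good_base:
  assumes "W \<noteq> {}"
  shows "\<exists>l. good l"
proof -
  have "W \<inter> {1, -1} = {}" using one_notin_W by blast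
  moreover have "B 0 = {1, -1}" by (auto simp: rt_def power2_eq_1_iff)
  ultimately have "\<not> W \<subseteq> B 0" using assms by blast
  moreover have "W \<subseteq> B e" unfolding W_def n[symmetric] by blast
  ultimately obtain l x where l: "0 < l" "l \<le> e" "W \<subseteq> B l" "x \<in> W" "x \<notin> B (l - 1)"
    using layer_exists[of W 2 p e 0] by blast
  have op: "odd (p ^ i)" for i using p(2) by simp
  obtain w where w: "w \<in> W" "w \<in> rt (p ^ l)" "w \<notin> B (l - 1)"
    using rt_double_cases[of x "p ^ l"] l op neg_B W_uminus by (metis subsetD)
  have wB: "w \<in> B l" using w l by blast
  have wn: "w \<in> rt n" using w by (simp add: W_def)
  have w0: "w \<noteq> 0" using nz wn by blast
  have st: "\<alpha> (y * w) / \<alpha> y \<in> W \<and> (\<beta> (y * w) = \<alpha> (y * w) \<longleftrightarrow> \<beta> y = \<alpha> y)"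
    if t: "(\<alpha>, \<beta>) \<in> T" and y: "y \<in> rt n" for \<alpha> \<beta> y
  proof -
    have "y * w / y \<in> W" using w nz[OF y] by simp
    then show ?thesis using T_VW(2)[OF t y rt_mult[OF y wn]] T_twist_W[OF t y rt_mult[OF y wn]] by blast
  qed
  have blk: "\<alpha> (y * z) / \<alpha> y \<in> B l \<and> (\<beta> (y * z) = \<alpha> (y * z) \<longleftrightarrow> \<beta> y = \<alpha> y)"
    if t: "(\<alpha>, \<beta>) \<in> T" and y: "y \<in> rt n" "z \<in> B l" for \<alpha> \<beta> y z
    using T_generated_subgroup[OF wn wB w(3) l(2) _ t y] st[OF t] l(3) by blast
  have "\<beta> 1 = 1" if t: "(\<alpha>, \<beta>) \<in> T" "\<alpha> 1 = 1" and tr: "\<forall>v \<in> B l. \<alpha> v / v \<in> B (l - 1)" for \<alpha> \<beta>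
  proof (rule ccontr)
    assume "\<beta> 1 \<noteq> 1"
    then have b1: "\<beta> 1 = -1" using T_sign[OF t(1) rt_1] t(2) by auto
    \<comment> \<open>With sign -1 at x, the deviation of the step w is excluded from the odd part
      of \<open>B (l - 1)\<close>, so its negative lies there. Every step by w thus contributes a
      factor -1.\<close>
    have neg: "- (\<alpha> (x * w) / (\<alpha> x * w)) \<in> rt (p ^ (l - 1))" if x: "x \<in> B l" for x
    proof -
      have xn: "x \<in> rt n" using x B_rt l by blast
      have a0: "\<alpha> x \<noteq> 0" "x \<noteq> 0" using nz tf_im(1)[OF t(1) xn] xn by auto
      have "\<beta> x \<noteq> \<alpha> x" using blk[OF t(1) rt_1 x] b1 t(2) by simp
      then have bx: "\<beta> x = - \<alpha> x" using T_sign[OF t(1) xn] by blast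
      have "\<alpha> (x * w) / \<alpha> x / w \<notin> rt (p ^ (l - 1))"
        using base_step[OF _ l(2) w blk tf_shift[OF t(1) xn tf_im(1)[OF t(1) xn] n0]] l(1) a0 bx by simp
      moreover have "\<alpha> (x * w) / (x * w) / (\<alpha> x / x) \<in> B (l - 1)" using tr x wB rt_mult rt_divide by blast
      then have "\<alpha> (x * w) / (\<alpha> x * w) \<in> B (l - 1)" using a0 w0 by (simp add: field_simps)
      ultimately show ?thesis using rt_double_cases op by (metis divide_divide_eq_left)
    qed
    have "\<exists>c\<in>rt (p ^ (l - 1)). \<alpha> (w ^ j) = (-1) ^ j * c * w ^ j" for j
    proof (induction j)
      case (Suc j)
      then obtain c where c: "c \<in> rt (p ^ (l - 1))" "\<alpha> (w ^ j) = (-1) ^ j * c * w ^ j" by blast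
      define d where "d = - (\<alpha> (w ^ j * w) / (\<alpha> (w ^ j) * w))"
      have d: "d \<in> rt (p ^ (l - 1))" unfolding d_def using neg rt_power wB by blast
      have "\<alpha> (w ^ j) \<noteq> 0" using nz tf_im(1)[OF t(1)] rt_power wn by blast
      then have "\<alpha> (w ^ j * w) = - (d * \<alpha> (w ^ j) * w)" using w0 by (simp add: d_def)
      then have "\<alpha> (w ^ Suc j) = (-1) ^ Suc j * (c * d) * w ^ Suc j" by (simp add: c(2) mult.commute mult.left_commute)
      then show ?case using rt_mult c(1) d by blast
    qed (use t(2) in \<open>auto intro!: bexI[of _ 1]\<close>)
    \<comment> \<open>After \<open>p ^ l\<close> steps the walk is back at 1. This number is odd, so
      the accumulated factors leave -1 in a group of odd order.\<close>
    from this[of "p ^ l"] obtain c where c: "c \<in> rt (p ^ (l - 1))" "\<alpha> (w ^ p ^ l) = (-1) ^ p ^ l * c * w ^ p ^ l" by blast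
    have "w ^ p ^ l = 1" using w(2) by (simp add: rt_def)
    then have "c = -1" using c(2) t(2) op[of l] by (simp add: minus_equation_iff)
    then show False using c(1) op[of "l - 1"] by (simp add: rt_def)
  qed
  then have "good l" unfolding good_def using l blk by auto
  then show ?thesis ..
qed

section \<open>Enlarging a subgroup on whose cosets the sign is constant\<close>

text \<open>The elements obstructing the periodicity of \<open>S\<close> outside \<open>B r\<close>.\<close>

definition Q where
  "Q r = {x \<in> rt n. x \<notin> B r \<and> \<not> (\<forall>b \<in> B r. x * b \<in> orb n {V} x)}"

text \<open>Since \<open>V\<close> is symmetric, the identity paired with negation is a two-fold
  automorphism for \<open>V\<close>.\<close>

lemma orbV_uminus:
  assumes "x \<in> rt n"
  shows "- z \<in> orb n {V} x \<longleftrightarrow> z \<in> orb n {V} x"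
proof -
  have b: "bij_betw uminus (rt n) (rt n)"
    by (rule bij_betw_byWitness[where f' = uminus]) (use neg_rt in auto)
  have "(\<lambda>t. t, uminus) \<in> tf n {V}"
    unfolding tf_def link_def using b bij_betw_id[of "rt n"] V_uminus by (simp add: id_def)
  then have lk: "link n (\<lambda>t. t) uminus (orb n {V} x) (orb n {V} x)"
    using invset_orb[OF assms n0, of "{V}"] by (auto simp: invset_def)
  have "orb n {V} x \<subseteq> rt n" using invset_orb[OF assms n0, of "{V}"] by (auto simp: invset_def)
  then show ?thesis using linkD(1)[OF lk rt_1, of z] neg_rt[of z] by auto
qed

lemma orbV_T:
  assumes "(\<alpha>, \<beta>) \<in> T" "x \<in> rt n" "y \<in> rt n" "z \<in> rt n"
  shows "\<alpha> z / \<alpha> y \<in> orb n {V} x \<longleftrightarrow> z / y \<in> orb n {V} x"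
  using linkD(1)[of n \<alpha> \<alpha>] invset_orb[OF assms(2) n0, of "{V}"] T_tfV[OF assms(1)] assms(3,4)
  unfolding invset_def by blast

text \<open>The map \<alpha> respects the orbits for \<open>V\<close> and, by \<open>good r\<close>,
  the cosets of \<open>B r\<close>. The set \<open>Q r\<close> is defined in terms of these
  alone.\<close>

lemma Q_step:
  assumes g: "good r" and t: "(\<alpha>, \<beta>) \<in> T" and y: "y \<in> rt n" and x: "x \<in> Q r"
  shows "\<alpha> (y * x) / \<alpha> y \<in> orb n {V} x" "\<alpha> (y * x) / \<alpha> y \<in> Q r"
proof -
  let ?x' = "\<alpha> (y * x) / \<alpha> y"
  have xn: "x \<in> rt n" "x \<notin> B r" using x by (auto simp: Q_def)
  have yx: "y * x \<in> rt n" using rt_mult y xn by blast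
  have y0: "y \<noteq> 0" using nz y .
  have a: "\<alpha> y \<in> rt n" "\<alpha> (y * x) \<in> rt n" using tf_im(1)[OF t] y yx by auto
  have a0: "\<alpha> y \<noteq> 0" "\<alpha> (y * x) \<noteq> 0" using nz a by auto
  have x'n: "?x' \<in> rt n" using rt_divide a by blast
  show xo: "?x' \<in> orb n {V} x"
    using orbV_T[OF t xn(1) y yx] orb_refl[OF n0, of x] y0 by simp
  have "?x' \<notin> B r"
  proof
    assume "?x' \<in> B r"
    let ?i = "inv_into (rt n) \<alpha>"
    have i: "?i (\<alpha> z) = z" if "z \<in> rt n" for z
      using t that by (auto simp: tf_def bij_betw_inv_into_left)
    have "?i (\<alpha> y * ?x') / ?i (\<alpha> y) \<in> B r" using goodD(4)[OF g tf_inv[OF t] a(1) \<open>?x' \<in> B r\<close>] .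
    then have "y * x / y \<in> B r" using i[OF y] i[OF yx] a0 by simp
    then show False using xn y0 by simp
  qed
  moreover have "\<not> (\<forall>b \<in> B r. ?x' * b \<in> orb n {V} ?x')"
  proof
    assume al: "\<forall>b \<in> B r. ?x' * b \<in> orb n {V} ?x'"
    have "x * b \<in> orb n {V} x" if b: "b \<in> B r" for b
    proof -
      have bn: "b \<in> rt n" using b B_rt goodD(2)[OF g] by blast
      have "\<alpha> (y * x * b) / \<alpha> (y * x) \<in> B r" using goodD(4)[OF g t yx b] .
      then have "?x' * (\<alpha> (y * x * b) / \<alpha> (y * x)) \<in> orb n {V} ?x'" using al by blast
      then have "\<alpha> (y * x * b) / \<alpha> y \<in> orb n {V} x" using orb_eq[OF xn(1) n0 xo] a0 by simp
      then have "y * x * b / y \<in> orb n {V} x" using orbV_T[OF t xn(1) y rt_mult[OF yx bn]] by blast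
      then show ?thesis using y0 by (simp add: mult.assoc)
    qed
    then show False using x by (auto simp: Q_def)
  qed
  ultimately show "?x' \<in> Q r" using x'n by (simp add: Q_def)
qed

text \<open>Otherwise the powers of c cover \<open>B r\<close> up to sign, and the coset argument
  for orbits puts all of x \<open>B r\<close> into the orbit of x, contrary to the choice of
  x.\<close>

lemma Q_coset:
  assumes g: "good r" and x: "x \<in> Q r" "x \<in> B l" "x \<notin> B (l - 1)" and l: "1 \<le> l" "l \<le> e"
    and c: "c \<in> B (l - 1)" "x * c \<in> orb n {V} x"
  shows "c \<in> B (r - 1)"
proof -
  have op: "odd (p ^ i)" for i using p(2) by simp
  have xn: "x \<in> rt n" using x by (simp add: Q_def)
  obtain a where a: "a \<in> rt (p ^ (l - 1))" "a = c \<or> a = - c"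
    using rt_double_cases[OF c(1) op] by blast
  have xa: "x * a \<in> orb n {V} x" using a(2) c(2) orbV_uminus[OF xn, of "x * c"] by auto
  have "a \<in> rt (p ^ (r - 1))"
  proof (rule ccontr)
    assume na: "a \<notin> rt (p ^ (r - 1))"
    have "x * b \<in> orb n {V} x" if b: "b \<in> B r" for b
    proof -
      obtain d where d: "d \<in> rt (p ^ r)" "d = b \<or> d = - b" using rt_double_cases[OF b op] by blast
      obtain j where "d = a ^ j" using rt_cover[OF p(1) a(1) na d(1)] by blast
      then have "x * d \<in> orb n {V} x"
        using orb_coset[OF p, of x e l x a "{V}" j] xn n l x a xa orb_refl[OF n0, of x] by simp
      then show ?thesis using d(2) orbV_uminus[OF xn, of "x * b"] by auto
    qed
    then show False using x by (auto simp: Q_def)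
  qed
  then have "a \<in> B (r - 1)" using rt_mono[of "p ^ (r - 1)" "2 * p ^ (r - 1)"] by auto
  then show ?thesis using a(2) neg_B by auto
qed

text \<open>The new subgroup is generated, up to sign, by an x in the top layer of
  \<open>Q r\<close>. To compare the signs at y and y x, the pair rebased at y is composed with the
  inverse of the pair rebased at y x. The composite acts trivially on \<open>B r\<close> modulo
  \<open>B (r - 1)\<close>, and the last clause of \<open>good r\<close> turns this into equality of
  the signs.\<close>

lemma good_extend:
  assumes g: "good r" and Q: "Q r \<noteq> {}"
  shows "\<exists>l>r. good l"
proof -
  have Qn: "Q r \<subseteq> B e" unfolding Q_def n[symmetric] by blast
  have QB: "Q r \<inter> B r = {}" by (auto simp: Q_def)
  have "\<not> Q r \<subseteq> B r" using QB Q by blast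
  then obtain l x where l: "r < l" "l \<le> e" "Q r \<subseteq> B l" "x \<in> Q r" "x \<notin> B (l - 1)"
    using layer_exists[OF Qn] by blast
  have l1: "1 \<le> l" using l by simp
  have xB: "x \<in> B l" using l by blast
  have xn: "x \<in> rt n" using l by (auto simp: Q_def)
  have x0: "x \<noteq> 0" using nz xn .
  have Brl: "B r \<subseteq> B l" using rt_mono_power l(1) by simp
  have Brn: "B r \<subseteq> rt n" using B_rt goodD(2)[OF g] .
  have st1: "\<alpha> (y * x) / \<alpha> y \<in> B l" if "(\<alpha>, \<beta>) \<in> T" "y \<in> rt n" for \<alpha> \<beta> y
    using Q_step(2)[OF g that l(4)] l(3) by blast
  have Qc: "c \<in> B (r - 1)" if xc: "x' \<in> Q r" "c \<in> B r" "x' * c \<in> orb n {V} x'" for x' c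
  proof -
    have "\<not> {x'} \<subseteq> B r" using xc(1) QB by blast
    then obtain l' where l': "r < l'" "l' \<le> e" "x' \<in> B l'" "x' \<notin> B (l' - 1)"
      using layer_exists[of "{x'}" 2 p e r] xc(1) Qn by auto
    have "r \<le> l' - 1" using l'(1) by simp
    then have "c \<in> B (l' - 1)" using rt_mono_power xc(2) by blast
    then show ?thesis using Q_coset[OF g xc(1) l'(3,4) _ l'(2) _ xc(3)] l'(1) by simp
  qed
  have st2: "\<beta> (y * x) = \<alpha> (y * x) \<longleftrightarrow> \<beta> y = \<alpha> y" if t: "(\<alpha>, \<beta>) \<in> T" and y: "y \<in> rt n" for \<alpha> \<beta> y
  proof -
    have yx: "y * x \<in> rt n" using rt_mult y xn by blast
    have a: "\<alpha> y \<in> rt n" "\<alpha> (y * x) \<in> rt n" using tf_im(1)[OF t] y yx by auto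
    have a0: "\<alpha> y \<noteq> 0" "\<alpha> (y * x) \<noteq> 0" using nz a by auto
    define \<gamma> where "\<gamma> z = \<alpha> (y * z) / \<alpha> y" for z
    define \<delta> where "\<delta> z = \<beta> (y * z) / \<alpha> y" for z
    define \<gamma>' where "\<gamma>' z = \<alpha> (y * x * z) / \<alpha> (y * x)" for z
    define \<delta>' where "\<delta>' z = \<beta> (y * x * z) / \<alpha> (y * x)" for z
    have t1: "(\<gamma>, \<delta>) \<in> T" unfolding \<gamma>_def \<delta>_def using tf_shift[OF t y a(1) n0] .
    have t2: "(\<gamma>', \<delta>') \<in> T" unfolding \<gamma>'_def \<delta>'_def using tf_shift[OF t yx a(2) n0] .
    have one: "\<gamma> 1 = 1" "\<gamma>' 1 = 1" using a0 by (auto simp: \<gamma>_def \<gamma>'_def)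
    let ?i = "inv_into (rt n) \<gamma>'" and ?j = "inv_into (rt n) \<delta>'"
    have i: "?i (\<gamma>' z) = z" "?j (\<delta>' z) = z" if "z \<in> rt n" for z
      using t2 that by (auto simp: tf_def bij_betw_inv_into_left)
    have i': "\<gamma>' (?i z) = z" if "z \<in> rt n" for z
      using t2 that by (auto simp: tf_def bij_betw_inv_into_right)
    have i1: "?i 1 = 1" using i(1)[OF rt_1] one by simp
    have D: "(\<lambda>z. \<gamma> (?i z), \<lambda>z. \<delta> (?j z)) \<in> T" using tf_comp[OF tf_inv[OF t2] t1] .
    have "\<gamma> (?i v) / v \<in> B (r - 1)" if v: "v \<in> B r" for v
    proof -
      define z where "z = ?i v"
      have vn: "v \<in> rt n" using v Brn by blast
      have zB: "z \<in> B r" using goodD(4)[OF g tf_inv[OF t2] rt_1 v] i1 by (simp add: z_def)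
      have zn: "z \<in> rt n" using zB Brn by blast
      have gz: "\<gamma>' z = v" using i' vn by (simp add: z_def)
      have yz: "y * z \<in> rt n" using rt_mult y zn by blast
      define x' where "x' = \<alpha> (y * x) / \<alpha> y"
      define c where "c = \<gamma>' z / \<gamma> z"
      have "\<gamma> z \<in> B r" using goodD(4)[OF g t1 rt_1 zB] one by simp
      then have cB: "c \<in> B r" unfolding c_def gz using v rt_divide by blast
      have az: "\<alpha> (y * z) \<noteq> 0" using nz tf_im(1)[OF t yz] .
      \<comment> \<open>The steps x and z from y commute, so x' c is the image of the step x taken
        at y z. It therefore lies in the same orbit as x', which confines c to
        \<open>B (r - 1)\<close>.\<close>
      have "x' * c = \<alpha> (y * z * x) / \<alpha> (y * z)"
        using a0 az unfolding x'_def c_def \<gamma>_def \<gamma>'_def by (simp add: mult.commute mult.left_commute)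
      then have "x' * c \<in> orb n {V} x" using Q_step(1)[OF g t yz l(4)] by simp
      moreover have x': "x' \<in> orb n {V} x" "x' \<in> Q r" unfolding x'_def using Q_step[OF g t y l(4)] by auto
      ultimately have "c \<in> B (r - 1)" using Qc[OF x'(2) cB] orb_eq[OF xn n0 x'(1)] by simp
      then have "1 / c \<in> B (r - 1)" using rt_divide rt_1 by blast
      moreover have "1 / c = \<gamma> (?i v) / v" unfolding c_def gz by (simp add: z_def)
      ultimately show ?thesis by simp
    qed
    then have D1: "\<delta> (?j 1) = 1" using goodD(6)[OF g D] i1 one by auto
    have y1: "\<delta> 1 = \<beta> y / \<alpha> y" "\<delta>' 1 = \<beta> (y * x) / \<alpha> (y * x)" by (auto simp: \<delta>_def \<delta>'_def)
    show ?thesis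
    proof (cases "\<beta> (y * x) = \<alpha> (y * x)")
      case True
      then have "\<delta>' 1 = 1" using y1 a0 by simp
      then have "?j 1 = 1" using i(2)[OF rt_1] by simp
      then show ?thesis using D1 y1 a0 True by simp
    next
      case False
      then have "\<beta> (y * x) = - \<alpha> (y * x)" using T_sign[OF t yx] by blast
      then have "\<delta>' 1 = -1" using y1 a0 by simp
      then have "\<delta>' (-1) = 1" using T_minus(2)[OF t2 rt_1] by simp
      then have "?j 1 = -1" using i(2)[of "-1"] neg_rt[of 1] by simp
      then have "\<delta> 1 = -1" using D1 T_minus(2)[OF t1 rt_1] by (simp add: minus_equation_iff)
      then have "\<beta> y = - \<alpha> y" using y1 a0 by (simp add: field_simps)
      then show ?thesis using False a0 by simp
    qed
  qed
  have "\<beta> 1 = 1" if t: "(\<alpha>, \<beta>) \<in> T" "\<alpha> 1 = 1" and tr: "\<forall>v \<in> B l. \<alpha> v / v \<in> B (l - 1)" for \<alpha> \<beta>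
  proof -
    \<comment> \<open>A deviation known to lie in \<open>B (l - 1)\<close> is confined to
      \<open>B (r - 1)\<close> at each step by x. Triviality on the top layer of \<open>B l\<close>
      thus descends to the top layer of \<open>B r\<close>, where the last clause of
      \<open>good r\<close> is available.\<close>
    have pw: "\<alpha> (x ^ m) / x ^ m \<in> B (r - 1)" for m
    proof (induction m)
      case (Suc m)
      have xm: "x ^ m \<in> rt n" "x ^ m \<in> B l" using rt_power xn xB by auto
      have am: "\<alpha> (x ^ m) \<noteq> 0" using nz tf_im(1)[OF t(1) xm(1)] .
      define q where "q = \<alpha> (x ^ m * x) / \<alpha> (x ^ m)"
      define c where "c = q / x"
      have q: "q \<in> orb n {V} x" unfolding q_def using Q_step(1)[OF g t(1) xm(1) l(4)] .
      have "\<alpha> (x ^ m * x) / (x ^ m * x) / (\<alpha> (x ^ m) / x ^ m) \<in> B (l - 1)"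
        using tr xm xB rt_mult rt_divide by blast
      then have cB: "c \<in> B (l - 1)" using x0 am by (simp add: c_def q_def field_simps)
      have "x * c = q" using x0 by (simp add: c_def)
      then have "c \<in> B (r - 1)" using Q_coset[OF g l(4) xB l(5) l1 l(2) cB] q by simp
      then have "c * (\<alpha> (x ^ m) / x ^ m) \<in> B (r - 1)" using Suc rt_mult by blast
      moreover have "c * (\<alpha> (x ^ m) / x ^ m) = \<alpha> (x ^ Suc m) / x ^ Suc m"
        using am x0 by (simp add: c_def q_def mult.commute)
      ultimately show ?case by simp
    qed (use t(2) in simp)
    have "\<alpha> v / v \<in> B (r - 1)" if v: "v \<in> B r" for v
    proof -
      have "v \<in> B l" using v Brl by blast
      then obtain m where m: "v = x ^ m \<or> v = - (x ^ m)" using rt_double_pm_gen[OF p xB l(5)] by blast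
      then show ?thesis using pw[of m] T_minus(1)[OF t(1), of "x ^ m"] rt_power[OF xn] by auto
    qed
    then show ?thesis using goodD(6)[OF g t] by blast
  qed
  moreover have "\<alpha> (y * z) / \<alpha> y \<in> B l \<and> (\<beta> (y * z) = \<alpha> (y * z) \<longleftrightarrow> \<beta> y = \<alpha> y)"
    if t: "(\<alpha>, \<beta>) \<in> T" and y: "y \<in> rt n" "z \<in> B l" for \<alpha> \<beta> y z
    using T_generated_subgroup[OF xn xB l(5) l(2) _ t y] st1[OF t] st2[OF t] by blast
  ultimately have "good l" unfolding good_def using l1 l(2) goodD(3)[OF g] Brl by auto
  then show ?thesis using l(1) by blast
qed

text \<open>For the largest good r the set \<open>Q r\<close> is empty, so outside
  \<open>B r\<close> the set S is symmetric and a union of cosets of \<open>B r\<close>. Hence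
  quotients between different cosets only need to stay in their coset of \<open>B r\<close>, whereas
  inside a coset the sign -1 makes \<alpha> exchange S and -S.\<close>

lemma glued_isomorphism:
  "\<exists>\<phi>. bij_betw \<phi> (rt n) (rt n) \<and> (\<forall>x\<in>rt n. \<forall>y\<in>rt n. y / x \<in> S \<longleftrightarrow> - (\<phi> y / \<phi> x) \<in> S)"
proof (cases "W = {}")
  case True
  then have "z \<in> S \<longleftrightarrow> - z \<in> S" if "z \<in> rt n" for z using that by (auto simp: W_def)
  then have "\<forall>x\<in>rt n. \<forall>y\<in>rt n. y / x \<in> S \<longleftrightarrow> - (id y / id x) \<in> S" using rt_divide by simp
  then show ?thesis using bij_betw_id by blast
next
  case False
  define r where "r = Max {r. good r}"
  have fin: "finite {r. good r}" by (rule finite_subset[of _ "{..e}"]) (auto dest: goodD(2))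
  have g: "good r" using Max_in[OF fin] good_base[OF False] by (auto simp: r_def)
  have "Q r = {}"
  proof (rule ccontr)
    assume "Q r \<noteq> {}"
    then obtain l where "r < l" "good l" using good_extend[OF g] by blast
    then show False using Max_ge[OF fin, of l] by (simp add: r_def)
  qed
  then have per: "x * b \<in> orb n {V} x" if "x \<in> rt n" "x \<notin> B r" "b \<in> B r" for x b
    using that by (auto simp: Q_def)
  have Brn: "B r \<subseteq> rt n" using B_rt goodD(2)[OF g] .
  have SV: "z \<in> S \<longleftrightarrow> z \<in> V" "- z \<in> S \<longleftrightarrow> z \<in> V" if "z \<in> rt n" "z \<notin> B r" for z
    using that goodD(3)[OF g] by (auto simp: V_def W_def)
  have invV: "invset n {V} V" unfolding invset_def tf_def V_def by auto
  have Vb: "z * b \<in> V" if "z \<in> V" "z \<notin> B r" "b \<in> B r" for z b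
    using per[of z b] that orb_subset[OF invV that(1)] by (auto simp: V_def)
  obtain \<alpha> \<beta> where t: "(\<alpha>, \<beta>) \<in> T" "\<alpha> 1 = 1" "\<beta> 1 = -1" using twisted by blast
  have aB: "\<alpha> v \<in> B r" if "v \<in> B r" for v using goodD(4)[OF g t(1) rt_1 that] t(2) by simp
  have bB: "\<beta> v = - \<alpha> v" if "v \<in> B r" for v
    using goodD(5)[OF g t(1) rt_1 that] T_sign[OF t(1), of v] t(2,3) that Brn by auto
  \<comment> \<open>The predicate under \<open>SOME\<close> is the same for all x in a coset, so
    \<open>\<rho>\<close> picks one representative for each coset.\<close>
  define \<rho> where "\<rho> x = (SOME y. y \<in> rt n \<and> x / y \<in> B r)" for x
  define \<phi> where "\<phi> x = \<rho> x * \<alpha> (x / \<rho> x)" for x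
  have \<rho>: "\<rho> x \<in> rt n" "x / \<rho> x \<in> B r" if "x \<in> rt n" for x
  proof -
    have "\<exists>y. y \<in> rt n \<and> x / y \<in> B r" using that nz[OF that] by (intro exI[of _ x]) simp
    from someI_ex[OF this] show "\<rho> x \<in> rt n" "x / \<rho> x \<in> B r" unfolding \<rho>_def by auto
  qed
  have \<rho>eq: "\<rho> x = \<rho> y" if xy: "x \<in> rt n" "y \<in> rt n" "y / x \<in> B r" for x y
  proof -
    have x0: "x \<noteq> 0" "y \<noteq> 0" using nz xy by auto
    have "x / z \<in> B r \<longleftrightarrow> y / z \<in> B r" for z
      using rt_mult[OF xy(3), of "x / z"] rt_divide[OF _ xy(3), of "y / z"] x0 by auto
    then show ?thesis unfolding \<rho>_def by simp
  qed
  have \<phi>n: "\<phi> x \<in> rt n" if "x \<in> rt n" for x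
    unfolding \<phi>_def using rt_mult \<rho>[OF that] aB Brn by blast
  have \<phi>B: "\<exists>b\<in>B r. \<phi> y / \<phi> x = y / x * b" if xy: "x \<in> rt n" "y \<in> rt n" for x y
  proof -
    have q: "\<phi> z / z \<in> B r" if "z \<in> rt n" for z
    proof -
      have e: "\<phi> z / z = \<alpha> (z / \<rho> z) / (z / \<rho> z)" by (simp add: \<phi>_def)
      show ?thesis unfolding e using rt_divide aB \<rho>(2)[OF that] by blast
    qed
    have "\<phi> y / \<phi> x = y / x * ((\<phi> y / y) / (\<phi> x / x))" using nz[OF xy(1)] nz[OF xy(2)] by simp
    then show ?thesis using rt_divide[OF q[OF xy(2)] q[OF xy(1)]] by blast
  qed
  have rel: "y / x \<in> S \<longleftrightarrow> - (\<phi> y / \<phi> x) \<in> S" if xy: "x \<in> rt n" "y \<in> rt n" for x y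
  proof (cases "y / x \<in> B r")
    case True
    define z where "z = \<rho> x"
    have z: "\<rho> x = z" "\<rho> y = z" "z \<in> rt n" "z \<noteq> 0" "x / z \<in> B r" "y / z \<in> B r"
      using \<rho>eq[OF xy True] \<rho>(1)[OF xy(1)] nz \<rho>(2)[OF xy(1)] \<rho>(2)[OF xy(2)] unfolding z_def by auto
    have "\<phi> y / \<phi> x = \<alpha> (y / z) / \<alpha> (x / z)" using z by (simp add: \<phi>_def)
    then have "- (\<phi> y / \<phi> x) = \<beta> (y / z) / \<alpha> (x / z)" using bB z by simp
    also have "\<dots> \<in> S \<longleftrightarrow> (y / z) / (x / z) \<in> S" using T_S(1)[OF t(1)] z Brn by blast
    finally show ?thesis using z by simp
  next
    case False
    obtain b where b: "b \<in> B r" "\<phi> y / \<phi> x = y / x * b" using \<phi>B[OF xy] by blast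
    have b0: "b \<noteq> 0" using b nz Brn by blast
    have n2: "y / x \<in> rt n" "\<phi> y / \<phi> x \<in> rt n" using rt_divide xy \<phi>n by auto
    have F2: "\<phi> y / \<phi> x \<notin> B r"
    proof
      assume "\<phi> y / \<phi> x \<in> B r"
      then have "\<phi> y / \<phi> x / b \<in> B r" using rt_divide b by blast
      then show False using False b b0 by simp
    qed
    have "1 / b \<in> B r" using rt_divide rt_1 b by blast
    moreover have "\<phi> y / \<phi> x * (1 / b) = y / x" using b b0 by simp
    ultimately have "y / x \<in> V \<longleftrightarrow> \<phi> y / \<phi> x \<in> V" using Vb[OF _ False b(1)] Vb[OF _ F2] b(2) by metis
    then show ?thesis using SV[OF n2(1) False] SV[OF n2(2) F2] by simp
  qed
  have "inj_on \<phi> (rt n)"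
  proof (rule inj_onI)
    fix x y assume xy: "x \<in> rt n" "y \<in> rt n" "\<phi> x = \<phi> y"
    obtain b where b: "b \<in> B r" "\<phi> y / \<phi> x = y / x * b" using \<phi>B[OF xy(1,2)] by blast
    have "y / x * b = 1" using b(2) xy(3) nz[OF \<phi>n[OF xy(1)]] by simp
    then have "y / x = 1 / b" using nz[of b] b(1) Brn by (auto simp: field_simps)
    then have "y / x \<in> B r" using rt_divide rt_1 b(1) by simp
    then have e: "\<rho> x = \<rho> y" using \<rho>eq xy by blast
    have r0: "\<rho> y \<noteq> 0" using nz \<rho> xy by blast
    have "\<alpha> (x / \<rho> y) = \<alpha> (y / \<rho> y)" using xy(3) e r0 by (simp add: \<phi>_def)
    then have "x / \<rho> y = y / \<rho> y" using tf_eq_iff(1)[OF t(1)] rt_divide \<rho>(1) xy by metis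
    then show "x = y" using r0 by simp
  qed
  moreover from this have "\<phi> ` rt n = rt n" using \<phi>n finite_rt[OF n0] by (intro endo_inj_surj) auto
  ultimately have "bij_betw \<phi> (rt n) (rt n)" by (simp add: bij_betw_def)
  then show ?thesis using rel by blast
qed

end

text \<open>Rebasing at a point where the two maps differ gives \<alpha> 1 = 1 and \<beta> 1
  \<noteq> 1. The cases are whether the orbit of 1 contains an element of order p. The claim that s
  lies outside \<open>rt p\<close> is what excludes e = 1 in the first alternative.\<close>

theorem unstable_dichotomy:
  assumes p: "prime (p::nat)" "odd p" and n: "n = 2 * p ^ e"
    and S: "S \<subseteq> rt n" "1 \<notin> S"
    and t: "(\<alpha>, \<beta>) \<in> tf n {S}" and x: "x \<in> rt n" "\<alpha> x \<noteq> \<beta> x"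
  shows "(\<forall>s \<in> S \<inter> rt (p ^ e). s \<notin> rt p \<and> (\<forall>u\<in>rt p. s * u \<in> S)) \<or>
    (\<exists>\<phi>. bij_betw \<phi> (rt n) (rt n) \<and> (\<forall>x\<in>rt n. \<forall>y\<in>rt n. y / x \<in> S \<longleftrightarrow> - (\<phi> y / \<phi> x) \<in> S))"
proof (cases "\<exists>h\<in>rt p. h \<noteq> 1 \<and> h \<in> orb n {S} 1")
  case True
  then show ?thesis using subgroup_periodic_of_orbit[OF p n S] by blast
next
  case False
  have n0: "n > 0" using n p prime_gt_0_nat by simp
  have ax: "\<alpha> x \<in> rt n" using tf_im(1)[OF t x(1)] .
  have a0: "\<alpha> x \<noteq> 0" using rt_nz[OF ax n0] .
  have o: "orb n {S} 1 \<subseteq> {1, -1}" using orbit_of_one_signs[OF p n] False by blast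
  define \<gamma> where "\<gamma> z = \<alpha> (x * z) / \<alpha> x" for z
  define \<delta> where "\<delta> z = \<beta> (x * z) / \<alpha> x" for z
  have g: "(\<gamma>, \<delta>) \<in> tf n {S}" unfolding \<gamma>_def \<delta>_def using tf_shift[OF t x(1) ax n0] .
  have g1: "\<gamma> 1 = 1" using a0 by (simp add: \<gamma>_def)
  have "\<delta> 1 \<noteq> 1" using a0 x(2) by (simp add: \<delta>_def)
  then have "\<delta> 1 = -1" using orbI[OF g g1 refl, of 1] o by blast
  then interpret sign_orbit p e n S
    by unfold_locales (use p n S o g g1 in blast)+
  show ?thesis using glued_isomorphism by blast
qed

subsection \<open>Stability in terms of two-fold automorphisms\<close>

definition tf_pair :: "'a ugraph \<Rightarrow> ('a \<Rightarrow> 'a) \<Rightarrow> ('a \<Rightarrow> 'a) \<Rightarrow> bool" where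
  "tf_pair G \<alpha> \<beta> \<longleftrightarrow> bij_betw \<alpha> (verts G) (verts G) \<and> bij_betw \<beta> (verts G) (verts G) \<and>
     (\<forall>u\<in>verts G. \<forall>v\<in>verts G. {u, v} \<in> edges G \<longleftrightarrow> {\<alpha> u, \<beta> v} \<in> edges G)"

text \<open>The natural map starts at the product with the cyclic group of order 2, while stability
  asks for an isomorphism onto it.\<close>

lemma is_iso_symI:
  assumes h: "h \<in> hom G K" "bij_betw h (carrier G) (carrier K)"
    and cl: "\<And>x y. x \<in> carrier G \<Longrightarrow> y \<in> carrier G \<Longrightarrow> x \<otimes>\<^bsub>G\<^esub> y \<in> carrier G"
  shows "K \<cong> G"
proof -
  let ?i = "inv_into (carrier G) h"
  have i: "?i z \<in> carrier G" "h (?i z) = z" if "z \<in> carrier K" for z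
    using h(2) that by (auto simp: bij_betw_inv_into_right inv_into_into bij_betw_imp_surj_on)
  have "?i (y \<otimes>\<^bsub>K\<^esub> z) = ?i y \<otimes>\<^bsub>G\<^esub> ?i z" if yz: "y \<in> carrier K" "z \<in> carrier K" for y z
  proof -
    have "h (?i y \<otimes>\<^bsub>G\<^esub> ?i z) = y \<otimes>\<^bsub>K\<^esub> z" using h(1) i yz by (simp add: hom_mult)
    then show ?thesis using cl[OF i(1) i(1)] yz bij_betw_inv_into_left[OF h(2)] by metis
  qed
  then have "?i \<in> hom K G" using i by (auto simp: hom_def)
  then show ?thesis using bij_betw_inv_into[OF h(2)] unfolding is_iso_def iso_def by blast
qed

lemma verts_times_K2: "verts (times_K2 G) = verts G \<times> {0, 1}"
  by (simp add: times_K2_def)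

lemma edge_times_K2:
  "{(u, i), (v, j)} \<in> edges (times_K2 G) \<longleftrightarrow> {u, v} \<in> edges G \<and> (i = 0 \<and> j = 1 \<or> i = 1 \<and> j = 0)"
proof
  assume "{(u, i), (v, j)} \<in> edges (times_K2 G)"
  then obtain a b where "{a, b} \<in> edges G" "{(u, i), (v, j)} = {(a, 0), (b, 1)}"
    by (auto simp: times_K2_def)
  then show "{u, v} \<in> edges G \<and> (i = 0 \<and> j = 1 \<or> i = 1 \<and> j = 0)"
    by (auto simp: doubleton_eq_iff insert_commute)
next
  assume *: "{u, v} \<in> edges G \<and> (i = 0 \<and> j = 1 \<or> i = 1 \<and> j = 0)"
  have "{(a, 0), (b, 1)} \<in> edges (times_K2 G)" if "{a, b} \<in> edges G" for a b
    using that by (auto simp: times_K2_def)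
  then show "{(u, i), (v, j)} \<in> edges (times_K2 G)" using * by (auto simp: insert_commute)
qed

lemma connected_invariant:
  assumes "connected_graph G" "\<And>E. E \<in> edges G \<Longrightarrow> E \<subseteq> verts G"
    and "\<And>u v. u \<in> verts G \<Longrightarrow> v \<in> verts G \<Longrightarrow> {u, v} \<in> edges G \<Longrightarrow> f u = f v"
    and "u \<in> verts G" "v \<in> verts G"
  shows "f u = f v"
proof -
  have "(u, v) \<in> {(x, y). {x, y} \<in> edges G}\<^sup>*" using assms by (simp add: connected_graph_def)
  then show ?thesis
  proof (induction rule: rtrancl_induct)
    case (step y z)
    then have "{y, z} \<in> edges G" by simp
    then show ?case using step assms(2)[of "{y, z}"] assms(3)[of y z] by simp
  qed simp
qed

text \<open>Let h record the layer of the image. Adjacent vertices in opposite layers receive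
  opposite values. Non-bipartiteness forces the two copies of each vertex into different layers, and
  connectedness then makes the layer constant, so the two layers are either kept or swapped as a
  whole.\<close>

lemma times_K2_automorphism:
  assumes fin: "finite (verts G)" and con: "connected_graph G" and nb: "\<not> bipartite_graph G"
    and wf: "\<And>E. E \<in> edges G \<Longrightarrow> \<exists>u\<in>verts G. \<exists>v\<in>verts G. E = {u, v}"
    and F: "F \<in> graph_isos (times_K2 G) (times_K2 G)"
  obtains \<alpha> \<beta> k where "tf_pair G \<alpha> \<beta>" "k < 2"
    "\<And>u. u \<in> verts G \<Longrightarrow> F (u, 0) = (\<alpha> u, k)" "\<And>u. u \<in> verts G \<Longrightarrow> F (u, 1) = (\<beta> u, 1 - k)"
proof -
  let ?V = "verts G"
  have bF: "bij_betw F (?V \<times> {0, 1}) (?V \<times> {0, 1})"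
    and eF: "\<And>x y. x \<in> ?V \<times> {0, 1} \<Longrightarrow> y \<in> ?V \<times> {0, 1} \<Longrightarrow>
      {x, y} \<in> edges (times_K2 G) \<longleftrightarrow> {F x, F y} \<in> edges (times_K2 G)"
    using F by (auto simp: graph_isos_def verts_times_K2)
  have sub: "E \<subseteq> ?V" if "E \<in> edges G" for E using wf[OF that] by auto
  define h where "h i u = snd (F (u, i))" for i :: nat and u
  define a where "a i u = fst (F (u, i))" for i :: nat and u
  have im: "a i u \<in> ?V" "h i u = 0 \<or> h i u = 1" if "u \<in> ?V" "i < 2" for i u
  proof -
    have "(u, i) \<in> ?V \<times> {0, 1}" using that by auto
    then have "F (u, i) \<in> ?V \<times> {0, 1}" using bij_betwE[OF bF] by blast
    then show "a i u \<in> ?V" "h i u = 0 \<or> h i u = 1" by (auto simp: a_def h_def mem_Times_iff)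
  qed
  have Fe: "F (u, i) = (a i u, h i u)" for u i by (simp add: a_def h_def)
  have edge: "{u, v} \<in> edges G \<longleftrightarrow> {a 0 u, a 1 v} \<in> edges G \<and> (h 0 u = 0 \<and> h 1 v = 1 \<or> h 0 u = 1 \<and> h 1 v = 0)"
    if "u \<in> ?V" "v \<in> ?V" for u v
    using eF[of "(u, 0)" "(v, 1)"] that by (simp add: edge_times_K2 Fe)
  have col: "h 1 v = 1 - h 0 u" "h 1 u = 1 - h 0 v" if "u \<in> ?V" "v \<in> ?V" "{u, v} \<in> edges G" for u v
    using edge[of u v] edge[of v u] that by (auto simp: insert_commute)
  \<comment> \<open>If both copies of one vertex landed in the same layer, this would spread along
    edges to all vertices, and \<open>h 0\<close> would be a proper 2-colouring.\<close>
  have nq: "h 1 u \<noteq> h 0 u" if u: "u \<in> ?V" for u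
  proof
    assume q: "h 1 u = h 0 u"
    have q': "h 1 v = h 0 v" if "v \<in> ?V" for v
    proof -
      have e: "(h 1 x = h 0 x) = (h 1 y = h 0 y)" if "x \<in> ?V" "y \<in> ?V" "{x, y} \<in> edges G" for x y
        using col[OF that] im(2)[OF that(1), of 0] im(2)[OF that(1), of 1] im(2)[OF that(2), of 0] im(2)[OF that(2), of 1] by auto
      show ?thesis using connected_invariant[where f = "\<lambda>x. h 1 x = h 0 x", OF con sub e u that] q by simp
    qed
    have "bipartite_graph G" unfolding bipartite_graph_def
    proof (intro exI conjI ballI)
      show "{v \<in> ?V. h 0 v = 0} \<union> {v \<in> ?V. h 0 v = 1} = ?V" using im(2)[of _ 0] by auto
      show "{v \<in> ?V. h 0 v = 0} \<inter> {v \<in> ?V. h 0 v = 1} = {}" by auto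
      fix E assume E: "E \<in> edges G"
      then obtain x y where xy: "x \<in> ?V" "y \<in> ?V" "E = {x, y}" using wf by blast
      have "h 0 y = 1 - h 0 x" using col(1)[OF xy(1,2)] E xy(3) q'[OF xy(2)] by simp
      then have "h 0 x = 0 \<and> h 0 y = 1 \<or> h 0 x = 1 \<and> h 0 y = 0" using im(2)[OF xy(1), of 0] by auto
      then show "\<exists>a\<in>{v \<in> ?V. h 0 v = 0}. \<exists>b\<in>{v \<in> ?V. h 0 v = 1}. E = {a, b}"
        using xy by (auto simp: insert_commute)
    qed
    then show False using nb by blast
  qed
  have eq: "h 0 x = h 0 y" if "x \<in> ?V" "y \<in> ?V" "{x, y} \<in> edges G" for x y
    using col[OF that] nq[OF that(1)] im(2)[OF that(1), of 0] im(2)[OF that(1), of 1] im(2)[OF that(2), of 0] by auto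
  obtain u0 where u0: "u0 \<in> ?V" using con by (auto simp: connected_graph_def)
  define k where "k = h 0 u0"
  have h0: "h 0 u = k" if "u \<in> ?V" for u
    using connected_invariant[OF con sub eq that u0] by (simp add: k_def)
  have k2: "k = 0 \<or> k = 1" using im(2)[OF u0, of 0] by (simp add: k_def)
  have h1: "h 1 u = 1 - k" if "u \<in> ?V" for u
    using nq[OF that] h0[OF that] im(2)[OF that, of 1] k2 by auto
  have bij: "bij_betw (a i) ?V ?V" if i: "i < 2" for i
  proof -
    have "inj_on (a i) ?V"
    proof (rule inj_onI)
      fix x y assume xy: "x \<in> ?V" "y \<in> ?V" "a i x = a i y"
      have i2: "i = 0 \<or> i = 1" using i by auto
      then have "F (x, i) = F (y, i)" using xy h0 h1 by (auto simp: Fe)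
      then show "x = y" using bij_betw_imp_inj_on[OF bF] xy i2 by (auto dest!: inj_onD)
    qed
    moreover from this have "a i ` ?V = ?V" using im(1) i fin by (intro endo_inj_surj) auto
    ultimately show ?thesis by (simp add: bij_betw_def)
  qed
  have "tf_pair G (a 0) (a 1)" unfolding tf_pair_def using bij edge h0 h1 k2 by auto
  then show ?thesis using that[of "a 0" "a 1" k] k2 h0 h1 by (auto simp: Fe)
qed

lemma graph_Aut_carrier: "carrier (graph_Aut G) = Bij (verts G) \<inter> graph_isos G G"
  by (simp add: graph_Aut_def)

lemma graph_Aut_mult:
  "f \<in> carrier (graph_Aut G) \<Longrightarrow> g \<in> carrier (graph_Aut G) \<Longrightarrow> f \<otimes>\<^bsub>graph_Aut G\<^esub> g = compose (verts G) f g"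
  by (simp add: graph_Aut_def BijGroup_def)

lemma graph_Aut_closed:
  assumes "f \<in> carrier (graph_Aut G)" "g \<in> carrier (graph_Aut G)"
  shows "compose (verts G) f g \<in> carrier (graph_Aut G)"
proof -
  have "g x \<in> verts G" if "x \<in> verts G" for x
    using assms(2) that Bij_imp_funcset by (auto simp: graph_Aut_carrier)
  then show ?thesis using assms compose_Bij[of f "verts G" g]
    by (auto simp: graph_Aut_carrier graph_isos_def Bij_def compose_eq)
qed

lemma finite_graph_Aut: "finite (verts G) \<Longrightarrow> finite (carrier (graph_Aut G))"
proof -
  assume "finite (verts G)"
  then have "finite (verts G \<rightarrow>\<^sub>E verts G)" by (simp add: finite_PiE)
  moreover have "carrier (graph_Aut G) \<subseteq> verts G \<rightarrow>\<^sub>E verts G"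
    unfolding graph_Aut_carrier Bij_def PiE_def using bij_betw_imp_funcset by blast
  ultimately show ?thesis using finite_subset by blast
qed

lemma add_mod2_bij: "bij_betw (\<lambda>j. (j + k) mod 2) {0, 1 :: nat} {0, 1}" if "k < (2::nat)"
proof -
  have "k = 0 \<or> k = 1" using that by auto
  then show ?thesis by (elim disjE) (auto simp: bij_betw_def inj_on_def)
qed

text \<open>The map \<open>\<Phi>\<close> always embeds the product group. As everything is finite,
  any abstract isomorphism forces equal cardinalities and hence surjectivity of
  \<open>\<Phi>\<close>, which means that every pair of maps is diagonal.\<close>

theorem stable_graph_iff:
  fixes G :: "'a ugraph"
  assumes fin: "finite (verts G)" and con: "connected_graph G" and nb: "\<not> bipartite_graph G"
    and wf: "\<And>E. E \<in> edges G \<Longrightarrow> \<exists>u\<in>verts G. \<exists>v\<in>verts G. E = {u, v}"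
  shows "stable_graph G \<longleftrightarrow> (\<forall>\<alpha> \<beta>. tf_pair G \<alpha> \<beta> \<longrightarrow> (\<forall>u\<in>verts G. \<alpha> u = \<beta> u))"
proof -
  let ?V = "verts G" and ?A = "graph_Aut G \<times>\<times> integer_mod_group 2" and ?D = "graph_Aut (times_K2 G)"
  define \<Phi> where "\<Phi> = (\<lambda>(\<alpha>, k :: int). \<lambda>(v, j) \<in> ?V \<times> {0, 1 :: nat}. (\<alpha> v :: 'a, (j + nat k) mod 2))"
  have cA: "carrier ?A = carrier (graph_Aut G) \<times> {0..<2}" by (simp add: carrier_integer_mod_group)
  have \<Phi>_app: "\<Phi> (\<alpha>, k) (v, j) = (\<alpha> v, (j + nat k) mod 2)" if "v \<in> ?V" "j = 0 \<or> j = 1" for \<alpha> k v j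
    using that by (auto simp: \<Phi>_def)
  obtain u0 where u0: "u0 \<in> ?V" using con by (auto simp: connected_graph_def)
  have mapsto: "\<Phi> x \<in> carrier ?D" if x: "x \<in> carrier ?A" for x
  proof -
    obtain \<alpha> k where ak: "x = (\<alpha>, k)" "\<alpha> \<in> carrier (graph_Aut G)" "nat k < 2" using x unfolding cA by auto
    have b: "bij_betw \<alpha> ?V ?V" and e: "\<And>u v. u \<in> ?V \<Longrightarrow> v \<in> ?V \<Longrightarrow> {u, v} \<in> edges G \<longleftrightarrow> {\<alpha> u, \<alpha> v} \<in> edges G"
      using ak(2) by (auto simp: graph_Aut_carrier graph_isos_def)
    have "bij_betw (map_prod \<alpha> (\<lambda>j. (j + nat k) mod 2)) (?V \<times> {0, 1}) (?V \<times> {0, 1})"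
      using bij_betw_map_prod[OF b add_mod2_bij[OF ak(3)]] .
    then have "bij_betw (\<Phi> x) (?V \<times> {0, 1}) (?V \<times> {0, 1})"
      by (rule bij_betw_cong[THEN iffD1, rotated]) (auto simp: ak(1) \<Phi>_app)
    moreover have "{(u, i), (v, j)} \<in> edges (times_K2 G) \<longleftrightarrow> {\<Phi> x (u, i), \<Phi> x (v, j)} \<in> edges (times_K2 G)"
      if uv: "u \<in> ?V" "v \<in> ?V" "i = 0 \<or> i = 1" "j = 0 \<or> j = 1" for u v i j
    proof -
      have "nat k = 0 \<or> nat k = 1" using ak(3) by auto
      then show ?thesis using uv e[OF uv(1,2)] by (auto simp: ak(1) \<Phi>_app edge_times_K2)
    qed
    moreover have "\<Phi> x \<in> extensional (?V \<times> {0, 1})" by (simp add: ak(1) \<Phi>_def)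
    ultimately show ?thesis by (auto simp: graph_Aut_carrier Bij_def graph_isos_def verts_times_K2)
  qed
  have inj: "inj_on \<Phi> (carrier ?A)"
  proof (rule inj_onI)
    fix x y assume xy: "x \<in> carrier ?A" "y \<in> carrier ?A" "\<Phi> x = \<Phi> y"
    obtain \<alpha> k where ak: "x = (\<alpha>, k)" "\<alpha> \<in> carrier (graph_Aut G)" "0 \<le> k" "k < 2" using xy(1) unfolding cA by auto
    obtain \<beta> l where bl: "y = (\<beta>, l)" "\<beta> \<in> carrier (graph_Aut G)" "0 \<le> l" "l < 2" using xy(2) unfolding cA by auto
    have "(\<alpha> v, (0 + nat k) mod 2) = (\<beta> v, (0 + nat l) mod 2)" if "v \<in> ?V" for v
      using \<Phi>_app[OF that, of 0 \<alpha> k] \<Phi>_app[OF that, of 0 \<beta> l] xy(3) ak(1) bl(1) by simp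
    then have eq: "\<alpha> v = \<beta> v" "nat k mod 2 = nat l mod 2" if "v \<in> ?V" for v using that by auto
    have "\<alpha> = \<beta>"
      by (rule extensionalityI[of _ ?V]) (use ak(2) bl(2) eq(1) in \<open>auto simp: graph_Aut_carrier Bij_def\<close>)
    moreover have "k = l" using eq(2)[OF u0] ak(3,4) bl(3,4) by auto
    ultimately show "x = y" using ak(1) bl(1) by simp
  qed
  have hom: "\<Phi> \<in> hom ?A ?D"
  proof (rule homI)
    fix x y assume xy: "x \<in> carrier ?A" "y \<in> carrier ?A"
    obtain \<alpha> k where ak: "x = (\<alpha>, k)" "\<alpha> \<in> carrier (graph_Aut G)" "0 \<le> k" "k < 2" using xy(1) unfolding cA by auto
    obtain \<beta> l where bl: "y = (\<beta>, l)" "\<beta> \<in> carrier (graph_Aut G)" "0 \<le> l" "l < 2" using xy(2) unfolding cA by auto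
    have m: "x \<otimes>\<^bsub>?A\<^esub> y = (compose ?V \<alpha> \<beta>, (k + l) mod 2)"
      by (simp add: ak(1) bl(1) graph_Aut_mult[OF ak(2) bl(2)])
    have bV: "\<beta> v \<in> ?V" if "v \<in> ?V" for v
      using bl(2) that Bij_imp_funcset by (auto simp: graph_Aut_carrier)
    have nm: "(j + nat ((k + l) mod 2)) mod 2 = ((j + nat l) mod 2 + nat k) mod 2" for j
    proof -
      have "k = 0 \<or> k = 1" "l = 0 \<or> l = 1" using ak bl by auto
      then show ?thesis by (elim disjE) (simp_all add: mod_simps)
    qed
    have "\<Phi> x \<otimes>\<^bsub>?D\<^esub> \<Phi> y = compose (?V \<times> {0, 1}) (\<Phi> x) (\<Phi> y)"
      using graph_Aut_mult[OF mapsto[OF xy(1)] mapsto[OF xy(2)]] by (simp add: verts_times_K2)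
    also have "\<dots> = \<Phi> (x \<otimes>\<^bsub>?A\<^esub> y)"
    proof (rule extensionalityI[of _ "?V \<times> {0, 1}"])
      show "\<Phi> (x \<otimes>\<^bsub>?A\<^esub> y) \<in> extensional (?V \<times> {0, 1})" unfolding m by (simp add: \<Phi>_def)
      fix w assume "w \<in> ?V \<times> {0, 1 :: nat}"
      then obtain v j where w: "w = (v, j)" "v \<in> ?V" "j = 0 \<or> j = 1" by auto
      have l: "compose (?V \<times> {0, 1}) (\<Phi> x) (\<Phi> y) w = \<Phi> x (\<Phi> y w)" using w by (auto simp: compose_def)
      have "(j + nat l) mod 2 = 0 \<or> (j + nat l) mod 2 = 1" by auto
      then have "\<Phi> x (\<Phi> y w) = (\<alpha> (\<beta> v), ((j + nat l) mod 2 + nat k) mod 2)"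
        unfolding w(1) bl(1) ak(1) \<Phi>_app[OF w(2,3)] by (rule \<Phi>_app[OF bV[OF w(2)]])
      moreover have "\<Phi> (x \<otimes>\<^bsub>?A\<^esub> y) w = (\<alpha> (\<beta> v), (j + nat ((k + l) mod 2)) mod 2)"
        unfolding m w(1) \<Phi>_app[OF w(2,3)] using w(2) by (simp add: compose_def)
      ultimately show "compose (?V \<times> {0, 1}) (\<Phi> x) (\<Phi> y) w = \<Phi> (x \<otimes>\<^bsub>?A\<^esub> y) w"
        using l nm by simp
    qed simp
    finally show "\<Phi> (x \<otimes>\<^bsub>?A\<^esub> y) = \<Phi> x \<otimes>\<^bsub>?D\<^esub> \<Phi> y" ..
  qed (rule mapsto)
  have surj_iff: "\<Phi> ` carrier ?A = carrier ?D \<longleftrightarrow> stable_graph G"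
  proof
    assume "\<Phi> ` carrier ?A = carrier ?D"
    then have "bij_betw \<Phi> (carrier ?A) (carrier ?D)" using inj by (simp add: bij_betw_def)
    then show "stable_graph G" unfolding stable_graph_def
    proof (rule is_iso_symI[OF hom])
      fix x y assume xy: "x \<in> carrier ?A" "y \<in> carrier ?A"
      obtain \<alpha> k where ak: "x = (\<alpha>, k)" "\<alpha> \<in> carrier (graph_Aut G)" using xy(1) unfolding cA by auto
      obtain \<beta> l where bl: "y = (\<beta>, l)" "\<beta> \<in> carrier (graph_Aut G)" using xy(2) unfolding cA by auto
      show "x \<otimes>\<^bsub>?A\<^esub> y \<in> carrier ?A"
        using graph_Aut_closed[OF ak(2) bl(2)] graph_Aut_mult[OF ak(2) bl(2)] unfolding cA ak(1) bl(1) by simp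
    qed
  next
    assume "stable_graph G"
    then have c: "card (carrier ?D) = card (carrier ?A)" unfolding stable_graph_def by (rule iso_same_card)
    have "finite (carrier ?D)" by (rule finite_graph_Aut) (simp add: verts_times_K2 fin)
    then show "\<Phi> ` carrier ?A = carrier ?D"
      using mapsto card_image[OF inj] c by (intro card_subset_eq) auto
  qed
  show ?thesis
  proof
    assume "stable_graph G"
    then have surj: "\<Phi> ` carrier ?A = carrier ?D" using surj_iff by simp
    show "\<forall>\<alpha> \<beta>. tf_pair G \<alpha> \<beta> \<longrightarrow> (\<forall>u\<in>verts G. \<alpha> u = \<beta> u)"
    proof (intro allI impI ballI)
      fix \<alpha> \<beta> u assume t: "tf_pair G \<alpha> \<beta>" and u: "u \<in> ?V"
      have ab: "bij_betw \<alpha> ?V ?V" "bij_betw \<beta> ?V ?V" using t by (auto simp: tf_pair_def)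
      define F where "F = (\<lambda>(v, j) \<in> ?V \<times> {0, 1 :: nat}. (if j = 0 then \<alpha> v else \<beta> v, j))"
      have F: "F (v, 0) = (\<alpha> v, 0)" "F (v, 1) = (\<beta> v, 1)" if "v \<in> ?V" for v using that by (auto simp: F_def)
      have im: "\<alpha> v \<in> ?V" "\<beta> v \<in> ?V" if "v \<in> ?V" for v using ab that bij_betwE by blast+
      have "inj_on F (?V \<times> {0, 1})"
      proof (rule inj_onI)
        fix x y assume xy: "x \<in> ?V \<times> {0, 1}" "y \<in> ?V \<times> {0, 1}" "F x = F y"
        obtain v j where x: "x = (v, j)" "v \<in> ?V" "j = 0 \<or> j = 1" using xy(1) by auto
        obtain w i where y: "y = (w, i)" "w \<in> ?V" "i = 0 \<or> i = 1" using xy(2) by auto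
        have "(if j = 0 then \<alpha> v else \<beta> v, j) = (if i = 0 then \<alpha> w else \<beta> w, i)"
          using xy(3) x y by (auto simp: F_def)
        then have "j = i" "j = 0 \<and> \<alpha> v = \<alpha> w \<or> j = 1 \<and> \<beta> v = \<beta> w" using x(3) by auto
        then show "x = y" using x(1,2) y(1,2) inj_onD[OF bij_betw_imp_inj_on[OF ab(1)]]
            inj_onD[OF bij_betw_imp_inj_on[OF ab(2)]] by blast
      qed
      moreover have "F ` (?V \<times> {0, 1}) \<subseteq> ?V \<times> {0, 1}" using F im by auto
      ultimately have "bij_betw F (?V \<times> {0, 1}) (?V \<times> {0, 1})"
        using fin by (simp add: bij_betw_def endo_inj_surj)
      moreover have "{x, y} \<in> edges (times_K2 G) \<longleftrightarrow> {F x, F y} \<in> edges (times_K2 G)"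
        if "x \<in> ?V \<times> {0, 1}" "y \<in> ?V \<times> {0, 1}" for x y
      proof -
        have e: "{u, v} \<in> edges G \<longleftrightarrow> {\<alpha> u, \<beta> v} \<in> edges G" if "u \<in> ?V" "v \<in> ?V" for u v
          using t that by (auto simp: tf_pair_def)
        have e': "{u, v} \<in> edges G \<longleftrightarrow> {\<beta> u, \<alpha> v} \<in> edges G" if "u \<in> ?V" "v \<in> ?V" for u v
          using e[OF that(2,1)] by (simp add: insert_commute)
        show ?thesis using that F by (auto simp: edge_times_K2 e[symmetric] e'[symmetric])
      qed
      moreover have "F \<in> extensional (?V \<times> {0, 1})" by (simp add: F_def)
      ultimately have "F \<in> carrier ?D" by (simp add: graph_Aut_carrier Bij_def graph_isos_def verts_times_K2)
      then obtain x where x: "x \<in> carrier ?A" "F = \<Phi> x" using surj by blast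
      obtain \<gamma> k where "x = (\<gamma>, k)" by (cases x)
      then have Fg: "F = \<Phi> (\<gamma>, k)" using x(2) by simp
      have "(\<alpha> u, 0) = (\<gamma> u, (0 + nat k) mod 2)"
        unfolding F(1)[OF u, symmetric] Fg by (rule \<Phi>_app) (use u in simp_all)
      moreover have "(\<beta> u, 1) = (\<gamma> u, (1 + nat k) mod 2)"
        unfolding F(2)[OF u, symmetric] Fg by (rule \<Phi>_app) (use u in simp_all)
      ultimately show "\<alpha> u = \<beta> u" by simp
    qed
  next
    assume diag: "\<forall>\<alpha> \<beta>. tf_pair G \<alpha> \<beta> \<longrightarrow> (\<forall>u\<in>verts G. \<alpha> u = \<beta> u)"
    have "F \<in> \<Phi> ` carrier ?A" if F: "F \<in> carrier ?D" for F
    proof -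
      have FD: "F \<in> graph_isos (times_K2 G) (times_K2 G)" "F \<in> extensional (?V \<times> {0, 1})"
        using F by (auto simp: graph_Aut_carrier Bij_def verts_times_K2)
      obtain \<alpha> \<beta> k where t: "tf_pair G \<alpha> \<beta>" "k < 2"
        and F0: "\<And>u. u \<in> ?V \<Longrightarrow> F (u, 0) = (\<alpha> u, k)" and F1: "\<And>u. u \<in> ?V \<Longrightarrow> F (u, 1) = (\<beta> u, 1 - k)"
        using times_K2_automorphism[OF fin con nb wf FD(1)] by metis
      have eq: "\<beta> u = \<alpha> u" if "u \<in> ?V" for u using diag t(1) that by metis
      have b: "bij_betw \<alpha> ?V ?V" using t by (simp add: tf_pair_def)
      let ?a = "restrict \<alpha> ?V"
      have "?a \<in> carrier (graph_Aut G)"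
        using t(1) b eq by (auto simp: graph_Aut_carrier Bij_def graph_isos_def tf_pair_def)
      then have cx: "(?a, int k) \<in> carrier ?A" using t(2) unfolding cA by auto
      have "F = \<Phi> (?a, int k)"
      proof (rule extensionalityI[of _ "?V \<times> {0, 1}"])
        show "\<Phi> (?a, int k) \<in> extensional (?V \<times> {0, 1})" by (simp add: \<Phi>_def)
        fix w assume "w \<in> ?V \<times> {0, 1 :: nat}"
        then obtain v j where w: "w = (v, j)" "v \<in> ?V" "j = 0 \<or> j = 1" by auto
        have "k = 0 \<or> k = 1" using t(2) by auto
        then show "F w = \<Phi> (?a, int k) w"
          unfolding w(1) \<Phi>_app[OF w(2,3)] using w(2,3) F0[OF w(2)] F1[OF w(2)] eq[OF w(2)] by auto
      qed (rule FD(2))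
      then show ?thesis using cx by blast
    qed
    then have "\<Phi> ` carrier ?A = carrier ?D" using mapsto by blast
    then show "stable_graph G" using surj_iff by simp
  qed
qed

subsection \<open>Transfer to cyclic groups\<close>

lemma cyclic_rt_iso:
  fixes H :: "('a, 'm) monoid_scheme"
  assumes "H \<cong> integer_mod_group n" "n > 0"
  obtains \<psi> where "bij_betw \<psi> (carrier H) (rt n)"
    "\<And>x y. x \<in> carrier H \<Longrightarrow> y \<in> carrier H \<Longrightarrow> \<psi> (x \<otimes>\<^bsub>H\<^esub> y) = \<psi> x * \<psi> y"
proof -
  obtain f where f: "f \<in> hom H (integer_mod_group n)" "bij_betw f (carrier H) {0..<int n}"
    using assms unfolding is_iso_def iso_def by (auto simp: carrier_integer_mod_group)
  let ?c = "\<lambda>k. cis (2 * pi * real k / real n)"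
  have c: "?c k = ?c 1 ^ k" for k by (simp add: DeMoivre mult_ac)
  have "bij_betw nat {0..<int n} {..<n}"
    by (rule bij_betw_byWitness[where f' = int]) auto
  moreover have "bij_betw ?c {..<n} (rt n)" using bij_betw_roots_unity[OF assms(2)] by (simp add: rt_def)
  ultimately have b: "bij_betw (?c \<circ> (nat \<circ> f)) (carrier H) (rt n)" using bij_betw_trans[OF bij_betw_trans[OF f(2)]] by blast
  have one: "?c 1 ^ n = 1" using assms(2) by (simp add: DeMoivre)
  have "(?c \<circ> (nat \<circ> f)) (x \<otimes>\<^bsub>H\<^esub> y) = (?c \<circ> (nat \<circ> f)) x * (?c \<circ> (nat \<circ> f)) y"
    if xy: "x \<in> carrier H" "y \<in> carrier H" for x y
  proof -
    have r: "0 \<le> f x" "0 \<le> f y" using bij_betwE[OF f(2)] xy by auto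
    have "f (x \<otimes>\<^bsub>H\<^esub> y) = (f x + f y) mod int n" using f(1) xy by (simp add: hom_def)
    then have "nat (f (x \<otimes>\<^bsub>H\<^esub> y)) = (nat (f x) + nat (f y)) mod n"
      using r by (simp add: nat_mod_distrib nat_add_distrib)
    then have "?c (nat (f (x \<otimes>\<^bsub>H\<^esub> y))) = ?c 1 ^ (nat (f x) + nat (f y))"
      unfolding c[of "nat (f (x \<otimes>\<^bsub>H\<^esub> y))"] using one by (intro power_eq_mod[of _ n]) simp_all
    then show ?thesis by (simp add: c[of "nat (f x)"] c[of "nat (f y)"] power_add)
  qed
  then show ?thesis using that b by blast
qed

lemma verts_Cay: "verts (Cay H S) = carrier H"
  by (simp add: Cay_def)

text \<open>An unordered edge only says that one of the two quotients is in S; closure under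
  inverses makes this a condition on y / x.\<close>

lemma Cay_edges:
  assumes H: "group H" and S: "S \<subseteq> carrier H" "set_inv\<^bsub>H\<^esub> S = S"
    and \<psi>: "bij_betw \<psi> (carrier H) (rt n)" "n > 0"
      "\<And>x y. x \<in> carrier H \<Longrightarrow> y \<in> carrier H \<Longrightarrow> \<psi> (x \<otimes>\<^bsub>H\<^esub> y) = \<psi> x * \<psi> y"
    and xy: "x \<in> carrier H" "y \<in> carrier H"
  shows "{x, y} \<in> edges (Cay H S) \<longleftrightarrow> \<psi> y / \<psi> x \<in> \<psi> ` S"
proof -
  interpret group H by (rule H)
  have nz: "\<psi> z \<noteq> 0" if "z \<in> carrier H" for z using bij_betwE[OF \<psi>(1)] rt_nz \<psi>(2) that by blast
  have inj: "\<psi> u = \<psi> v \<longleftrightarrow> u = v" if "u \<in> carrier H" "v \<in> carrier H" for u v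
    using bij_betw_imp_inj_on[OF \<psi>(1)] that by (auto dest: inj_onD)
  have iv: "inv\<^bsub>H\<^esub> z \<in> S" if "z \<in> S" for z using S(2) that by (auto simp: SET_INV_def)
  have *: "v = s \<otimes>\<^bsub>H\<^esub> u \<longleftrightarrow> \<psi> v / \<psi> u = \<psi> s" if "u \<in> carrier H" "v \<in> carrier H" "s \<in> S" for u v s
    using inj[of v "s \<otimes>\<^bsub>H\<^esub> u"] \<psi>(3)[of s u] nz[of u] that S(1) by (auto simp: field_simps)
  have inv1: "\<psi> (inv\<^bsub>H\<^esub> s) = 1 / \<psi> s" if "s \<in> S" for s
  proof -
    have sc: "s \<in> carrier H" "inv\<^bsub>H\<^esub> s \<in> carrier H" using that S(1) by auto
    have "\<psi> \<one>\<^bsub>H\<^esub> * \<psi> \<one>\<^bsub>H\<^esub> = \<psi> \<one>\<^bsub>H\<^esub>" using \<psi>(3)[of "\<one>\<^bsub>H\<^esub>" "\<one>\<^bsub>H\<^esub>"] by simp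
    then have "\<psi> \<one>\<^bsub>H\<^esub> = 1" using nz[of "\<one>\<^bsub>H\<^esub>"] by simp
    then show ?thesis using \<psi>(3)[OF sc(2,1)] sc nz[OF sc(1)] by (simp add: field_simps)
  qed
  have "{x, y} \<in> edges (Cay H S) \<longleftrightarrow> (\<exists>s\<in>S. y = s \<otimes>\<^bsub>H\<^esub> x \<or> x = s \<otimes>\<^bsub>H\<^esub> y)"
    unfolding Cay_def using xy by (auto simp: doubleton_eq_iff)
  also have "\<dots> \<longleftrightarrow> (\<exists>s\<in>S. \<psi> y / \<psi> x = \<psi> s \<or> \<psi> x / \<psi> y = \<psi> s)" using * xy by auto
  also have "\<dots> \<longleftrightarrow> (\<exists>s\<in>S. \<psi> y / \<psi> x = \<psi> s)"
  proof
    assume "\<exists>s\<in>S. \<psi> y / \<psi> x = \<psi> s \<or> \<psi> x / \<psi> y = \<psi> s"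
    then obtain s where s: "s \<in> S" "\<psi> y / \<psi> x = \<psi> s \<or> \<psi> x / \<psi> y = \<psi> s" by blast
    then have "\<psi> y / \<psi> x = \<psi> s \<or> \<psi> y / \<psi> x = \<psi> (inv\<^bsub>H\<^esub> s)"
      using inv1[OF s(1)] nz[OF xy(1)] nz[OF xy(2)] by (metis inverse_divide inverse_eq_divide)
    then show "\<exists>s\<in>S. \<psi> y / \<psi> x = \<psi> s" using s(1) iv by blast
  qed blast
  also have "\<dots> \<longleftrightarrow> \<psi> y / \<psi> x \<in> \<psi> ` S" by auto
  finally show ?thesis .
qed

text \<open>Each map shifts one of the two cosets of \<open>rt m\<close>. Between different cosets
  either both ends are shifted or neither, so the quotient is unchanged; within a coset exactly one
  end is shifted, and the periodicity of S on \<open>rt m\<close> absorbs the factor.\<close>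

lemma shifted_halves_tf:
  assumes m: "odd m" and h: "h \<in> rt m" and n: "n = 2 * m"
    and S: "\<And>z. z \<in> rt m \<Longrightarrow> z * h \<in> S \<longleftrightarrow> z \<in> S"
  shows "(\<lambda>x. if x \<in> rt m then x * h else x, \<lambda>x. if x \<in> rt m then x else x * h) \<in> tf n {S}"
    (is "(?a, ?b) \<in> _")
proof -
  have m0: "m > 0" and n0: "n > 0" using m n by (auto intro: odd_pos)
  have h0: "h \<noteq> 0" using rt_nz[OF h m0] .
  have hn: "h \<in> rt n" using h rt_mono[of m n] n by auto
  have mh: "x * h \<in> rt m \<longleftrightarrow> x \<in> rt m" "x / h \<in> rt m \<longleftrightarrow> x \<in> rt m" for x
  proof -
    have hh: "h ^ m = 1" using h by (simp add: rt_def)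
    show "x * h \<in> rt m \<longleftrightarrow> x \<in> rt m" "x / h \<in> rt m \<longleftrightarrow> x \<in> rt m"
      by (simp_all add: rt_def power_mult_distrib power_divide hh)
  qed
  have bij: "bij_betw (\<lambda>x. if P x then x * h else x) (rt n) (rt n)"
    if P: "\<And>x. P (x * h) \<longleftrightarrow> P x" "\<And>x. P (x / h) \<longleftrightarrow> P x" for P
    by (rule bij_betw_byWitness[where f' = "\<lambda>x. if P x then x / h else x"])
      (use P h0 rt_mult[OF _ hn] rt_divide[OF _ hn] in auto)
  have b1: "bij_betw ?a (rt n) (rt n)" using bij[of "\<lambda>x. x \<in> rt m"] mh by simp
  have "bij_betw (\<lambda>x. if x \<notin> rt m then x * h else x) (rt n) (rt n)" using bij[of "\<lambda>x. x \<notin> rt m"] mh by simp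
  then have b2: "bij_betw ?b (rt n) (rt n)" by (rule bij_betw_cong[THEN iffD1, rotated]) simp
  have odd: "- x \<in> rt m" if "x \<in> rt n" "x \<notin> rt m" for x using rt_double_cases[of x m] that m n by blast
  have Sd: "z / h \<in> S \<longleftrightarrow> z \<in> S" if "z \<in> rt m" for z using S[of "z / h"] mh that h0 by simp
  have "link n ?a ?b S S" unfolding link_def
  proof (intro ballI)
    fix x y assume xy: "x \<in> rt n" "y \<in> rt n"
    have same: "y / x \<in> rt m" if "x \<in> rt m \<longleftrightarrow> y \<in> rt m"
      using that rt_divide[of y m x] rt_divide[of "- y" m "- x"] odd xy by (cases "x \<in> rt m") auto
    show "(y / x \<in> S \<longleftrightarrow> ?b y / ?a x \<in> S) \<and> (y / x \<in> S \<longleftrightarrow> ?a y / ?b x \<in> S)"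
    proof (cases "x \<in> rt m \<longleftrightarrow> y \<in> rt m")
      case True
      have e: "y / (x * h) = y / x / h" "y * h / x = y / x * h" by simp_all
      show ?thesis using True S[OF same[OF True]] Sd[OF same[OF True]]
        by (cases "x \<in> rt m") (simp_all only: if_True if_False e simp_thms)
    next
      case False
      then show ?thesis using h0 by (cases "x \<in> rt m") auto
    qed
  qed
  then show ?thesis using b1 b2 by (simp add: tf_def)
qed

theorem theorem1p5:
  fixes H :: "('a, 'm) monoid_scheme" and p e :: nat
    and H0 S :: "'a set" and b :: 'a
  assumes "Factorial_Ring.prime p" and "odd p" and "e \<ge> 1"
    and "group H" and "H \<cong> integer_mod_group (2 * p ^ e)"
    and "subgroup H0 H" and "card H0 = p ^ e"
    and "b \<in> carrier H" and "b \<noteq> \<one>\<^bsub>H\<^esub>" and "b \<otimes>\<^bsub>H\<^esub> b = \<one>\<^bsub>H\<^esub>"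
    and "S \<subseteq> carrier H" and "\<one>\<^bsub>H\<^esub> \<notin> S" and "set_inv\<^bsub>H\<^esub> S = S"
    and "connected_graph (Cay H S)" and "\<not> bipartite_graph (Cay H S)"
  shows "\<not> stable_graph (Cay H S) \<longleftrightarrow>
           (e > 1 \<and> (\<exists>h \<in> H0. h \<noteq> \<one>\<^bsub>H\<^esub> \<and> (S \<inter> H0) #>\<^bsub>H\<^esub> h = S \<inter> H0)) \<or>
           graph_isomorphic (Cay H S) (Cay H (S #>\<^bsub>H\<^esub> b))"
proof -
  interpret group H by (rule assms(4))
  let ?G = "Cay H S" and ?n = "2 * p ^ e" and ?m = "p ^ e"
  note p = assms(1,2)
  have p1: "p > 1" using prime_gt_1_nat[OF p(1)] .
  have m0: "?m > 0" and n0: "?n > 0" and om: "odd ?m" using p p1 by auto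
  obtain \<psi> where bij: "bij_betw \<psi> (carrier H) (rt ?n)"
    and hom: "\<And>x y. x \<in> carrier H \<Longrightarrow> y \<in> carrier H \<Longrightarrow> \<psi> (x \<otimes>\<^bsub>H\<^esub> y) = \<psi> x * \<psi> y"
    using cyclic_rt_iso[OF assms(5) n0] by blast
  have im: "\<psi> x \<in> rt ?n" if "x \<in> carrier H" for x using bij_betwE[OF bij] that by blast
  have nz: "\<psi> x \<noteq> 0" if "x \<in> carrier H" for x using rt_nz[OF im[OF that] n0] .
  have inj: "\<psi> x = \<psi> y \<longleftrightarrow> x = y" if "x \<in> carrier H" "y \<in> carrier H" for x y
    using bij_betw_imp_inj_on[OF bij] that by (auto dest: inj_onD)
  have "\<psi> \<one>\<^bsub>H\<^esub> * \<psi> \<one>\<^bsub>H\<^esub> = \<psi> \<one>\<^bsub>H\<^esub>" using hom[of "\<one>\<^bsub>H\<^esub>" "\<one>\<^bsub>H\<^esub>"] by simp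
  then have \<psi>1: "\<psi> \<one>\<^bsub>H\<^esub> = 1" using nz[of "\<one>\<^bsub>H\<^esub>"] by simp
  define \<chi> where "\<chi> = inv_into (carrier H) \<psi>"
  have \<chi>: "\<chi> z \<in> carrier H" "\<psi> (\<chi> z) = z" if "z \<in> rt ?n" for z
    using bij that by (auto simp: \<chi>_def bij_betw_inv_into_right inv_into_into bij_betw_imp_surj_on)
  have \<chi>\<psi>: "\<chi> (\<psi> x) = x" if "x \<in> carrier H" for x
    using bij_betw_inv_into_left[OF bij that] by (simp add: \<chi>_def)
  have b\<chi>: "bij_betw \<chi> (rt ?n) (carrier H)" unfolding \<chi>_def using bij_betw_inv_into[OF bij] .
  have \<psi>b: "\<psi> b = -1"
  proof -
    have "\<psi> b * \<psi> b = 1" using hom[of b b] assms(8,10) \<psi>1 by simp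
    moreover have "\<psi> b \<noteq> 1" using inj[of b "\<one>\<^bsub>H\<^esub>"] \<psi>1 assms(8,9) by simp
    ultimately show ?thesis by (simp add: square_eq_1_iff)
  qed
  have H0c: "H0 \<subseteq> carrier H" using assms(6) subgroup.subset by blast
  have \<psi>H0: "\<psi> ` H0 = rt ?m"
  proof (rule card_subset_eq[OF finite_rt[OF m0]])
    have injH: "inj_on \<psi> H0" using bij_betw_imp_inj_on[OF bij] H0c inj_on_subset by blast
    then show "card (\<psi> ` H0) = card (rt ?m)" using card_rt[OF m0] assms(7) by (simp add: card_image)
    \<comment> \<open>Translation by x permutes \<open>H0\<close>, so the product over
      \<open>H0\<close> is multiplied by \<open>\<psi> x ^ ?m\<close> and yet stays the
      same.\<close>
    have "\<psi> x ^ ?m = 1" if x: "x \<in> H0" for x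
    proof -
      have xc: "x \<in> carrier H" using x H0c by blast
      have fH: "finite H0" using assms(7) m0 by (metis card.infinite less_irrefl)
      have "inj_on (\<lambda>y. x \<otimes>\<^bsub>H\<^esub> y) H0" 
      proof (rule inj_onI)
        fix y z assume yz: "y \<in> H0" "z \<in> H0" "x \<otimes>\<^bsub>H\<^esub> y = x \<otimes>\<^bsub>H\<^esub> z"
        then have "y \<in> carrier H" "z \<in> carrier H" using H0c by auto
        then show "y = z" using hom[OF xc] nz[OF xc] inj yz(3) by (metis mult_left_cancel)
      qed
      moreover have "(\<lambda>y. x \<otimes>\<^bsub>H\<^esub> y) ` H0 \<subseteq> H0" using subgroup.m_closed[OF assms(6) x] by blast
      ultimately have "bij_betw (\<lambda>y. x \<otimes>\<^bsub>H\<^esub> y) H0 H0" using fH by (simp add: bij_betw_def endo_inj_surj)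
      then have "(\<Prod>y\<in>H0. \<psi> y) = (\<Prod>y\<in>H0. \<psi> (x \<otimes>\<^bsub>H\<^esub> y))" by (rule prod.reindex_bij_betw[symmetric])
      also have "\<dots> = (\<Prod>y\<in>H0. \<psi> x * \<psi> y)" using hom xc H0c by (intro prod.cong refl) blast
      also have "\<dots> = \<psi> x ^ ?m * (\<Prod>y\<in>H0. \<psi> y)" by (simp add: prod.distrib assms(7))
      finally have "\<psi> x ^ ?m * (\<Prod>y\<in>H0. \<psi> y) = 1 * (\<Prod>y\<in>H0. \<psi> y)" by simp
      moreover have "(\<Prod>y\<in>H0. \<psi> y) \<noteq> 0" using fH nz H0c by auto
      ultimately show ?thesis by (metis mult_right_cancel)
    qed
    then show "\<psi> ` H0 \<subseteq> rt ?m" by (auto simp: rt_def)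
  qed
  have H0_iff: "x \<in> H0 \<longleftrightarrow> \<psi> x \<in> rt ?m" if "x \<in> carrier H" for x
    using \<psi>H0 inj that H0c by (metis image_iff subsetD)
  define S' where "S' = \<psi> ` S"
  have S_iff: "\<psi> x \<in> S' \<longleftrightarrow> x \<in> S" if "x \<in> carrier H" for x
    using inj that assms(11) by (auto simp: S'_def)
  have S'n: "S' \<subseteq> rt ?n" using im assms(11) by (auto simp: S'_def)
  have S'1: "1 \<notin> S'" using S_iff[of "\<one>\<^bsub>H\<^esub>"] \<psi>1 assms(12) by simp
  have edge: "{x, y} \<in> edges ?G \<longleftrightarrow> \<psi> y / \<psi> x \<in> S'" if "x \<in> carrier H" "y \<in> carrier H" for x y
    unfolding S'_def by (rule Cay_edges[OF assms(4,11,13) bij n0 hom that])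
  have edgeb: "{x, y} \<in> edges (Cay H (S #>\<^bsub>H\<^esub> b)) \<longleftrightarrow> - (\<psi> y / \<psi> x) \<in> S'"
    if xy: "x \<in> carrier H" "y \<in> carrier H" for x y
  proof -
    have binv: "inv\<^bsub>H\<^esub> b = b" using inv_equality[OF assms(10,8,8)] .
    have comm: "u \<otimes>\<^bsub>H\<^esub> v = v \<otimes>\<^bsub>H\<^esub> u" if "u \<in> carrier H" "v \<in> carrier H" for u v
      using inj[of "u \<otimes>\<^bsub>H\<^esub> v" "v \<otimes>\<^bsub>H\<^esub> u"] hom that by (simp add: mult.commute)
    have iv: "(\<exists>s\<in>S. x = inv\<^bsub>H\<^esub> s) \<longleftrightarrow> x \<in> S" for x using assms(13) by (auto simp: SET_INV_def)
    have "inv\<^bsub>H\<^esub> (s \<otimes>\<^bsub>H\<^esub> b) = inv\<^bsub>H\<^esub> s \<otimes>\<^bsub>H\<^esub> b" if "s \<in> S" for s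
    proof -
      have sc: "s \<in> carrier H" using that assms(11) by blast
      show ?thesis using inv_mult_group[OF sc assms(8)] comm[OF assms(8), of "inv\<^bsub>H\<^esub> s"] sc binv by simp
    qed
    then have "set_inv\<^bsub>H\<^esub> (S #>\<^bsub>H\<^esub> b) = (\<lambda>x. x \<otimes>\<^bsub>H\<^esub> b) ` (set_inv\<^bsub>H\<^esub> S)" by (auto simp: SET_INV_def r_coset_def)
    also have "\<dots> = S #>\<^bsub>H\<^esub> b" unfolding assms(13) by (auto simp: r_coset_def)
    finally have si: "set_inv\<^bsub>H\<^esub> (S #>\<^bsub>H\<^esub> b) = S #>\<^bsub>H\<^esub> b" .
    have sub: "S #>\<^bsub>H\<^esub> b \<subseteq> carrier H" using assms(8,11) by (auto simp: r_coset_def)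
    have "\<psi> ` (S #>\<^bsub>H\<^esub> b) = uminus ` S'"
    proof -
      have "\<psi> (s \<otimes>\<^bsub>H\<^esub> b) = - \<psi> s" if "s \<in> S" for s using hom[of s b] that assms(8,11) \<psi>b by auto
      then show ?thesis by (auto simp: r_coset_def S'_def image_iff)
    qed
    moreover have "z \<in> uminus ` S' \<longleftrightarrow> - z \<in> S'" for z by (metis image_eqI image_iff minus_minus)
    ultimately show ?thesis
      using Cay_edges[OF assms(4) sub si bij n0 hom xy] by simp
  qed
  have S'inv: "1 / z \<in> S' \<longleftrightarrow> z \<in> S'" if "z \<in> rt ?n" for z
  proof -
    have c: "\<chi> z \<in> carrier H" using \<chi> that by blast
    have "{\<one>\<^bsub>H\<^esub>, \<chi> z} \<in> edges ?G \<longleftrightarrow> z \<in> S'" using edge[OF one_closed c] \<chi>(2)[OF that] \<psi>1 by simp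
    moreover have "{\<chi> z, \<one>\<^bsub>H\<^esub>} \<in> edges ?G \<longleftrightarrow> 1 / z \<in> S'" using edge[OF c one_closed] \<chi>(2)[OF that] \<psi>1 by simp
    ultimately show ?thesis by (simp add: insert_commute)
  qed
  note vG = verts_Cay[of H S]
  have fin: "finite (carrier H)" using bij_betw_finite[OF bij] finite_rt[OF n0] by simp
  have wf: "\<exists>u\<in>verts ?G. \<exists>v\<in>verts ?G. E = {u, v}" if "E \<in> edges ?G" for E
    using that assms(11) m_closed by (auto simp: Cay_def)
  have stable: "\<not> stable_graph ?G \<longleftrightarrow> (\<exists>\<alpha> \<beta>. tf_pair ?G \<alpha> \<beta> \<and> (\<exists>u\<in>carrier H. \<alpha> u \<noteq> \<beta> u))"
    using stable_graph_iff[OF _ assms(14,15) wf] fin unfolding vG by blast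
  have unstable: "\<not> stable_graph ?G \<longleftrightarrow> (\<exists>(\<alpha>, \<beta>)\<in>tf ?n {S'}. \<exists>x\<in>rt ?n. \<alpha> x \<noteq> \<beta> x)"
    unfolding stable
  proof
    assume "\<exists>\<alpha> \<beta>. tf_pair ?G \<alpha> \<beta> \<and> (\<exists>u\<in>carrier H. \<alpha> u \<noteq> \<beta> u)"
    then obtain \<alpha> \<beta> u where t: "tf_pair ?G \<alpha> \<beta>" and u: "u \<in> carrier H" "\<alpha> u \<noteq> \<beta> u" by blast
    have b: "bij_betw \<alpha> (carrier H) (carrier H)" "bij_betw \<beta> (carrier H) (carrier H)"
      using t by (auto simp: tf_pair_def vG)
    have c: "\<alpha> v \<in> carrier H" "\<beta> v \<in> carrier H" if "v \<in> carrier H" for v using b bij_betwE that by blast+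
    have e: "\<psi> v / \<psi> u \<in> S' \<longleftrightarrow> \<psi> (\<beta> v) / \<psi> (\<alpha> u) \<in> S'" if "u \<in> carrier H" "v \<in> carrier H" for u v
      using t that edge c unfolding tf_pair_def vG by auto
    have inv: "z / w \<in> S' \<longleftrightarrow> w / z \<in> S'" if "z \<in> rt ?n" "w \<in> rt ?n" for z w
      using S'inv[OF rt_divide[OF that]] by simp
    have e': "\<psi> v / \<psi> u \<in> S' \<longleftrightarrow> \<psi> (\<alpha> v) / \<psi> (\<beta> u) \<in> S'" if uv: "u \<in> carrier H" "v \<in> carrier H" for u v
      using e[OF uv(2,1)] inv[of "\<psi> v" "\<psi> u"] inv[of "\<psi> (\<alpha> v)" "\<psi> (\<beta> u)"] im c uv by blast
    have "bij_betw (\<psi> \<circ> (\<alpha> \<circ> \<chi>)) (rt ?n) (rt ?n)" "bij_betw (\<psi> \<circ> (\<beta> \<circ> \<chi>)) (rt ?n) (rt ?n)"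
      using bij_betw_trans[OF bij_betw_trans[OF b\<chi> b(1)] bij] bij_betw_trans[OF bij_betw_trans[OF b\<chi> b(2)] bij] .
    moreover have "link ?n (\<psi> \<circ> (\<alpha> \<circ> \<chi>)) (\<psi> \<circ> (\<beta> \<circ> \<chi>)) S' S'"
      unfolding link_def comp_def
    proof (intro ballI)
      fix z w assume zw: "z \<in> rt ?n" "w \<in> rt ?n"
      show "(w / z \<in> S' \<longleftrightarrow> \<psi> (\<beta> (\<chi> w)) / \<psi> (\<alpha> (\<chi> z)) \<in> S') \<and> (w / z \<in> S' \<longleftrightarrow> \<psi> (\<alpha> (\<chi> w)) / \<psi> (\<beta> (\<chi> z)) \<in> S')"
        using e[OF \<chi>(1)[OF zw(1)] \<chi>(1)[OF zw(2)]] e'[OF \<chi>(1)[OF zw(1)] \<chi>(1)[OF zw(2)]] \<chi>(2) zw by simp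
    qed
    ultimately have "(\<psi> \<circ> (\<alpha> \<circ> \<chi>), \<psi> \<circ> (\<beta> \<circ> \<chi>)) \<in> tf ?n {S'}" by (simp add: tf_def)
    moreover have "(\<psi> \<circ> (\<alpha> \<circ> \<chi>)) (\<psi> u) \<noteq> (\<psi> \<circ> (\<beta> \<circ> \<chi>)) (\<psi> u)" using u inj c \<chi>\<psi> by simp
    ultimately show "\<exists>(\<alpha>, \<beta>)\<in>tf ?n {S'}. \<exists>x\<in>rt ?n. \<alpha> x \<noteq> \<beta> x" using im[OF u(1)] by blast
  next
    assume "\<exists>(\<alpha>, \<beta>)\<in>tf ?n {S'}. \<exists>x\<in>rt ?n. \<alpha> x \<noteq> \<beta> x"
    then obtain \<alpha> \<beta> x where t: "(\<alpha>, \<beta>) \<in> tf ?n {S'}" and x: "x \<in> rt ?n" "\<alpha> x \<noteq> \<beta> x" by blast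
    have b: "bij_betw \<alpha> (rt ?n) (rt ?n)" "bij_betw \<beta> (rt ?n) (rt ?n)" and l: "link ?n \<alpha> \<beta> S' S'"
      using t by (auto simp: tf_def)
    have "bij_betw (\<chi> \<circ> (\<alpha> \<circ> \<psi>)) (carrier H) (carrier H)" "bij_betw (\<chi> \<circ> (\<beta> \<circ> \<psi>)) (carrier H) (carrier H)"
      using bij_betw_trans[OF bij_betw_trans[OF bij b(1)] b\<chi>] bij_betw_trans[OF bij_betw_trans[OF bij b(2)] b\<chi>] .
    moreover have "{u, v} \<in> edges ?G \<longleftrightarrow> {(\<chi> \<circ> (\<alpha> \<circ> \<psi>)) u, (\<chi> \<circ> (\<beta> \<circ> \<psi>)) v} \<in> edges ?G"
      if uv: "u \<in> carrier H" "v \<in> carrier H" for u v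
    proof -
      have "{u, v} \<in> edges ?G \<longleftrightarrow> \<beta> (\<psi> v) / \<alpha> (\<psi> u) \<in> S'"
        using edge[OF uv] linkD(1)[OF l im[OF uv(1)] im[OF uv(2)]] by simp
      also have "\<dots> \<longleftrightarrow> {\<chi> (\<alpha> (\<psi> u)), \<chi> (\<beta> (\<psi> v))} \<in> edges ?G"
        using edge[OF \<chi>(1) \<chi>(1)] \<chi>(2) tf_im[OF t] im uv by simp
      finally show ?thesis by simp
    qed
    ultimately have "tf_pair ?G (\<chi> \<circ> (\<alpha> \<circ> \<psi>)) (\<chi> \<circ> (\<beta> \<circ> \<psi>))" by (simp add: tf_pair_def vG)
    moreover have "(\<chi> \<circ> (\<alpha> \<circ> \<psi>)) (\<chi> x) \<noteq> (\<chi> \<circ> (\<beta> \<circ> \<psi>)) (\<chi> x)"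
    proof
      assume "(\<chi> \<circ> (\<alpha> \<circ> \<psi>)) (\<chi> x) = (\<chi> \<circ> (\<beta> \<circ> \<psi>)) (\<chi> x)"
      then have "\<chi> (\<alpha> x) = \<chi> (\<beta> x)" using \<chi>(2)[OF x(1)] by simp
      then show False using \<chi>(2) tf_im[OF t x(1)] x(2) by metis
    qed
    ultimately show "\<exists>\<alpha> \<beta>. tf_pair ?G \<alpha> \<beta> \<and> (\<exists>u\<in>carrier H. \<alpha> u \<noteq> \<beta> u)"
      using \<chi>(1)[OF x(1)] by blast
  qed
  have coset: "(S \<inter> H0) #>\<^bsub>H\<^esub> h = S \<inter> H0 \<longleftrightarrow> (\<forall>z\<in>rt ?m. z * \<psi> h \<in> S' \<longleftrightarrow> z \<in> S')" if h: "h \<in> H0" for h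
  proof -
    have hc: "h \<in> carrier H" and hm: "\<psi> h \<in> rt ?m" using h H0c \<psi>H0 by auto
    have mn: "rt ?m \<subseteq> rt ?n" by (rule rt_mono) simp
    have SH: "x \<in> S \<inter> H0 \<longleftrightarrow> \<psi> x \<in> S' \<inter> rt ?m" if "x \<in> carrier H" for x
      using S_iff[OF that] H0_iff[OF that] by blast
    have co: "x \<otimes>\<^bsub>H\<^esub> h \<in> (S \<inter> H0) #>\<^bsub>H\<^esub> h \<longleftrightarrow> x \<in> S \<inter> H0" if "x \<in> carrier H" for x
    proof
      assume "x \<otimes>\<^bsub>H\<^esub> h \<in> (S \<inter> H0) #>\<^bsub>H\<^esub> h"
      then obtain s where s: "s \<in> S \<inter> H0" "x \<otimes>\<^bsub>H\<^esub> h = s \<otimes>\<^bsub>H\<^esub> h" by (auto simp: r_coset_def)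
      then have "x = s" using that hc H0c by (metis IntD2 right_cancel subsetD)
      then show "x \<in> S \<inter> H0" using s by simp
    qed (auto simp: r_coset_def)
    show ?thesis
    proof
      assume eq: "(S \<inter> H0) #>\<^bsub>H\<^esub> h = S \<inter> H0"
      show "\<forall>z\<in>rt ?m. z * \<psi> h \<in> S' \<longleftrightarrow> z \<in> S'"
      proof
        fix z assume z: "z \<in> rt ?m"
        have zc: "\<chi> z \<in> carrier H" "\<psi> (\<chi> z) = z" using \<chi> z mn by auto
        have "\<psi> (\<chi> z \<otimes>\<^bsub>H\<^esub> h) = z * \<psi> h" using hom zc hc by simp
        then show "z * \<psi> h \<in> S' \<longleftrightarrow> z \<in> S'"
          using co[OF zc(1)] SH[OF zc(1)] SH[of "\<chi> z \<otimes>\<^bsub>H\<^esub> h"] eq zc hc rt_mult[OF z hm] z by simp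
      qed
    next
      assume per: "\<forall>z\<in>rt ?m. z * \<psi> h \<in> S' \<longleftrightarrow> z \<in> S'"
      show "(S \<inter> H0) #>\<^bsub>H\<^esub> h = S \<inter> H0"
      proof (intro equalityI subsetI)
        fix y assume "y \<in> (S \<inter> H0) #>\<^bsub>H\<^esub> h"
        then obtain s where s: "s \<in> S \<inter> H0" "y = s \<otimes>\<^bsub>H\<^esub> h" by (auto simp: r_coset_def)
        have sc: "s \<in> carrier H" using s H0c by blast
        have "\<psi> s \<in> S' \<inter> rt ?m" using SH[OF sc] s(1) by blast
        then have "\<psi> s * \<psi> h \<in> S' \<inter> rt ?m" using per rt_mult hm by blast
        then show "y \<in> S \<inter> H0" using SH[of y] hom[OF sc hc] s(2) sc hc by simp
      next
        fix y assume y: "y \<in> S \<inter> H0"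
        then have yc: "y \<in> carrier H" using H0c by blast
        define x where "x = y \<otimes>\<^bsub>H\<^esub> inv\<^bsub>H\<^esub> h"
        have xc: "x \<in> carrier H" and xy: "x \<otimes>\<^bsub>H\<^esub> h = y" using yc hc by (simp_all add: x_def m_assoc)
        have yy: "\<psi> x * \<psi> h = \<psi> y" using hom[OF xc hc] xy by simp
        then have "\<psi> x = \<psi> y / \<psi> h" using nz[OF hc] by (simp add: field_simps)
        then have xm: "\<psi> x \<in> rt ?m" using rt_divide hm SH[OF yc] y by auto
        have "\<psi> x * \<psi> h \<in> S'" using SH[OF yc] y yy by simp
        then have "\<psi> x \<in> S'" using per xm by blast
        then have "x \<in> S \<inter> H0" using SH[OF xc] xm by blast
        then show "y \<in> (S \<inter> H0) #>\<^bsub>H\<^esub> h" using co[OF xc] xy by simp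
      qed
    qed
  qed
  have iso: "graph_isomorphic ?G (Cay H (S #>\<^bsub>H\<^esub> b)) \<longleftrightarrow>
    (\<exists>\<phi>. bij_betw \<phi> (rt ?n) (rt ?n) \<and> (\<forall>x\<in>rt ?n. \<forall>y\<in>rt ?n. y / x \<in> S' \<longleftrightarrow> - (\<phi> y / \<phi> x) \<in> S'))"
  proof
    assume "graph_isomorphic ?G (Cay H (S #>\<^bsub>H\<^esub> b))"
    then obtain f where f: "bij_betw f (carrier H) (carrier H)"
      and e: "\<And>u v. u \<in> carrier H \<Longrightarrow> v \<in> carrier H \<Longrightarrow> {u, v} \<in> edges ?G \<longleftrightarrow> {f u, f v} \<in> edges (Cay H (S #>\<^bsub>H\<^esub> b))"
      unfolding graph_isomorphic_def graph_isos_def verts_Cay by blast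
    have fc: "f u \<in> carrier H" if "u \<in> carrier H" for u using f that bij_betwE by blast
    have "bij_betw (\<psi> \<circ> (f \<circ> \<chi>)) (rt ?n) (rt ?n)" using bij_betw_trans[OF bij_betw_trans[OF b\<chi> f] bij] .
    moreover have "y / x \<in> S' \<longleftrightarrow> - ((\<psi> \<circ> (f \<circ> \<chi>)) y / (\<psi> \<circ> (f \<circ> \<chi>)) x) \<in> S'" if xy: "x \<in> rt ?n" "y \<in> rt ?n" for x y
      using e[OF \<chi>(1)[OF xy(1)] \<chi>(1)[OF xy(2)]] edge[OF \<chi>(1)[OF xy(1)] \<chi>(1)[OF xy(2)]]
        edgeb[OF fc[OF \<chi>(1)[OF xy(1)]] fc[OF \<chi>(1)[OF xy(2)]]] \<chi>(2) xy by simp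
    ultimately show "\<exists>\<phi>. bij_betw \<phi> (rt ?n) (rt ?n) \<and> (\<forall>x\<in>rt ?n. \<forall>y\<in>rt ?n. y / x \<in> S' \<longleftrightarrow> - (\<phi> y / \<phi> x) \<in> S')"
      by blast
  next
    assume "\<exists>\<phi>. bij_betw \<phi> (rt ?n) (rt ?n) \<and> (\<forall>x\<in>rt ?n. \<forall>y\<in>rt ?n. y / x \<in> S' \<longleftrightarrow> - (\<phi> y / \<phi> x) \<in> S')"
    then obtain \<phi> where \<phi>: "bij_betw \<phi> (rt ?n) (rt ?n)"
      and e: "\<And>x y. x \<in> rt ?n \<Longrightarrow> y \<in> rt ?n \<Longrightarrow> y / x \<in> S' \<longleftrightarrow> - (\<phi> y / \<phi> x) \<in> S'" by blast
    have \<phi>c: "\<phi> x \<in> rt ?n" if "x \<in> rt ?n" for x using \<phi> that bij_betwE by blast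
    have "bij_betw (\<chi> \<circ> (\<phi> \<circ> \<psi>)) (carrier H) (carrier H)" using bij_betw_trans[OF bij_betw_trans[OF bij \<phi>] b\<chi>] .
    moreover have "{u, v} \<in> edges ?G \<longleftrightarrow> {(\<chi> \<circ> (\<phi> \<circ> \<psi>)) u, (\<chi> \<circ> (\<phi> \<circ> \<psi>)) v} \<in> edges (Cay H (S #>\<^bsub>H\<^esub> b))"
      if uv: "u \<in> carrier H" "v \<in> carrier H" for u v
      using edge[OF uv] e[OF im[OF uv(1)] im[OF uv(2)]]
        edgeb[OF \<chi>(1)[OF \<phi>c[OF im[OF uv(1)]]] \<chi>(1)[OF \<phi>c[OF im[OF uv(2)]]]] \<chi>(2) \<phi>c im uv by simp
    ultimately have "\<chi> \<circ> (\<phi> \<circ> \<psi>) \<in> graph_isos ?G (Cay H (S #>\<^bsub>H\<^esub> b))" by (simp add: graph_isos_def verts_Cay)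
    then show "graph_isomorphic ?G (Cay H (S #>\<^bsub>H\<^esub> b))" unfolding graph_isomorphic_def by blast
  qed
  show ?thesis
  proof
    assume "\<not> stable_graph ?G"
    then obtain \<alpha> \<beta> x where t: "(\<alpha>, \<beta>) \<in> tf ?n {S'}" "x \<in> rt ?n" "\<alpha> x \<noteq> \<beta> x" using unstable by blast
    \<comment> \<open>Otherwise every edge would join \<open>H0\<close> to its complement, and the
      graph would be bipartite.\<close>
    have "S' \<inter> rt ?m \<noteq> {}"
    proof
      assume em: "S' \<inter> rt ?m = {}"
      have "bipartite_graph ?G" unfolding bipartite_graph_def vG
      proof (rule exI[of _ H0], rule exI[of _ "carrier H - H0"], intro conjI ballI)
        fix E assume E: "E \<in> edges ?G"
        then obtain u v where uv: "u \<in> carrier H" "v \<in> carrier H" "E = {u, v}" using wf vG by blast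
        have q: "\<psi> v / \<psi> u \<notin> rt ?m" using edge[OF uv(1,2)] E uv(3) em by blast
        then have "\<not> (u \<in> H0 \<and> v \<in> H0)" using H0_iff uv rt_divide by blast
        moreover have "u \<in> H0 \<or> v \<in> H0"
        proof (rule ccontr)
          assume "\<not> (u \<in> H0 \<or> v \<in> H0)"
          then have "- \<psi> v \<in> rt ?m" "- \<psi> u \<in> rt ?m" using H0_iff uv rt_double_cases om im by blast+
          then have "- \<psi> v / - \<psi> u \<in> rt ?m" by (rule rt_divide)
          then show False using q by simp
        qed
        ultimately show "\<exists>a\<in>H0. \<exists>b\<in>carrier H - H0. E = {a, b}"
          using uv by (auto simp: insert_commute)
      qed (use H0c in auto)
      then show False using assms(15) by blast
    qed
    then obtain s where s: "s \<in> S'" "s \<in> rt ?m" by blast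
    from unstable_dichotomy[OF p refl S'n S'1 t]
    show "(e > 1 \<and> (\<exists>h \<in> H0. h \<noteq> \<one>\<^bsub>H\<^esub> \<and> (S \<inter> H0) #>\<^bsub>H\<^esub> h = S \<inter> H0)) \<or> graph_isomorphic ?G (Cay H (S #>\<^bsub>H\<^esub> b))"
    proof
      assume per: "\<forall>s \<in> S' \<inter> rt ?m. s \<notin> rt p \<and> (\<forall>u\<in>rt p. s * u \<in> S')"
      \<comment> \<open>For e = 1 the element s of S' and \<open>rt ?m\<close> would lie in
        \<open>rt p\<close>.\<close>
      have "e \<noteq> 1" using per s by auto
      then have e1: "e > 1" using assms(3) by simp
      have "card (rt p) > 1" using card_rt[of p] p1 by simp
      then obtain u where u: "u \<in> rt p" "u \<noteq> 1"
      proof -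
        have "rt p \<noteq> {1}" using \<open>card (rt p) > 1\<close> by auto
        then show ?thesis using that rt_1[of p] by blast
      qed
      have um: "u \<in> rt ?m" using u(1) rt_mono[of p ?m] assms(3) by (auto simp: dvd_power)
      then obtain h where h: "h \<in> H0" "\<psi> h = u" using \<psi>H0 by (metis imageE)
      have "h \<noteq> \<one>\<^bsub>H\<^esub>" using h u \<psi>1 by auto
      moreover have "z * u \<in> S' \<longleftrightarrow> z \<in> S'" if z: "z \<in> rt ?m" for z
      proof
        assume "z * u \<in> S'"
        moreover have "z * u \<in> rt ?m" using rt_mult z um by blast
        ultimately have "z * u * (1 / u) \<in> S'" using per rt_divide[OF rt_1 u(1)] by blast
        then show "z \<in> S'" using rt_nz[OF um m0] by simp
      qed (use per z u in blast)
      then have "(S \<inter> H0) #>\<^bsub>H\<^esub> h = S \<inter> H0" using coset[OF h(1)] h(2) by blast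
      ultimately show ?thesis using e1 h(1) by blast
    qed (use iso in blast)
  next
    assume "(e > 1 \<and> (\<exists>h \<in> H0. h \<noteq> \<one>\<^bsub>H\<^esub> \<and> (S \<inter> H0) #>\<^bsub>H\<^esub> h = S \<inter> H0)) \<or> graph_isomorphic ?G (Cay H (S #>\<^bsub>H\<^esub> b))"
    then show "\<not> stable_graph ?G"
    proof
      assume "e > 1 \<and> (\<exists>h \<in> H0. h \<noteq> \<one>\<^bsub>H\<^esub> \<and> (S \<inter> H0) #>\<^bsub>H\<^esub> h = S \<inter> H0)"
      then obtain h where h: "h \<in> H0" "h \<noteq> \<one>\<^bsub>H\<^esub>" "(S \<inter> H0) #>\<^bsub>H\<^esub> h = S \<inter> H0" by blast
      have hm: "\<psi> h \<in> rt ?m" "\<psi> h \<noteq> 1" using h H0c H0_iff inj[of h "\<one>\<^bsub>H\<^esub>"] \<psi>1 by auto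
      have "\<And>z. z \<in> rt ?m \<Longrightarrow> z * \<psi> h \<in> S' \<longleftrightarrow> z \<in> S'" using h coset by blast
      \<comment> \<open>The pair differs at 1, where only the first map multiplies by the nontrivial
        \<open>\<psi> h\<close>.\<close>
      from shifted_halves_tf[OF om hm(1) refl this] show ?thesis
        unfolding unstable by (rule bexI[rotated]) (use hm(2) in \<open>auto intro!: bexI[of _ 1]\<close>)
    next
      assume "graph_isomorphic ?G (Cay H (S #>\<^bsub>H\<^esub> b))"
      then obtain \<phi> where \<phi>: "bij_betw \<phi> (rt ?n) (rt ?n)"
        and e: "\<And>x y. x \<in> rt ?n \<Longrightarrow> y \<in> rt ?n \<Longrightarrow> y / x \<in> S' \<longleftrightarrow> - (\<phi> y / \<phi> x) \<in> S'" unfolding iso by blast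
      have "bij_betw uminus (rt ?n) (rt ?n)"
        by (rule bij_betw_byWitness[where f' = uminus]) (auto simp: rt_uminus)
      then have "bij_betw (uminus \<circ> \<phi>) (rt ?n) (rt ?n)" using bij_betw_trans[OF \<phi>] by blast
      \<comment> \<open>An isomorphism onto the graph of S b is the same as a pair whose second map
        is the negative of the first; it differs from the diagonal at every point.\<close>
      then have "(\<phi>, \<lambda>x. - \<phi> x) \<in> tf ?n {S'}" using \<phi> e by (simp add: tf_def link_def comp_def)
      then show ?thesis unfolding unstable
        by (rule bexI[rotated]) (use rt_nz[OF _ n0, of "\<phi> 1"] bij_betwE[OF \<phi>] in \<open>auto intro!: bexI[of _ 1]\<close>)
    qed
  qed
qed

end
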